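(* Let $0\le p\le2$ and $s<-\left(\frac32-\frac p4\right)=\frac p4-\frac32$. Then the flow map $u_0\mapsto u(t)$ of the Cauchy problem $$\partial_t u+\partial_x^3u+L_pu+u\,\partial_xu=0,\quad x\in\mathbb{R},\ t\ge 0,\qquad u(0,\cdot)=u_0,$$ is not $C^2$ at the origin from $H^s(\mathbb{R})$ to $H^s(\mathbb{R})$: there do not exist $T>0$ and a ball $B$ centered at the origin of $H^s(\mathbb{R})$ such that for every $t\in[0,T]$ the map $u_0\mapsto u(t)$, defined for smooth data $u_0\in B\cap H^\infty(\mathbb{R})$, extends to a map from $B$ to $H^s(\mathbb{R})$ that is $C^2$ at the origin.
   Context: $u=u(t,x)$ is real-valued, and $L_p$ is the Fourier multiplier in $x$ with symbol $|\xi|^p$: $\mathcal{F}_x\{L_pu\}(t,\xi)=|\xi|^p\mathcal{F}_xu(t,\xi)$. $H^s(\mathbb{R})$ is the inhomogeneous Sobolev space with norm $\|\langle\xi\rangle^s\hat f\|_{L^2}$, $\langle x\rangle=(1+|x|^2)^{1/2}$, and $H^\infty=\bigcap_sH^s$. For smooth data, $u$ is the solution of the integral equation $$u(t)=S_p(t)u_0-\tfrac12\int_0^tS_p(t-t')\partial_x(u^2)(t')\,dt',\qquad \mathcal{F}_x\{S_p(t)f\}(\xi)=e^{it\xi^3-t|\xi|^p}\hat f(\xi),\ t\ge0.$$ *)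

theory Defs
  imports "HOL-Analysis.Analysis" "HOL-Library.Function_Algebras" "HOL-Library.FuncSet"
begin

section \<open>Schwartz functions and tempered distributions on the real line\<close>

definition nderiv :: "nat \<Rightarrow> (real \<Rightarrow> 'a::real_normed_vector) \<Rightarrow> real \<Rightarrow> 'a" where
  "nderiv n f = ((\<lambda>g x. vector_derivative g (at x)) ^^ n) f"

definition smooth :: "(real \<Rightarrow> 'a::real_normed_vector) \<Rightarrow> bool" where
  "smooth f \<longleftrightarrow> (\<forall>n x. nderiv n f differentiable (at x))"

definition schwartz :: "(real \<Rightarrow> complex) set" where
  "schwartz = {\<phi>. smooth \<phi> \<and>
     (\<forall>j k. bdd_above (range (\<lambda>x. \<bar>x\<bar> ^ j * cmod (nderiv k \<phi> x))))}"

definition schwartz_seminorm :: "nat \<Rightarrow> nat \<Rightarrow> (real \<Rightarrow> complex) \<Rightarrow> real" where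
  "schwartz_seminorm j k \<phi> = (SUP x. \<bar>x\<bar> ^ j * cmod (nderiv k \<phi> x))"

definition fourier :: "(real \<Rightarrow> complex) \<Rightarrow> real \<Rightarrow> complex" where
  "fourier \<phi> \<xi> = (LINT x|lborel. exp (- \<i> * of_real (x * \<xi>)) * \<phi> x)"

text \<open>A distribution is a functional on the Schwartz space. It is made total by the value 0 outside
  that space, so that equality of functionals is equality of distributions. Sums and
  differences of distributions are the pointwise ones.\<close>

type_synonym dist = "(real \<Rightarrow> complex) \<Rightarrow> complex"

definition tempered :: "dist \<Rightarrow> bool" where
  "tempered V \<longleftrightarrow>
     (\<forall>\<phi>. \<phi> \<notin> schwartz \<longrightarrow> V \<phi> = 0) \<and>
     (\<forall>\<phi>\<in>schwartz. \<forall>\<psi>\<in>schwartz. V (\<lambda>x. \<phi> x + \<psi> x) = V \<phi> + V \<psi>) \<and>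
     (\<forall>c. \<forall>\<phi>\<in>schwartz. V (\<lambda>x. c * \<phi> x) = c * V \<phi>) \<and>
     (\<exists>C m. \<forall>\<phi>\<in>schwartz. cmod (V \<phi>) \<le> C * (\<Sum>j\<le>m. \<Sum>k\<le>m. schwartz_seminorm j k \<phi>))"

definition real_dist :: "dist \<Rightarrow> bool" where
  "real_dist V \<longleftrightarrow> (\<forall>\<phi>\<in>schwartz. V (\<lambda>x. cnj (\<phi> x)) = cnj (V \<phi>))"

definition dist_fourier :: "dist \<Rightarrow> dist" where
  "dist_fourier V = (\<lambda>\<phi>. if \<phi> \<in> schwartz then V (fourier \<phi>) else 0)"

text \<open>The distributional Fourier transform of \<open>V\<close> is the function \<open>g\<close>. Such a \<open>g\<close> is unique up to
  null sets, so \<open>hat V\<close> is determined almost everywhere.\<close>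

definition has_fourier_fun :: "dist \<Rightarrow> (real \<Rightarrow> complex) \<Rightarrow> bool" where
  "has_fourier_fun V g \<longleftrightarrow> g \<in> borel_measurable borel \<and>
     (\<forall>\<phi>\<in>schwartz. integrable lborel (\<lambda>\<xi>. g \<xi> * \<phi> \<xi>) \<and>
        dist_fourier V \<phi> = (LINT \<xi>|lborel. g \<xi> * \<phi> \<xi>))"

definition hat :: "dist \<Rightarrow> real \<Rightarrow> complex" where
  "hat V = (SOME g. has_fourier_fun V g)"

section \<open>Sobolev spaces of real-valued distributions\<close>

text \<open>The weight \<open>(1 + \<xi>\<^sup>2) powr s\<close> is \<open>\<langle>\<xi>\<rangle>\<close> to the power \<open>2s\<close>.\<close>

definition sobolev :: "real \<Rightarrow> dist set" where
  "sobolev s = {V. tempered V \<and> real_dist V \<and>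
     (\<exists>g. has_fourier_fun V g \<and>
        integrable lborel (\<lambda>\<xi>. (1 + \<xi>\<^sup>2) powr s * (cmod (g \<xi>))\<^sup>2))}"

definition sobolev_norm :: "real \<Rightarrow> dist \<Rightarrow> real" where
  "sobolev_norm s V = sqrt (LINT \<xi>|lborel. (1 + \<xi>\<^sup>2) powr s * (cmod (hat V \<xi>))\<^sup>2)"

definition sobolev_ball :: "real \<Rightarrow> real \<Rightarrow> dist set" where
  "sobolev_ball s r = {V \<in> sobolev s. sobolev_norm s V < r}"

definition dist_of :: "(real \<Rightarrow> real) \<Rightarrow> dist" where
  "dist_of f = (\<lambda>\<phi>. if \<phi> \<in> schwartz then LINT x|lborel. of_real (f x) * \<phi> x else 0)"

text \<open>Elements of \<open>H\<^sup>\<infinity>\<close> are taken as functions, through their smooth representatives.\<close>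

definition H_infinity :: "(real \<Rightarrow> real) set" where
  "H_infinity = {f. smooth f \<and>
     (\<forall>\<phi>\<in>schwartz. integrable lborel (\<lambda>x. of_real (f x) * \<phi> x)) \<and>
     (\<forall>\<sigma>. dist_of f \<in> sobolev \<sigma>)}"

section \<open>The integral equation\<close>

text \<open>The multiplier \<open>S\<^sub>p(t)\<close>, written with the inversion formula. It is applied only to functions
  in \<open>H\<^sup>\<infinity>\<close>, whose Fourier transform is integrable. For \<open>p = 0\<close> the convention \<open>0 powr 0 = 0\<close>
  affects the symbol only at \<open>\<xi> = 0\<close>.\<close>

definition semigroup :: "real \<Rightarrow> real \<Rightarrow> (real \<Rightarrow> real) \<Rightarrow> real \<Rightarrow> complex" where
  "semigroup p t f x = (1 / (2 * of_real pi)) *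
     (LINT \<xi>|lborel. exp (\<i> * of_real (x * \<xi>)) *
        (exp (\<i> * of_real (t * \<xi> ^ 3) - of_real (t * \<bar>\<xi>\<bar> powr p)) * hat (dist_of f) \<xi>))"

text \<open>\<open>u\<close> solves the integral equation on \<open>[0,T]\<close> with datum \<open>u0\<close>, in the class
  \<open>C([0,T]; H\<^sup>\<infinity>)\<close>.\<close>

definition is_solution :: "real \<Rightarrow> real \<Rightarrow> (real \<Rightarrow> real) \<Rightarrow> (real \<Rightarrow> real \<Rightarrow> real) \<Rightarrow> bool" where
  "is_solution p T u0 u \<longleftrightarrow>
     (\<forall>t\<in>{0..T}. u t \<in> H_infinity) \<and>
     (\<forall>\<sigma>. \<forall>t\<in>{0..T}.
        ((\<lambda>\<tau>. sobolev_norm \<sigma> (dist_of (u \<tau>) - dist_of (u t))) \<longlongrightarrow> 0) (at t within {0..T})) \<and>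
     (\<forall>t\<in>{0..T}. \<forall>x. complex_of_real (u t x) =
        semigroup p t u0 x -
        1/2 * (LINT \<tau>:{0..t}|lborel. semigroup p (t - \<tau>) (deriv (\<lambda>y. (u \<tau> y)\<^sup>2)) x))"

section \<open>Differentiability of maps between Sobolev spaces\<close>

definition sob_linear :: "real \<Rightarrow> (dist \<Rightarrow> dist) \<Rightarrow> bool" where
  "sob_linear s A \<longleftrightarrow> A \<in> sobolev s \<rightarrow> sobolev s \<and>
     (\<forall>h\<in>sobolev s. \<forall>k\<in>sobolev s. A (h + k) = A h + A k) \<and>
     (\<forall>c::real. \<forall>h\<in>sobolev s. A (\<lambda>\<phi>. c *\<^sub>R h \<phi>) = (\<lambda>\<phi>. c *\<^sub>R A h \<phi>))"

definition sob_bounded_linear :: "real \<Rightarrow> (dist \<Rightarrow> dist) \<Rightarrow> bool" where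
  "sob_bounded_linear s A \<longleftrightarrow> sob_linear s A \<and>
     (\<exists>C. \<forall>h\<in>sobolev s. sobolev_norm s (A h) \<le> C * sobolev_norm s h)"

definition sob_bounded_bilinear :: "real \<Rightarrow> (dist \<Rightarrow> dist \<Rightarrow> dist) \<Rightarrow> bool" where
  "sob_bounded_bilinear s A \<longleftrightarrow>
     (\<forall>h\<in>sobolev s. sob_linear s (A h)) \<and> (\<forall>k\<in>sobolev s. sob_linear s (\<lambda>h. A h k)) \<and>
     (\<exists>C. \<forall>h\<in>sobolev s. \<forall>k\<in>sobolev s.
        sobolev_norm s (A h k) \<le> C * sobolev_norm s h * sobolev_norm s k)"

definition has_frechet :: "real \<Rightarrow> (dist \<Rightarrow> dist) \<Rightarrow> dist \<Rightarrow> (dist \<Rightarrow> dist) \<Rightarrow> bool" where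
  "has_frechet s \<Phi> v A \<longleftrightarrow> sob_bounded_linear s A \<and>
     (\<forall>\<epsilon>>0. \<exists>\<delta>>0. \<forall>h\<in>sobolev_ball s \<delta>.
        sobolev_norm s (\<Phi> (v + h) - \<Phi> v - A h) \<le> \<epsilon> * sobolev_norm s h)"

text \<open>Frechet differentiability at \<open>v\<close> of an operator-valued map \<open>D\<close> in the operator norm, the
  derivative being viewed as a bounded bilinear map.\<close>

definition has_frechet_op ::
    "real \<Rightarrow> (dist \<Rightarrow> dist \<Rightarrow> dist) \<Rightarrow> dist \<Rightarrow> (dist \<Rightarrow> dist \<Rightarrow> dist) \<Rightarrow> bool" where
  "has_frechet_op s D v A \<longleftrightarrow> sob_bounded_bilinear s A \<and>
     (\<forall>\<epsilon>>0. \<exists>\<delta>>0. \<forall>h\<in>sobolev_ball s \<delta>. \<forall>k\<in>sobolev s.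
        sobolev_norm s (D (v + h) k - D v k - A h k)
          \<le> \<epsilon> * sobolev_norm s h * sobolev_norm s k)"

text \<open>\<open>\<Phi>\<close>, defined on the ball of radius \<open>r\<close>, is twice Frechet differentiable near the origin and its
  second derivative is continuous at the origin.\<close>

definition C2_at_origin :: "real \<Rightarrow> real \<Rightarrow> (dist \<Rightarrow> dist) \<Rightarrow> bool" where
  "C2_at_origin s r \<Phi> \<longleftrightarrow> (\<exists>\<rho> D D2. 0 < \<rho> \<and> \<rho> \<le> r \<and>
     (\<forall>v\<in>sobolev_ball s \<rho>. has_frechet s \<Phi> v (D v) \<and> has_frechet_op s D v (D2 v)) \<and>
     (\<forall>\<epsilon>>0. \<exists>\<delta>>0. \<forall>v\<in>sobolev_ball s (min \<delta> \<rho>). \<forall>h\<in>sobolev s. \<forall>k\<in>sobolev s.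
        sobolev_norm s (D2 v h k - D2 0 h k) \<le> \<epsilon> * sobolev_norm s h * sobolev_norm s k))"

section \<open>The flow map\<close>

text \<open>\<open>\<Phi>\<close> extends the map sending a smooth datum in the ball to the value at time \<open>t\<close> of
  its solution.\<close>

definition extends_flow ::
    "real \<Rightarrow> real \<Rightarrow> real \<Rightarrow> real \<Rightarrow> real \<Rightarrow> (dist \<Rightarrow> dist) \<Rightarrow> bool" where
  "extends_flow p T s r t \<Phi> \<longleftrightarrow>
     (\<forall>u0 u. u0 \<in> H_infinity \<and> dist_of u0 \<in> sobolev_ball s r \<and> is_solution p T u0 u \<longrightarrow>
        \<Phi> (dist_of u0) = dist_of (u t))"

end

theory Submission
  imports Defs "HOL-Probability.Probability"
begin

text \<open>The flow map fails to be \<open>C\<^sup>2\<close> because its second derivative at the origin would have to be the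
  second Picard iterate, and that bilinear operator is unbounded on \<open>H\<^sup>s\<close>. Feed it data whose Fourier
  transform is the indicator of \<open>N \<le> \<bar>\<xi>\<bar> \<le> N + \<gamma>\<close>. The two frequencies \<open>\<eta> \<approx> N\<close> and \<open>\<xi> - \<eta> \<approx> - N\<close> interact
  to produce the low frequencies \<open>\<xi> \<approx> \<gamma>\<close>, with oscillation
  \<open>\<eta>\<^sup>3 + (\<xi> - \<eta>)\<^sup>3 - \<xi>\<^sup>3 = - 3\<xi>\<eta>(\<xi> - \<eta>) \<approx> \<gamma>N\<^sup>2\<close> and damping rate of size \<open>N powr p\<close>. For \<open>\<gamma>\<close> a small
  multiple of \<open>N powr (p - 2)\<close> the oscillation is dominated by the damping, so the time integral is about
  \<open>N powr (- p)\<close> and nothing cancels: the iterate is at least a multiple of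
  \<open>\<gamma> \<cdot> \<gamma> \<cdot> N powr (- p)\<close> on a set of measure about \<open>\<gamma>\<close> (\<open>second_iterate_lower_bound\<close>). The square of the
  \<open>H\<^sup>s\<close> norm of the datum is about \<open>\<gamma> N powr (2s)\<close>, so boundedness would give
  \<open>\<gamma> powr (3/2) \<le> C N powr (p + 2s)\<close>, that is, a bound on \<open>N powr (p/2 - 3 - 2s)\<close> uniform in \<open>N\<close>, which is
  false for \<open>s < p/4 - 3/2\<close>.

  The hypothesis on the flow map says something only about data for which smooth solutions exist on the
  whole interval \<open>[0,T]\<close>, so such solutions must be constructed, including for small \<open>p\<close>, where the semigroup
  does not regain the derivative lost in the nonlinearity. Data with compactly supported Fourier
  transform \<open>f\<close> make this elementary. The solution with datum \<open>\<epsilon> f\<close> is a power series in \<open>\<epsilon>\<close> whose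
  coefficients are the Duhamel iterates; the \<open>n\<close>-th one is supported in \<open>\<bar>\<xi>\<bar> \<le> (n + 1)R\<close>, so the
  derivative costs a factor \<open>n + 1\<close>, and the time integration of \<open>\<tau>\<^sup>n\<close> returns \<open>1 / (n + 1)\<close>. A Catalan type
  majorant then gives geometric bounds (\<open>a_bound\<close>, \<open>majorant_geometric\<close>) and, for small \<open>\<epsilon>\<close>, a solution on
  \<open>[0,T]\<close> (\<open>solution\<close>).

  The series also yields the derivatives. Pairing the Fourier transform of the value of the flow with
  a bounded weight supported in \<open>\<bar>\<xi>\<bar> \<le> 1\<close> is a continuous functional on \<open>H\<^sup>s\<close>, and along the line \<open>\<epsilon> f\<close>
  it is a scalar power series in \<open>\<epsilon>\<close>. Differentiating it twice identifies the second Frechet derivative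
  in the direction of the datum, tested against that weight, with twice the first Duhamel iterate
  (\<open>second_derivative_of_flow\<close>).

  Everything takes place on the frequency side. The link with distributions is Fourier inversion for
  Schwartz functions and the uniqueness of the function representing a distributional Fourier transform
  (\<open>fourier_inversion\<close>, \<open>has_fourier_fun_unique\<close>).\<close>

section \<open>Schwartz functions\<close>

lemma nderiv_0 [simp]: "nderiv 0 f = f"
  by (simp add: nderiv_def)

lemma nderiv_Suc: "nderiv (Suc n) f = (\<lambda>x. vector_derivative (nderiv n f) (at x))"
  by (simp add: nderiv_def)

text \<open>Iterated derivatives are computed by guessing the whole sequence of them: this one criterion
  replaces an induction in each closure property below.\<close>

lemma nderiv_sequence:
  assumes "\<And>n x. (D n has_vector_derivative D (Suc n) x) (at x)"
  shows "nderiv n (D 0) = D n"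
proof (induction n)
  case (Suc n)
  show ?case
    unfolding nderiv_Suc Suc by (intro ext vector_derivative_at assms)
qed simp

lemma smooth_sequence:
  assumes "\<And>n x. (D n has_vector_derivative D (Suc n) x) (at x)"
  shows "smooth (D 0)"
proof -
  have "nderiv n (D 0) = D n" for n
    by (rule nderiv_sequence) (rule assms)
  then show ?thesis
    unfolding smooth_def using assms by (metis differentiableI_vector)
qed

lemma smooth_has_vector_derivative:
  assumes "smooth f"
  shows "(nderiv n f has_vector_derivative nderiv (Suc n) f x) (at x)"
  using assms by (simp add: smooth_def nderiv_Suc vector_derivative_works)

lemma schwartz_sequence:
  assumes "\<And>n x. (D n has_vector_derivative D (Suc n) x) (at x)"
    and "\<And>j k. \<exists>C. \<forall>x. \<bar>x\<bar> ^ j * cmod (D k x) \<le> C"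
  shows "D 0 \<in> schwartz"
  using smooth_sequence[of D] nderiv_sequence[of D] assms
  by (auto simp: schwartz_def bdd_above_def)

lemma schwartz_deriv:
  "\<phi> \<in> schwartz \<Longrightarrow> (nderiv n \<phi> has_vector_derivative nderiv (Suc n) \<phi> x) (at x)"
  by (simp add: schwartz_def smooth_has_vector_derivative)

lemma schwartz_bound:
  assumes "\<phi> \<in> schwartz"
  shows "\<bar>x\<bar> ^ j * cmod (nderiv k \<phi> x) \<le> schwartz_seminorm j k \<phi>"
  unfolding schwartz_seminorm_def
  by (rule cSUP_upper) (use assms in \<open>auto simp: schwartz_def\<close>)

lemma schwartz_add:
  assumes "\<phi> \<in> schwartz" "\<psi> \<in> schwartz"
  shows "(\<lambda>x. \<phi> x + \<psi> x) \<in> schwartz"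
proof -
  let ?D = "\<lambda>n x. nderiv n \<phi> x + nderiv n \<psi> x"
  have "?D 0 \<in> schwartz"
  proof (rule schwartz_sequence)
    show "(?D n has_vector_derivative ?D (Suc n) x) (at x)" for n x
      by (intro has_vector_derivative_add schwartz_deriv assms)
    show "\<exists>C. \<forall>x. \<bar>x\<bar> ^ j * cmod (?D k x) \<le> C" for j k
    proof (intro exI allI)
      fix x
      have "\<bar>x\<bar> ^ j * cmod (?D k x) \<le> \<bar>x\<bar> ^ j * (cmod (nderiv k \<phi> x) + cmod (nderiv k \<psi> x))"
        by (intro mult_left_mono norm_triangle_ineq) auto
      also have "\<dots> \<le> schwartz_seminorm j k \<phi> + schwartz_seminorm j k \<psi>"
        unfolding distrib_left by (intro add_mono schwartz_bound assms)
      finally show "\<bar>x\<bar> ^ j * cmod (?D k x) \<le> schwartz_seminorm j k \<phi> + schwartz_seminorm j k \<psi>" .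
    qed
  qed
  then show ?thesis by simp
qed

lemma schwartz_cmult:
  assumes "\<phi> \<in> schwartz"
  shows "(\<lambda>x. c * \<phi> x) \<in> schwartz"
proof -
  let ?D = "\<lambda>n x. c * nderiv n \<phi> x"
  have "?D 0 \<in> schwartz"
  proof (rule schwartz_sequence)
    show "(?D n has_vector_derivative ?D (Suc n) x) (at x)" for n x
      by (intro has_vector_derivative_mult_right schwartz_deriv assms)
    show "\<exists>C. \<forall>x. \<bar>x\<bar> ^ j * cmod (?D k x) \<le> C" for j k
    proof (intro exI allI)
      fix x
      have "\<bar>x\<bar> ^ j * cmod (?D k x) = cmod c * (\<bar>x\<bar> ^ j * cmod (nderiv k \<phi> x))"
        by (simp add: norm_mult)
      also have "\<dots> \<le> cmod c * schwartz_seminorm j k \<phi>"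
        by (intro mult_left_mono schwartz_bound assms) auto
      finally show "\<bar>x\<bar> ^ j * cmod (?D k x) \<le> cmod c * schwartz_seminorm j k \<phi>" .
    qed
  qed
  then show ?thesis by simp
qed

lemma schwartz_cnj:
  assumes "\<phi> \<in> schwartz"
  shows "(\<lambda>x. cnj (\<phi> x)) \<in> schwartz"
proof -
  let ?D = "\<lambda>n x. cnj (nderiv n \<phi> x)"
  have "?D 0 \<in> schwartz"
  proof (rule schwartz_sequence)
    show "(?D n has_vector_derivative ?D (Suc n) x) (at x)" for n x
      by (intro has_vector_derivative_cnj schwartz_deriv assms)
    show "\<exists>C. \<forall>x. \<bar>x\<bar> ^ j * cmod (?D k x) \<le> C" for j k
      using schwartz_bound[OF assms] by auto
  qed
  then show ?thesis by simp
qed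

lemma schwartz_nderiv:
  assumes "\<phi> \<in> schwartz"
  shows "nderiv m \<phi> \<in> schwartz"
proof -
  let ?D = "\<lambda>n. nderiv (n + m) \<phi>"
  have "?D 0 \<in> schwartz"
  proof (rule schwartz_sequence)
    show "(?D n has_vector_derivative ?D (Suc n) x) (at x)" for n x
      using schwartz_deriv[OF assms] by simp
    show "\<exists>C. \<forall>x. \<bar>x\<bar> ^ j * cmod (?D k x) \<le> C" for j k
      using schwartz_bound[OF assms] by auto
  qed
  then show ?thesis by simp
qed

lemma nderiv_nderiv:
  assumes "\<phi> \<in> schwartz"
  shows "nderiv n (nderiv m \<phi>) = nderiv (n + m) \<phi>"
  using nderiv_sequence[of "\<lambda>n. nderiv (n + m) \<phi>" n] schwartz_deriv[OF assms] by simp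

lemma schwartz_mult_x:
  assumes "\<phi> \<in> schwartz"
  shows "(\<lambda>x. of_real x * \<phi> x) \<in> schwartz"
proof -
  let ?D = "\<lambda>n x. of_real x * nderiv n \<phi> x + of_nat n * nderiv (n - 1) \<phi> x"
  have "?D 0 \<in> schwartz"
  proof (rule schwartz_sequence)
    show "(?D n has_vector_derivative ?D (Suc n) x) (at x)" for n x
    proof -
      have of_real_deriv: "((\<lambda>x. complex_of_real x) has_vector_derivative 1) (at x)"
        using has_vector_derivative_of_real[OF DERIV_ident] by simp
      have A: "((\<lambda>x. of_real x * nderiv n \<phi> x) has_vector_derivative
            of_real x * nderiv (Suc n) \<phi> x + 1 * nderiv n \<phi> x) (at x)"
        by (intro has_vector_derivative_mult of_real_deriv schwartz_deriv assms)
      have B: "((\<lambda>x. of_nat n * nderiv (n - 1) \<phi> x) has_vector_derivative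
            of_nat n * nderiv n \<phi> x) (at x)"
        using has_vector_derivative_mult_right[OF schwartz_deriv[OF assms], of "of_nat n" "n - 1" x]
        by (cases n) auto
      show ?thesis
        using has_vector_derivative_add[OF A B] by (simp add: algebra_simps)
    qed
    show "\<exists>C. \<forall>x. \<bar>x\<bar> ^ j * cmod (?D k x) \<le> C" for j k
    proof (intro exI allI)
      fix x
      have "\<bar>x\<bar> ^ j * cmod (?D k x) \<le> \<bar>x\<bar> ^ j * (\<bar>x\<bar> * cmod (nderiv k \<phi> x) + k * cmod (nderiv (k-1) \<phi> x))"
        by (intro mult_left_mono norm_triangle_le) (auto simp: norm_mult)
      also have "\<dots> = \<bar>x\<bar> ^ Suc j * cmod (nderiv k \<phi> x) + k * (\<bar>x\<bar> ^ j * cmod (nderiv (k-1) \<phi> x))"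
        by (simp add: algebra_simps)
      also have "\<dots> \<le> schwartz_seminorm (Suc j) k \<phi> + k * schwartz_seminorm j (k-1) \<phi>"
        by (intro add_mono mult_left_mono schwartz_bound assms) auto
      finally show "\<bar>x\<bar> ^ j * cmod (?D k x) \<le> schwartz_seminorm (Suc j) k \<phi> + k * schwartz_seminorm j (k-1) \<phi>" .
    qed
  qed
  then show ?thesis by simp
qed

lemma schwartz_mult_monomial:
  assumes "\<phi> \<in> schwartz"
  shows "(\<lambda>x. (- \<i> * of_real x) ^ k * \<phi> x) \<in> schwartz"
proof (induction k)
  case (Suc k)
  have "(\<lambda>x. - \<i> * (of_real x * ((- \<i> * of_real x) ^ k * \<phi> x))) \<in> schwartz"
    by (intro schwartz_cmult schwartz_mult_x Suc)
  then show ?case by (simp add: mult_ac)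
qed (use assms in simp)

lemma power_gaussian_bounded: "\<bar>x::real\<bar> ^ j * exp (- (x\<^sup>2) / 2) \<le> exp (real j ^ 2 / 2)"
proof -
  have "\<bar>x\<bar> ^ j \<le> exp \<bar>x\<bar> ^ j"
    by (intro power_mono) (use exp_ge_add_one_self[of "\<bar>x\<bar>"] in linarith)+
  also have "\<dots> = exp (real j * \<bar>x\<bar>)"
    by (simp add: exp_of_nat_mult)
  also have "\<dots> \<le> exp (real j ^ 2 / 2 + x\<^sup>2 / 2)"
    using zero_le_power2[of "real j - \<bar>x\<bar>"] by (simp add: power2_diff)
  finally have "\<bar>x\<bar> ^ j * exp (- (x\<^sup>2) / 2) \<le> exp (real j ^ 2 / 2 + x\<^sup>2 / 2) * exp (- (x\<^sup>2) / 2)"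
    by (intro mult_right_mono) auto
  then show ?thesis by (simp flip: exp_add)
qed

text \<open>Every derivative of a modulated Gaussian is a polynomial times the same function, so these bounds
  give membership in the Schwartz space.\<close>

lemma poly_gaussian_bounded:
  "\<exists>C. \<forall>x. \<bar>x\<bar> ^ j * (cmod (poly p (of_real x)) * exp (- (x\<^sup>2) / 2)) \<le> C"
proof (intro exI allI)
  fix x :: real
  have "cmod (poly p (of_real x)) \<le> (\<Sum>i\<le>degree p. cmod (coeff p i) * \<bar>x\<bar> ^ i)"
    unfolding poly_altdef by (rule sum_norm_le) (simp add: norm_mult norm_power)
  then have "\<bar>x\<bar> ^ j * (cmod (poly p (of_real x)) * exp (- (x\<^sup>2) / 2))
      \<le> \<bar>x\<bar> ^ j * ((\<Sum>i\<le>degree p. cmod (coeff p i) * \<bar>x\<bar> ^ i) * exp (- (x\<^sup>2) / 2))"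
    by (intro mult_left_mono mult_right_mono) auto
  also have "\<dots> = (\<Sum>i\<le>degree p. cmod (coeff p i) * (\<bar>x\<bar> ^ (i + j) * exp (- (x\<^sup>2) / 2)))"
    by (simp add: sum_distrib_left sum_distrib_right power_add mult_ac)
  also have "\<dots> \<le> (\<Sum>i\<le>degree p. cmod (coeff p i) * exp (real (i + j) ^ 2 / 2))"
    by (intro sum_mono mult_left_mono power_gaussian_bounded) auto
  finally show "\<bar>x\<bar> ^ j * (cmod (poly p (of_real x)) * exp (- (x\<^sup>2) / 2))
      \<le> (\<Sum>i\<le>degree p. cmod (coeff p i) * exp (real (i + j) ^ 2 / 2))" .
qed

lemma schwartz_modulated_gaussian:
  "(\<lambda>x. exp (\<i> * of_real (x * \<xi>)) * of_real (exp (- (x\<^sup>2) / 2))) \<in> schwartz"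
proof -
  define e where "e = (\<lambda>z. exp (\<i> * of_real \<xi> * z - z\<^sup>2 / 2))"
  define P where "P = (\<lambda>n. ((\<lambda>p. pderiv p + [:\<i> * of_real \<xi>, -1:] * p) ^^ n) 1)"
  define D where "D = (\<lambda>n x. poly (P n) (of_real x) * e (of_real x))"
  have P_Suc: "P (Suc n) = pderiv (P n) + [:\<i> * of_real \<xi>, -1:] * P n" for n
    by (simp add: P_def)
  have norm_e: "cmod (e (of_real x)) = exp (- (x\<^sup>2) / 2)" for x
    by (simp add: e_def norm_exp_eq_Re power2_eq_square)
  have "D 0 \<in> schwartz"
  proof (rule schwartz_sequence)
    show "(D n has_vector_derivative D (Suc n) x) (at x)" for n x
    proof -
      have "((\<lambda>z. poly (P n) z * e z) has_field_derivative
          poly (P (Suc n)) (of_real x) * e (of_real x)) (at (of_real x))"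
        unfolding e_def P_Suc
        by (auto intro!: derivative_eq_intros simp: algebra_simps)
      from has_vector_derivative_real_field[OF this] show ?thesis
        by (simp add: D_def)
    qed
    show "\<exists>C. \<forall>x. \<bar>x\<bar> ^ j * cmod (D k x) \<le> C" for j k
      using poly_gaussian_bounded[of j "P k"] by (simp add: D_def norm_mult norm_e)
  qed
  moreover have "D 0 = (\<lambda>x. exp (\<i> * of_real (x * \<xi>)) * of_real (exp (- (x\<^sup>2) / 2)))"
    by (auto simp: D_def P_def e_def fun_eq_iff mult_ac exp_of_real[symmetric] simp flip: exp_add)
  ultimately show ?thesis by simp
qed

section \<open>Rapidly decreasing functions and their Fourier integrals\<close>

text \<open>The Lorentz profile is an integrable majorant that also behaves well under convolution (see
  \<open>lorentz_product\<close>).\<close>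

definition lorentz :: "real \<Rightarrow> real" where
  "lorentz x = inverse (1 + x\<^sup>2)"

lemma lorentz_pos: "0 < lorentz x"
  by (simp add: lorentz_def add_pos_nonneg)

lemma lorentz_nonneg [simp]: "0 \<le> lorentz x"
  using lorentz_pos[of x] by simp

lemma lorentz_measurable [measurable]: "lorentz \<in> borel_measurable borel"
  unfolding lorentz_def by measurable

lemma lorentz_integrable: "integrable lborel lorentz"
proof -
  have "lorentz = (\<lambda>x. inverse (1 + x\<^sup>2))"
    by (simp add: lorentz_def fun_eq_iff)
  then show ?thesis
    using integrable_inverse_1_plus_square by (simp add: set_integrable_def einterval_def)
qed

text \<open>The frequency-side counterpart of smoothness. It is decay without regularity in \<open>\<xi>\<close>, because the
  data have discontinuous Fourier transforms.\<close>

definition rapid :: "(real \<Rightarrow> complex) \<Rightarrow> bool" where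
  "rapid g \<longleftrightarrow> g \<in> borel_measurable borel \<and> (\<forall>k. \<exists>C. \<forall>x. \<bar>x\<bar> ^ k * cmod (g x) \<le> C)"

lemma rapid_measurable [measurable_dest]: "rapid g \<Longrightarrow> g \<in> borel_measurable borel"
  by (simp add: rapid_def)

lemma rapid_bound:
  assumes "rapid g"
  obtains C where "C \<ge> 0" "\<And>x. \<bar>x\<bar> ^ k * cmod (g x) \<le> C"
proof -
  obtain C where C: "\<And>x. \<bar>x\<bar> ^ k * cmod (g x) \<le> C"
    using assms by (auto simp: rapid_def)
  have "0 \<le> \<bar>0::real\<bar> ^ k * cmod (g 0)" by simp
  also have "\<dots> \<le> C" by (rule C)
  finally show ?thesis using C that by blast
qed

lemma rapid_mult_power:
  assumes "rapid g" 
  shows "rapid (\<lambda>x. (c * of_real x) ^ n * g x)"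
  unfolding rapid_def
proof (intro conjI allI)
  show "(\<lambda>x. (c * of_real x) ^ n * g x) \<in> borel_measurable borel"
    using assms by measurable
  fix k
  obtain C where C: "\<And>x. \<bar>x\<bar> ^ (k + n) * cmod (g x) \<le> C"
    using rapid_bound[OF assms] by metis
  have "\<bar>x\<bar> ^ k * cmod ((c * of_real x) ^ n * g x) \<le> cmod c ^ n * C" for x
  proof -
    have "\<bar>x\<bar> ^ k * cmod ((c * of_real x) ^ n * g x) = cmod c ^ n * (\<bar>x\<bar> ^ (k + n) * cmod (g x))"
      by (simp add: norm_mult norm_power power_mult_distrib power_add)
    also have "\<dots> \<le> cmod c ^ n * C"
      by (intro mult_left_mono C) auto
    finally show ?thesis .
  qed
  then show "\<exists>C. \<forall>x. \<bar>x\<bar> ^ k * cmod ((c * of_real x) ^ n * g x) \<le> C" by blast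
qed

lemma rapid_dominated:
  assumes "rapid g" "h \<in> borel_measurable borel" "\<And>x. cmod (h x) \<le> B * cmod (g x)"
  shows "rapid h"
  unfolding rapid_def
proof (intro conjI allI)
  fix k
  obtain C where C: "\<And>x. \<bar>x\<bar> ^ k * cmod (g x) \<le> C"
    using rapid_bound[OF assms(1)] by metis
  have "\<bar>x\<bar> ^ k * cmod (h x) \<le> \<bar>B\<bar> * C" for x
  proof -
    have "cmod (h x) \<le> \<bar>B\<bar> * cmod (g x)"
      by (rule order_trans[OF assms(3)]) (intro mult_right_mono, auto)
    then have "\<bar>x\<bar> ^ k * cmod (h x) \<le> \<bar>x\<bar> ^ k * (\<bar>B\<bar> * cmod (g x))"
      by (intro mult_left_mono) auto
    also have "\<dots> = \<bar>B\<bar> * (\<bar>x\<bar> ^ k * cmod (g x))" by simp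
    also have "\<dots> \<le> \<bar>B\<bar> * C" by (intro mult_left_mono C) auto
    finally show ?thesis .
  qed
  then show "\<exists>C. \<forall>x. \<bar>x\<bar> ^ k * cmod (h x) \<le> C" by blast
qed (rule assms)

lemma rapid_le_lorentz:
  assumes "rapid g"
  obtains C where "C \<ge> 0" "\<And>x. cmod (g x) \<le> C * lorentz x"
proof -
  obtain A B where A: "A \<ge> 0" "\<And>x. \<bar>x\<bar> ^ 0 * cmod (g x) \<le> A"
    and B: "B \<ge> 0" "\<And>x. \<bar>x\<bar> ^ 2 * cmod (g x) \<le> B"
    using rapid_bound[OF assms] by metis
  have "cmod (g x) \<le> (A + B) * lorentz x" for x
  proof -
    have "(1 + x\<^sup>2) * cmod (g x) \<le> A + B"
      using A(2)[of x] B(2)[of x] by (simp add: distrib_right)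
    then show ?thesis
      using lorentz_pos[of x] by (simp add: lorentz_def field_simps add_pos_nonneg)
  qed
  then show ?thesis using that[of "A + B"] A B by auto
qed

lemma integrable_le_lorentz:
  fixes g :: "real \<Rightarrow> 'a::{banach, second_countable_topology}"
  assumes [measurable]: "g \<in> borel_measurable borel" and "\<And>x. norm (g x) \<le> C * lorentz x"
  shows "integrable lborel g"
  by (rule Bochner_Integration.integrable_bound[OF integrable_mult_right[OF lorentz_integrable, of C]])
     (use assms(2) in \<open>auto intro!: AE_I2 order_trans[OF assms(2)]\<close>)

lemma rapid_integrable: "rapid g \<Longrightarrow> integrable lborel g"
  by (metis integrable_le_lorentz rapid_le_lorentz rapid_measurable)

lemma rapid_integrable_mult:
  assumes "rapid g" "h \<in> borel_measurable borel" "\<And>x. cmod (h x) \<le> B"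
  shows "integrable lborel (\<lambda>x. h x * g x)"
  by (rule rapid_integrable[OF rapid_dominated[OF assms(1), of _ B]])
     (use assms in \<open>auto simp: norm_mult intro!: mult_right_mono borel_measurable_times rapid_measurable\<close>)

lemma schwartz_rapid:
  assumes "\<phi> \<in> schwartz"
  shows "rapid \<phi>"
proof -
  have "isCont \<phi> x" for x
    using schwartz_deriv[OF assms, of 0 x] has_vector_derivative_continuous by auto
  then have "\<phi> \<in> borel_measurable borel"
    by (intro borel_measurable_continuous_onI continuous_at_imp_continuous_on) auto
  then show ?thesis
    using schwartz_bound[OF assms, of _ _ 0] by (auto simp: rapid_def)
qed

lemma norm_exp_ii [simp]: "cmod (exp (\<i> * of_real x)) = 1" "cmod (exp (- (\<i> * of_real x))) = 1"
  by (simp_all add: norm_exp_eq_Re)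

lemma fourier_integrable:
  "rapid g \<Longrightarrow> integrable lborel (\<lambda>x. exp (- \<i> * of_real (x * \<xi>)) * g x)"
  by (rule rapid_integrable_mult[where B=1]) auto

lemma norm_fourier_le:
  assumes "rapid g"
  shows "cmod (fourier g \<xi>) \<le> (LINT x|lborel. cmod (g x))"
  unfolding fourier_def
  by (rule order_trans[OF integral_norm_bound]) (simp add: norm_mult)

text \<open>The second-order Taylor bound for the exponential gives an error quadratic in the increment,
  controlled by the second moment of \<open>g\<close>.\<close>

lemma fourier_deriv:
  assumes "rapid g"
  shows "(fourier g has_vector_derivative fourier (\<lambda>x. - \<i> * of_real x * g x) \<xi>) (at \<xi>)"
proof -
  define M where "M = (LINT x|lborel. cmod ((1 * of_real x) ^ 2 * g x))"
  have r1: "rapid (\<lambda>x. - \<i> * of_real x * g x)" and r2: "rapid (\<lambda>x. (1 * of_real x)^2 * g x)"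
    using rapid_mult_power[OF assms, of "-\<i>" 1] rapid_mult_power[OF assms, of 1 2] by auto
  have est: "cmod (fourier g \<eta> - fourier g \<xi> - (\<eta> - \<xi>) *\<^sub>R fourier (\<lambda>x. - \<i> * of_real x * g x) \<xi>)
      \<le> (\<eta> - \<xi>)\<^sup>2 * M" for \<eta>
  proof -
    let ?d = "\<lambda>x. exp (- \<i> * of_real (x * \<eta>)) * g x - exp (- \<i> * of_real (x * \<xi>)) * g x
        - (\<eta> - \<xi>) *\<^sub>R (exp (- \<i> * of_real (x * \<xi>)) * (- \<i> * of_real x * g x))"
    have eq: "fourier g \<eta> - fourier g \<xi> - (\<eta> - \<xi>) *\<^sub>R fourier (\<lambda>x. - \<i> * of_real x * g x) \<xi>
        = (LINT x|lborel. ?d x)"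
      unfolding fourier_def
      by (subst Bochner_Integration.integral_diff integral_scaleR_right[symmetric];
          (intro Bochner_Integration.integrable_diff integrable_scaleR_right fourier_integrable assms r1)?)+ simp
    have "cmod (?d x) \<le> (\<eta> - \<xi>)\<^sup>2 * cmod ((1 * of_real x) ^ 2 * g x)" for x
    proof -
      define \<theta> where "\<theta> = - (x * (\<eta> - \<xi>))"
      have "?d x = exp (- \<i> * of_real (x * \<xi>)) * g x * (iexp \<theta> - (\<Sum>k\<le>1. (\<i> * \<theta>)^k / fact k))"
        by (simp add: \<theta>_def scaleR_conv_of_real algebra_simps flip: exp_add)
      then have "cmod (?d x) = cmod (g x) * cmod (iexp \<theta> - (\<Sum>k\<le>1. (\<i> * \<theta>)^k / fact k))"
        by (simp add: norm_mult)
      also have "\<dots> \<le> cmod (g x) * (\<bar>\<theta>\<bar> ^ Suc 1 / fact (Suc 1))"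
        by (intro mult_left_mono iexp_approx1) auto
      also have "\<dots> \<le> cmod (g x) * \<theta>\<^sup>2"
        by (intro mult_left_mono) (auto simp: power2_eq_square)
      also have "\<dots> = (\<eta> - \<xi>)\<^sup>2 * cmod ((1 * of_real x) ^ 2 * g x)"
        by (simp add: \<theta>_def norm_mult norm_power power_mult_distrib)
      finally show ?thesis .
    qed
    then have "(LINT x|lborel. cmod (?d x)) \<le> (LINT x|lborel. (\<eta> - \<xi>)\<^sup>2 * cmod ((1 * of_real x) ^ 2 * g x))"
      by (intro integral_mono integrable_norm integrable_mult_right Bochner_Integration.integrable_diff
          integrable_scaleR_right fourier_integrable assms r1 rapid_integrable r2)
    then show ?thesis
      unfolding eq M_def by (intro order_trans[OF integral_norm_bound]) simp
  qed
  have M: "M \<ge> 0" unfolding M_def by (rule Bochner_Integration.integral_nonneg) auto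
  show ?thesis
    unfolding has_vector_derivative_def
  proof (rule has_derivativeI_sandwich[of 1])
    show "bounded_linear (\<lambda>h. h *\<^sub>R fourier (\<lambda>x. - \<i> * of_real x * g x) \<xi>)"
      by (rule bounded_linear_scaleR_left)
    show "0 < (1::real)" by simp
    show "((\<lambda>\<eta>. \<bar>\<eta> - \<xi>\<bar> * M) \<longlongrightarrow> 0) (at \<xi>)"
      by (auto intro!: tendsto_eq_intros)
    fix \<eta> assume "\<eta> \<noteq> \<xi>"
    then show "cmod (fourier g \<eta> - fourier g \<xi> - (\<eta> - \<xi>) *\<^sub>R fourier (\<lambda>x. - \<i> * of_real x * g x) \<xi>) / norm (\<eta> - \<xi>)
        \<le> \<bar>\<eta> - \<xi>\<bar> * M"
      using est[of \<eta>] by (simp add: divide_le_eq power2_eq_square mult_ac)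
  qed
qed

lemma fourier_derivs:
  assumes "rapid g"
  shows "(fourier (\<lambda>x. (- \<i> * of_real x) ^ n * g x) has_vector_derivative
     fourier (\<lambda>x. (- \<i> * of_real x) ^ Suc n * g x) \<xi>) (at \<xi>)"
  using fourier_deriv[OF rapid_mult_power[OF assms, of "- \<i>" n], of \<xi>] by (simp add: mult_ac)

text \<open>Integration by parts, in the form that the derivative of \<open>exp (- \<i> x \<xi>) \<phi>(x)\<close> has integral zero.\<close>

lemma fourier_of_deriv:
  assumes "\<phi> \<in> schwartz"
  shows "fourier (nderiv 1 \<phi>) \<xi> = \<i> * of_real \<xi> * fourier \<phi> \<xi>"
proof -
  define F where "F = (\<lambda>x. exp (- \<i> * of_real (x * \<xi>)) * \<phi> x)"
  define f where "f = (\<lambda>x. exp (- \<i> * of_real (x * \<xi>)) * nderiv 1 \<phi> x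
      - \<i> * of_real \<xi> * (exp (- \<i> * of_real (x * \<xi>)) * \<phi> x))"
  have sch: "nderiv 1 \<phi> \<in> schwartz" by (rule schwartz_nderiv[OF assms])
  have deriv: "(F has_vector_derivative f x) (at x)" for x
  proof -
    have "((\<lambda>z. exp (- \<i> * (z * of_real \<xi>))) has_field_derivative
        - \<i> * of_real \<xi> * exp (- \<i> * (of_real x * of_real \<xi>))) (at (of_real x))"
      by (auto intro!: derivative_eq_intros)
    from has_vector_derivative_real_field[OF this]
    have e: "((\<lambda>x. exp (- \<i> * of_real (x * \<xi>))) has_vector_derivative
        - \<i> * of_real \<xi> * exp (- \<i> * of_real (x * \<xi>))) (at x)" by simp
    show ?thesis
      using has_vector_derivative_mult[OF e schwartz_deriv[OF assms, of 0 x]]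
      unfolding F_def f_def by (simp add: algebra_simps)
  qed
  have int1: "integrable lborel (\<lambda>x. exp (- \<i> * of_real (x * \<xi>)) * nderiv 1 \<phi> x)"
    and int2: "integrable lborel (\<lambda>x. exp (- \<i> * of_real (x * \<xi>)) * \<phi> x)"
    by (intro fourier_integrable schwartz_rapid sch assms)+
  have int: "integrable lborel f"
    unfolding f_def by (intro Bochner_Integration.integrable_diff integrable_mult_right int1 int2)
  obtain C where C: "C \<ge> 0" "\<And>x. cmod (\<phi> x) \<le> C * lorentz x"
    using rapid_le_lorentz[OF schwartz_rapid[OF assms]] by metis
  have F_le: "norm (F x) \<le> C * lorentz x" for x
    using C(2)[of x] by (simp add: F_def norm_mult)
  have lim_top: "(F \<longlongrightarrow> 0) at_top"
    by (rule Lim_null_comparison[OF always_eventually[OF allI[OF F_le]]])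
       (unfold lorentz_def, real_asymp)
  have lim_bot: "(F \<longlongrightarrow> 0) at_bot"
    by (rule Lim_null_comparison[OF always_eventually[OF allI[OF F_le]]])
       (unfold lorentz_def, real_asymp)
  have "(LBINT x=-\<infinity>..\<infinity>. f x) = 0 - 0"
  proof (rule interval_integral_FTC_integrable[where F=F])
    show "isCont f x" for x
    proof -
      have "isCont (nderiv 1 \<phi>) x" "isCont \<phi> x"
        using schwartz_deriv[OF assms, of 0 x] schwartz_deriv[OF assms, of 1 x]
          has_vector_derivative_continuous by fastforce+
      then show ?thesis unfolding f_def by (intro continuous_intros)
    qed
    show "set_integrable lborel (einterval (-\<infinity>) \<infinity>) f"
      using int by (simp add: set_integrable_def einterval_def)
    show "((F \<circ> real_of_ereal) \<longlongrightarrow> 0) (at_right (-\<infinity>))" "((F \<circ> real_of_ereal) \<longlongrightarrow> 0) (at_left \<infinity>)"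
      using lim_top lim_bot by (simp_all add: ereal_tendsto_simps)
  qed (use deriv in auto)
  then have "integral\<^sup>L lborel f = 0"
    by (simp add: interval_lebesgue_integral_def set_lebesgue_integral_def einterval_def)
  moreover have "integral\<^sup>L lborel f = fourier (nderiv 1 \<phi>) \<xi> - \<i> * of_real \<xi> * fourier \<phi> \<xi>"
    unfolding f_def fourier_def
    by (subst Bochner_Integration.integral_diff;
        (intro integrable_mult_right int1 int2)?) (simp only: integral_mult_right_zero)
  ultimately show ?thesis by simp
qed

lemma fourier_of_nderiv:
  assumes "\<phi> \<in> schwartz"
  shows "fourier (nderiv j \<phi>) \<xi> = (\<i> * of_real \<xi>) ^ j * fourier \<phi> \<xi>"
proof (induction j)
  case (Suc j)
  have "fourier (nderiv (Suc j) \<phi>) \<xi> = fourier (nderiv 1 (nderiv j \<phi>)) \<xi>"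
    by (simp add: nderiv_nderiv[OF assms])
  also have "\<dots> = \<i> * of_real \<xi> * fourier (nderiv j \<phi>) \<xi>"
    by (rule fourier_of_deriv[OF schwartz_nderiv[OF assms]])
  finally show ?case using Suc by simp
qed simp

lemma fourier_schwartz:
  assumes "\<phi> \<in> schwartz"
  shows "fourier \<phi> \<in> schwartz"
proof -
  let ?D = "\<lambda>n. fourier (\<lambda>x. (- \<i> * of_real x) ^ n * \<phi> x)"
  have "?D 0 \<in> schwartz"
  proof (rule schwartz_sequence)
    show "(?D n has_vector_derivative ?D (Suc n) x) (at x)" for n x
      by (rule fourier_derivs[OF schwartz_rapid[OF assms]])
    show "\<exists>C. \<forall>x. \<bar>x\<bar> ^ j * cmod (?D k x) \<le> C" for j k
    proof (intro exI allI)
      fix x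
      define \<psi> where "\<psi> = (\<lambda>x. (- \<i> * of_real x) ^ k * \<phi> x)"
      have \<psi>: "\<psi> \<in> schwartz"
        unfolding \<psi>_def by (rule schwartz_mult_monomial[OF assms])
      have "\<bar>x\<bar> ^ j * cmod (fourier \<psi> x) = cmod (fourier (nderiv j \<psi>) x)"
        by (simp add: fourier_of_nderiv[OF \<psi>] norm_mult norm_power)
      also have "\<dots> \<le> (LINT x|lborel. cmod (nderiv j \<psi> x))"
        by (intro norm_fourier_le schwartz_rapid schwartz_nderiv \<psi>)
      finally show "\<bar>x\<bar> ^ j * cmod (?D k x) \<le> (LINT x|lborel.
          cmod (nderiv j (\<lambda>x. (- \<i> * of_real x) ^ k * \<phi> x) x))"
        unfolding \<psi>_def .
    qed
  qed
  then show ?thesis by simp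
qed

section \<open>Fourier inversion and uniqueness\<close>

lemma integrable_prod_bound:
  fixes f :: "real \<Rightarrow> real \<Rightarrow> complex"
  assumes meas: "(\<lambda>(x, y). f x y) \<in> borel_measurable (lborel \<Otimes>\<^sub>M lborel)"
    and u: "integrable lborel u" and v: "integrable lborel v"
    and le: "\<And>x y. cmod (f x y) \<le> u x * v y"
  shows "integrable (lborel \<Otimes>\<^sub>M lborel) (\<lambda>(x, y). f x y)"
proof -
  have [measurable]: "u \<in> borel_measurable borel" "v \<in> borel_measurable borel"
    using borel_measurable_integrable[OF u] borel_measurable_integrable[OF v] by simp_all
  have "integrable (lborel \<Otimes>\<^sub>M lborel) (\<lambda>(x, y). u x * v y)"
  proof (rule lborel_pair.Fubini_integrable)
    show "integrable lborel (\<lambda>x. LINT y|lborel. norm (case (x, y) of (x, y) \<Rightarrow> u x * v y))"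
      using u by (simp add: abs_mult)
    show "AE x in lborel. integrable lborel (\<lambda>y. case (x, y) of (x, y) \<Rightarrow> u x * v y)"
      using v by simp
  qed simp
  then show ?thesis
    by (rule Bochner_Integration.integrable_bound)
       (use meas le in \<open>auto intro!: AE_I2 order_trans[OF le]\<close>)
qed

lemma fourier_gaussian:
  "(LINT x|lborel. exp (\<i> * of_real (t * x)) * of_real (exp (- (x\<^sup>2) / 2)))
     = of_real (sqrt (2 * pi) * exp (- (t\<^sup>2) / 2))"
proof -
  have "char std_normal_distribution t
      = (LINT x|lborel. std_normal_density x *\<^sub>R exp (\<i> * of_real (t * x)))"
    unfolding char_def by (subst integral_density) auto
  also have "\<dots> = (LINT x|lborel. (1 / sqrt (2 * pi)) *\<^sub>R
      (exp (\<i> * of_real (t * x)) * of_real (exp (- (x\<^sup>2) / 2))))"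
    by (simp add: std_normal_density_def scaleR_conv_of_real mult_ac)
  also have "\<dots> = (1 / sqrt (2 * pi)) *\<^sub>R
      (LINT x|lborel. exp (\<i> * of_real (t * x)) * of_real (exp (- (x\<^sup>2) / 2)))"
    by (rule integral_scaleR_right)
  finally show ?thesis
    unfolding char_std_normal_distribution
    by (simp add: scaleR_conv_of_real field_simps)
qed

lemma gaussian_integrable: "integrable lborel (\<lambda>x::real. exp (- (x\<^sup>2) / 2))"
proof -
  have "integrable lborel (\<lambda>x. sqrt (2 * pi) * std_normal_density x)"
    using std_normal_moment_even[of 0] by (intro integrable_mult_right) (simp add: has_bochner_integral_iff)
  then show ?thesis by (simp add: std_normal_density_def)
qed

lemma fourier_scaled_gaussian:
  assumes "\<sigma> > 0"
  shows "(LINT x|lborel. exp (\<i> * of_real (t * x)) * of_real (exp (- ((x / \<sigma>)\<^sup>2) / 2)))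
     = of_real (\<sigma> * sqrt (2 * pi) * exp (- ((\<sigma> * t)\<^sup>2) / 2))"
proof -
  have "(LINT x|lborel. exp (\<i> * of_real (t * x)) * of_real (exp (- ((x / \<sigma>)\<^sup>2) / 2)))
     = \<bar>\<sigma>\<bar> *\<^sub>R (LINT x|lborel. exp (\<i> * of_real (t * (0 + \<sigma> * x))) * of_real (exp (- (((0 + \<sigma> * x) / \<sigma>)\<^sup>2) / 2)))"
    by (rule lborel_integral_real_affine) (use assms in simp)
  also have "\<dots> = \<sigma> *\<^sub>R (LINT x|lborel. exp (\<i> * of_real ((\<sigma> * t) * x)) * of_real (exp (- (x\<^sup>2) / 2)))"
    using assms by (simp add: mult_ac)
  finally show ?thesis
    unfolding fourier_gaussian by (simp add: scaleR_conv_of_real)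
qed

text \<open>The double integral in the inversion formula does not converge absolutely; a Gaussian factor of
  width \<open>\<sigma>\<close> makes it do so, and Fubini turns the expression into an average of \<open>\<phi>\<close> against a Gaussian of width
  \<open>1 / \<sigma>\<close> around \<open>\<xi>\<close>. Letting \<open>\<sigma>\<close> tend to infinity gives \<open>fourier_inversion\<close>.\<close>

lemma gauss_regularized_inversion:
  assumes \<phi>: "rapid \<phi>" and \<sigma>: "\<sigma> > 0"
  shows "(LINT x|lborel. exp (\<i> * of_real (x * \<xi>)) * fourier \<phi> x * of_real (exp (- ((x / \<sigma>)\<^sup>2) / 2)))
    = of_real (sqrt (2 * pi)) * (LINT z|lborel. \<phi> (\<xi> + z / \<sigma>) * of_real (exp (- (z\<^sup>2) / 2)))"
proof -
  let ?G = "\<lambda>x. exp (- ((x / \<sigma>)\<^sup>2) / 2)"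
  let ?f = "\<lambda>x y. exp (\<i> * of_real (x * \<xi>)) * of_real (?G x) * (exp (- \<i> * of_real (y * x)) * \<phi> y)"
  have [measurable]: "\<phi> \<in> borel_measurable borel" using \<phi> by (rule rapid_measurable)
  have G: "integrable lborel ?G"
    using lborel_integrable_real_affine[OF gaussian_integrable, of "1 / \<sigma>" 0] \<sigma> by simp
  have int: "integrable (lborel \<Otimes>\<^sub>M lborel) (\<lambda>(x, y). ?f x y)"
    by (rule integrable_prod_bound[OF _ G integrable_norm[OF rapid_integrable[OF \<phi>]]])
       (auto simp: norm_mult)
  have "(LINT x|lborel. exp (\<i> * of_real (x * \<xi>)) * fourier \<phi> x * of_real (?G x))
      = (LINT x|lborel. LINT y|lborel. ?f x y)"
    unfolding fourier_def
    by (subst integral_mult_right_zero) (simp add: mult_ac)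
  also have "\<dots> = (LINT y|lborel. LINT x|lborel. ?f x y)"
    by (rule lborel_pair.Fubini_integral[OF int, symmetric])
  also have "\<dots> = (LINT y|lborel. \<phi> y * (LINT x|lborel. exp (\<i> * of_real ((\<xi> - y) * x)) * of_real (?G x)))"
  proof -
    have "?f x y = \<phi> y * (exp (\<i> * of_real ((\<xi> - y) * x)) * of_real (?G x))" for x y
    proof -
      have "exp (\<i> * of_real ((\<xi> - y) * x)) = exp (\<i> * of_real (x * \<xi>)) * exp (- \<i> * of_real (y * x))"
        by (simp add: algebra_simps flip: exp_add)
      then show ?thesis by (simp only: mult_ac)
    qed
    then show ?thesis by (simp only: integral_mult_right_zero)
  qed
  also have "\<dots> = (LINT y|lborel. \<phi> y * of_real (\<sigma> * sqrt (2 * pi) * exp (- ((\<sigma> * (\<xi> - y))\<^sup>2) / 2)))"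
    by (subst fourier_scaled_gaussian[OF \<sigma>]) simp
  also have "\<dots> = \<bar>1 / \<sigma>\<bar> *\<^sub>R (LINT z|lborel. \<phi> (\<xi> + 1 / \<sigma> * z) *
      of_real (\<sigma> * sqrt (2 * pi) * exp (- ((\<sigma> * (\<xi> - (\<xi> + 1 / \<sigma> * z)))\<^sup>2) / 2)))"
    by (rule lborel_integral_real_affine) (use \<sigma> in simp)
  also have "\<dots> = (LINT z|lborel. of_real (sqrt (2 * pi)) * (\<phi> (\<xi> + z / \<sigma>) * of_real (exp (- (z\<^sup>2) / 2))))"
    using \<sigma> by (subst integral_scaleR_right[symmetric]) (simp add: scaleR_conv_of_real mult_ac)
  also have "\<dots> = of_real (sqrt (2 * pi)) * (LINT z|lborel. \<phi> (\<xi> + z / \<sigma>) * of_real (exp (- (z\<^sup>2) / 2)))"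
    by (rule integral_mult_right_zero)
  finally show ?thesis .
qed

lemma fourier_inversion:
  assumes \<phi>: "\<phi> \<in> schwartz"
  shows "(LINT x|lborel. exp (\<i> * of_real (x * \<xi>)) * fourier \<phi> x) = of_real (2 * pi) * \<phi> \<xi>"
proof -
  have r: "rapid \<phi>" "rapid (fourier \<phi>)"
    using \<phi> fourier_schwartz schwartz_rapid by blast+
  have [measurable]: "\<phi> \<in> borel_measurable borel" "fourier \<phi> \<in> borel_measurable borel"
    using r by (auto intro: rapid_measurable)
  obtain B where B: "\<And>x. cmod (\<phi> x) \<le> B"
    using rapid_bound[OF r(1), of 0] by auto
  have cont: "isCont \<phi> x" for x
    using schwartz_deriv[OF \<phi>, of 0 x] has_vector_derivative_continuous by auto
  let ?L = "\<lambda>n. (LINT x|lborel. exp (\<i> * of_real (x * \<xi>)) * fourier \<phi> x * of_real (exp (- ((x / Suc n)\<^sup>2) / 2)))"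
  let ?R = "\<lambda>n. of_real (sqrt (2 * pi)) * (LINT z|lborel. \<phi> (\<xi> + z / Suc n) * of_real (exp (- (z\<^sup>2) / 2)))"
  have inv: "(\<lambda>n. z / Suc n) \<longlonglongrightarrow> 0" for z :: real
    by (rule LIMSEQ_Suc[OF lim_const_over_n])
  have L: "?L \<longlonglongrightarrow> (LINT x|lborel. exp (\<i> * of_real (x * \<xi>)) * fourier \<phi> x)"
  proof (rule integral_dominated_convergence)
    show "integrable lborel (\<lambda>x. cmod (fourier \<phi> x))"
      by (intro integrable_norm rapid_integrable r)
    show "AE x in lborel. (\<lambda>n. exp (\<i> * of_real (x * \<xi>)) * fourier \<phi> x * of_real (exp (- ((x / Suc n)\<^sup>2) / 2)))
        \<longlonglongrightarrow> exp (\<i> * of_real (x * \<xi>)) * fourier \<phi> x"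
    proof (intro AE_I2)
      fix x
      have "(\<lambda>n. exp (\<i> * of_real (x * \<xi>)) * fourier \<phi> x * of_real (exp (- ((x / Suc n)\<^sup>2) / 2)))
        \<longlonglongrightarrow> exp (\<i> * of_real (x * \<xi>)) * fourier \<phi> x * of_real (exp (- (0\<^sup>2) / 2))"
        by (intro tendsto_intros inv) simp
      then show "(\<lambda>n. exp (\<i> * of_real (x * \<xi>)) * fourier \<phi> x * of_real (exp (- ((x / Suc n)\<^sup>2) / 2)))
        \<longlonglongrightarrow> exp (\<i> * of_real (x * \<xi>)) * fourier \<phi> x" by simp
    qed
    show "AE x in lborel. norm (exp (\<i> * of_real (x * \<xi>)) * fourier \<phi> x * of_real (exp (- ((x / Suc n)\<^sup>2) / 2)))
        \<le> cmod (fourier \<phi> x)" for n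
      by (intro AE_I2) (simp add: norm_mult mult_left_le)
  qed measurable
  have R: "?R \<longlonglongrightarrow> of_real (sqrt (2 * pi)) * (LINT z|lborel. \<phi> \<xi> * of_real (exp (- (z\<^sup>2) / 2)))"
  proof (intro tendsto_mult tendsto_const integral_dominated_convergence)
    show "integrable lborel (\<lambda>z::real. B * exp (- (z\<^sup>2) / 2))"
      by (intro integrable_mult_right gaussian_integrable)
    show "AE z in lborel. (\<lambda>n. \<phi> (\<xi> + z / Suc n) * of_real (exp (- (z\<^sup>2) / 2)))
        \<longlonglongrightarrow> \<phi> \<xi> * of_real (exp (- (z\<^sup>2) / 2))"
    proof (intro AE_I2 tendsto_mult tendsto_const)
      fix z :: real
      have "(\<lambda>n. \<xi> + z / Suc n) \<longlonglongrightarrow> \<xi> + 0" by (intro tendsto_intros inv)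
      then show "(\<lambda>n. \<phi> (\<xi> + z / Suc n)) \<longlonglongrightarrow> \<phi> \<xi>"
        using isCont_tendsto_compose[OF cont] by simp
    qed
    show "AE z in lborel. norm (\<phi> (\<xi> + z / Suc n) * of_real (exp (- (z\<^sup>2) / 2))) \<le> B * exp (- (z\<^sup>2) / 2)" for n
      by (intro AE_I2) (auto simp: norm_mult intro!: mult_right_mono B)
  qed measurable
  have "?L n = ?R n" for n
    by (rule gauss_regularized_inversion[OF r(1)]) simp
  then have "?R \<longlonglongrightarrow> (LINT x|lborel. exp (\<i> * of_real (x * \<xi>)) * fourier \<phi> x)"
    using L by (simp only:)
  note lim = LIMSEQ_unique[OF this R]
  have gauss0: "(LINT z|lborel. \<phi> \<xi> * of_real (exp (- (z\<^sup>2) / 2))) = \<phi> \<xi> * of_real (sqrt (2 * pi))"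
    using fourier_gaussian[of 0] by (simp only: integral_mult_right_zero) simp
  have "(LINT x|lborel. exp (\<i> * of_real (x * \<xi>)) * fourier \<phi> x)
      = of_real (sqrt (2 * pi)) * (\<phi> \<xi> * of_real (sqrt (2 * pi)))"
    unfolding lim gauss0 ..
  also have "\<dots> = of_real (sqrt (2 * pi) * sqrt (2 * pi)) * \<phi> \<xi>"
    by (simp only: of_real_mult mult_ac)
  finally show ?thesis by simp
qed

lemma char_density:
  fixes f :: "real \<Rightarrow> real"
  assumes [measurable]: "f \<in> borel_measurable borel" and "\<And>x. 0 \<le> f x"
  shows "char (density lborel f) t = (LINT x|lborel. of_real (f x) * exp (\<i> * of_real (t * x)))"
  unfolding char_def by (subst integral_density) (use assms in \<open>auto simp: scaleR_conv_of_real\<close>)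

lemma real_distribution_density:
  fixes f :: "real \<Rightarrow> real"
  assumes "integrable lborel f" "\<And>x. 0 \<le> f x" "integral\<^sup>L lborel f = 1"
  shows "real_distribution (density lborel f)"
proof -
  have "prob_space (density lborel f)"
    by (rule prob_spaceI)
       (use assms borel_measurable_integrable[OF assms(1)] in
         \<open>simp add: emeasure_density nn_integral_eq_integral\<close>)
  then show ?thesis
    by (simp add: real_distribution_def real_distribution_axioms_def)
qed

text \<open>The positive and negative parts of \<open>H\<close> have the same total mass (take \<open>t = 0\<close>); normalized, they are
  densities of two probability measures with equal characteristic functions, to which Levy's
  uniqueness theorem applies.\<close>

lemma real_AE_zero_of_fourier_zero:
  fixes H :: "real \<Rightarrow> real"
  assumes int: "integrable lborel H"
    and zero: "\<And>t. (LINT x|lborel. of_real (H x) * exp (\<i> * of_real (t * x))) = 0"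
  shows "AE x in lborel. H x = 0"
proof -
  have [measurable]: "H \<in> borel_measurable borel"
    using borel_measurable_integrable[OF int] by simp
  define P where "P = (\<lambda>x. max 0 (H x))"
  define N where "N = (\<lambda>x. max 0 (- H x))"
  have H_eq: "H x = P x - N x" and PN: "0 \<le> P x" "0 \<le> N x" for x
    by (auto simp: P_def N_def max_def)
  have P: "integrable lborel P" and N: "integrable lborel N"
    unfolding P_def N_def using int by auto
  have [measurable]: "P \<in> borel_measurable borel" "N \<in> borel_measurable borel"
    by (auto simp: P_def N_def)
  have ci: "integrable lborel (\<lambda>x. of_real (f x) * exp (\<i> * of_real (t * x)))"
    if "integrable lborel f" for f :: "real \<Rightarrow> real" and t
    using borel_measurable_integrable[OF that]
    by (intro Bochner_Integration.integrable_bound[OF that]) (auto simp: norm_mult)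
  have eq: "(LINT x|lborel. of_real (P x) * exp (\<i> * of_real (t * x)))
      = (LINT x|lborel. of_real (N x) * exp (\<i> * of_real (t * x)))" for t
    using zero[of t] Bochner_Integration.integral_diff[OF ci[OF P, of t] ci[OF N, of t]]
    by (simp add: H_eq algebra_simps)
  define m where "m = integral\<^sup>L lborel P"
  have mN: "m = integral\<^sup>L lborel N"
    using eq[of 0] unfolding m_def by simp
  have "m \<ge> 0" unfolding m_def by (rule Bochner_Integration.integral_nonneg) (rule PN)
  then consider "m = 0" | "m > 0" by linarith
  then have "AE x in lborel. P x = N x"
  proof cases
    case 1
    have "AE x in lborel. P x = 0" "AE x in lborel. N x = 0"
      using integral_nonneg_eq_0_iff_AE[OF P] integral_nonneg_eq_0_iff_AE[OF N] PN 1 mN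
      by (auto simp: m_def)
    then show ?thesis by eventually_elim simp
  next
    case 2
    have dist: "real_distribution (density lborel (\<lambda>x. ennreal (f x / m)))"
      if "integrable lborel f" "\<And>x. 0 \<le> f x" "integral\<^sup>L lborel f = m" for f
      by (rule real_distribution_density) (use that 2 in auto)
    have ch: "char (density lborel (\<lambda>x. ennreal (f x / m))) t
        = (LINT x|lborel. of_real (f x) * exp (\<i> * of_real (t * x))) / of_real m"
      if "integrable lborel f" "\<And>x. 0 \<le> f x" for f t
    proof -
      have [measurable]: "f \<in> borel_measurable borel"
        using borel_measurable_integrable[OF that(1)] by simp
      show ?thesis
        by (subst char_density) (use that 2 in auto)
    qed
    have "density lborel (\<lambda>x. ennreal (P x / m)) = density lborel (\<lambda>x. ennreal (N x / m))"
    proof (rule Levy_uniqueness[OF dist dist])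
      show "char (density lborel (\<lambda>x. ennreal (P x / m))) = char (density lborel (\<lambda>x. ennreal (N x / m)))"
        by (rule ext) (simp only: ch[OF P PN(1)] ch[OF N PN(2)] eq)
    qed (simp_all only: P N PN m_def[symmetric] mN[symmetric])
    then have "AE x in lborel. ennreal (P x / m) = ennreal (N x / m)"
      by (intro sigma_finite_measure.density_unique[OF sigma_finite_lborel]) auto
    then show ?thesis
      by eventually_elim (use PN 2 in auto)
  qed
  then show ?thesis by eventually_elim (simp add: H_eq)
qed

lemma AE_zero_of_fourier_zero:
  assumes int: "integrable lborel g" and zero: "\<And>\<xi>. fourier g \<xi> = 0"
  shows "AE x in lborel. g x = 0"
proof -
  have e: "integrable lborel (\<lambda>x. exp (\<i> * of_real (t * x)) * h x)"
    if "integrable lborel h" for t and h :: "real \<Rightarrow> complex"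
    using borel_measurable_integrable[OF that]
    by (intro Bochner_Integration.integrable_bound[OF that]) (auto simp: norm_mult)
  have z1: "(LINT x|lborel. exp (\<i> * of_real (t * x)) * g x) = 0" for t
    using zero[of "- t"] by (simp add: fourier_def mult_ac)
  have z2: "(LINT x|lborel. exp (\<i> * of_real (t * x)) * cnj (g x)) = 0" for t
  proof -
    have "(LINT x|lborel. exp (\<i> * of_real (t * x)) * cnj (g x))
        = (LINT x|lborel. cnj (exp (\<i> * of_real ((- t) * x)) * g x))"
      by (simp add: exp_cnj)
    also have "\<dots> = cnj (LINT x|lborel. exp (\<i> * of_real ((- t) * x)) * g x)"
      by (rule Bochner_Integration.integral_cnj)
    finally show ?thesis unfolding z1 by simp
  qed
  have cg: "integrable lborel (\<lambda>x. cnj (g x))" using int by simp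
  have "AE x in lborel. Re (g x) = 0"
  proof (rule real_AE_zero_of_fourier_zero)
    fix t
    have "(LINT x|lborel. of_real (Re (g x)) * exp (\<i> * of_real (t * x)))
        = (LINT x|lborel. (exp (\<i> * of_real (t * x)) * g x + exp (\<i> * of_real (t * x)) * cnj (g x)) / 2)"
      by (intro Bochner_Integration.integral_cong refl)
         (simp only: distrib_left[symmetric] complex_add_cnj, simp)
    also have "\<dots> = 0"
      using z1[of t] z2[of t]
      by (simp only: integral_divide_zero Bochner_Integration.integral_add[OF e[OF int] e[OF cg]]) simp
    finally show "(LINT x|lborel. of_real (Re (g x)) * exp (\<i> * of_real (t * x))) = 0" .
  qed (use int in simp)
  moreover have "AE x in lborel. Im (g x) = 0"
  proof (rule real_AE_zero_of_fourier_zero)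
    fix t
    have "(LINT x|lborel. of_real (Im (g x)) * exp (\<i> * of_real (t * x)))
        = (LINT x|lborel. (exp (\<i> * of_real (t * x)) * g x - exp (\<i> * of_real (t * x)) * cnj (g x)) / (2 * \<i>))"
      by (intro Bochner_Integration.integral_cong refl)
         (simp only: right_diff_distrib[symmetric] complex_diff_cnj, simp add: mult_ac)
    also have "\<dots> = 0"
      using z1[of t] z2[of t]
      by (simp only: integral_divide_zero Bochner_Integration.integral_diff[OF e[OF int] e[OF cg]]) simp
    finally show "(LINT x|lborel. of_real (Im (g x)) * exp (\<i> * of_real (t * x))) = 0" .
  qed (use int in simp)
  ultimately show ?thesis by eventually_elim (simp add: complex_eq_iff)
qed

text \<open>Modulated Gaussians are enough test functions: testing the difference against them says that
  its product with a Gaussian has vanishing Fourier transform.\<close>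

lemma has_fourier_fun_unique:
  assumes g: "has_fourier_fun V g" and h: "has_fourier_fun V h"
  shows "AE x in lborel. g x = h x"
proof -
  define \<gamma> where "\<gamma> = (\<lambda>x::real. complex_of_real (exp (- (x\<^sup>2) / 2)))"
  define \<phi> where "\<phi> = (\<lambda>\<xi> x. exp (\<i> * of_real (x * \<xi>)) * \<gamma> x)"
  have \<phi>: "\<phi> \<xi> \<in> schwartz" for \<xi>
    unfolding \<phi>_def \<gamma>_def by (rule schwartz_modulated_gaussian)
  have gi: "integrable lborel (\<lambda>x. g x * \<phi> \<xi> x)" and hi: "integrable lborel (\<lambda>x. h x * \<phi> \<xi> x)"
    and eq: "(LINT x|lborel. g x * \<phi> \<xi> x) = (LINT x|lborel. h x * \<phi> \<xi> x)" for \<xi>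
    using g h \<phi>[of \<xi>] by (auto simp: has_fourier_fun_def)
  have "AE x in lborel. (g x - h x) * \<gamma> x = 0"
  proof (rule AE_zero_of_fourier_zero)
    show "integrable lborel (\<lambda>x. (g x - h x) * \<gamma> x)"
      using Bochner_Integration.integrable_diff[OF gi[of 0] hi[of 0]]
      by (simp add: \<phi>_def left_diff_distrib)
    show "fourier (\<lambda>x. (g x - h x) * \<gamma> x) \<xi> = 0" for \<xi>
      using Bochner_Integration.integral_diff[OF gi[of "-\<xi>"] hi[of "-\<xi>"]] eq[of "-\<xi>"]
      by (simp add: fourier_def \<phi>_def algebra_simps)
  qed
  then show ?thesis by eventually_elim (simp add: \<gamma>_def)
qed

section \<open>Inverse Fourier integrals as elements of the Sobolev spaces\<close>

definition ift :: "(real \<Rightarrow> complex) \<Rightarrow> real \<Rightarrow> complex" where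
  "ift g x = 1 / (2 * of_real pi) * (LINT \<xi>|lborel. exp (\<i> * of_real (x * \<xi>)) * g \<xi>)"

text \<open>Real-valued functions are needed for the data and the solutions; on Hermitian functions nothing is
  lost by taking the real part (\<open>ift_real\<close>).\<close>

definition rift :: "(real \<Rightarrow> complex) \<Rightarrow> real \<Rightarrow> real" where
  "rift g x = Re (ift g x)"

definition hermitian :: "(real \<Rightarrow> complex) \<Rightarrow> bool" where
  "hermitian g \<longleftrightarrow> (\<forall>\<xi>. g (- \<xi>) = cnj (g \<xi>))"

lemma ift_fourier: "ift g x = 1 / (2 * of_real pi) * fourier g (- x)"
  by (simp add: ift_def fourier_def mult_ac)

lemma ift_integrable:
  "rapid g \<Longrightarrow> integrable lborel (\<lambda>\<xi>. exp (\<i> * of_real (x * \<xi>)) * g \<xi>)"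
  by (rule rapid_integrable_mult[where B=1]) auto

lemma norm_ift_le:
  assumes "rapid g"
  shows "cmod (ift g x) \<le> (LINT \<xi>|lborel. cmod (g \<xi>))"
proof -
  have "cmod (ift g x) = cmod (fourier g (- x)) / (2 * pi)"
    by (simp add: ift_fourier norm_mult norm_divide)
  also have "\<dots> \<le> cmod (fourier g (- x))"
    using mult_left_mono[of 1 "2 * pi" "cmod (fourier g (- x))"] pi_ge_two by (simp add: divide_le_eq)
  finally show ?thesis using norm_fourier_le[OF assms, of "- x"] by linarith
qed

lemma ift_deriv:
  assumes "rapid g"
  shows "(ift g has_vector_derivative ift (\<lambda>\<xi>. \<i> * of_real \<xi> * g \<xi>) x) (at x)"
proof -
  have "((fourier g \<circ> uminus) has_vector_derivative
      (- 1) *\<^sub>R fourier (\<lambda>x. - \<i> * of_real x * g x) (- x)) (at x)"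
    by (rule vector_diff_chain_at[OF _ fourier_deriv[OF assms]]) (auto intro!: derivative_eq_intros)
  from has_vector_derivative_mult_right[OF this, of "1 / (2 * of_real pi)"]
  have "(ift g has_vector_derivative
      1 / (2 * of_real pi) * ((- 1) *\<^sub>R fourier (\<lambda>x. - \<i> * of_real x * g x) (- x))) (at x)"
    by (simp add: ift_fourier[abs_def] o_def)
  moreover have "(- 1) *\<^sub>R fourier (\<lambda>x. - \<i> * of_real x * g x) (- x)
      = fourier (\<lambda>x. \<i> * of_real x * g x) (- x)"
    unfolding fourier_def by (subst integral_scaleR_right[symmetric]) (simp add: mult_ac)
  ultimately show ?thesis by (simp only: ift_fourier)
qed

lemma ift_real:
  assumes "rapid g" "hermitian g"
  shows "of_real (rift g x) = ift g x"
proof -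
  have "cnj (LINT \<xi>|lborel. exp (\<i> * of_real (x * \<xi>)) * g \<xi>)
      = (LINT \<xi>|lborel. cnj (exp (\<i> * of_real (x * \<xi>)) * g \<xi>))"
    by (rule Bochner_Integration.integral_cnj[symmetric])
  also have "\<dots> = (LINT \<xi>|lborel. exp (\<i> * of_real (x * (0 + (- 1) * \<xi>))) * g (0 + (- 1) * \<xi>))"
    using assms(2) by (simp add: hermitian_def exp_cnj)
  also have "\<dots> = (LINT \<xi>|lborel. exp (\<i> * of_real (x * \<xi>)) * g \<xi>)"
    using lborel_integral_real_affine[of "-1" "\<lambda>\<xi>. exp (\<i> * of_real (x * \<xi>)) * g \<xi>" 0] by simp
  finally have "cnj (ift g x) = ift g x"
    by (simp add: ift_def)
  then show ?thesis
    by (simp add: rift_def complex_eq_iff)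
qed

lemma rift_deriv:
  assumes "rapid g"
  shows "(rift g has_vector_derivative rift (\<lambda>\<xi>. \<i> * of_real \<xi> * g \<xi>) x) (at x)"
  unfolding rift_def[abs_def]
  by (rule bounded_linear.has_vector_derivative[OF bounded_linear_Re ift_deriv[OF assms]])

lemma rift_smooth:
  assumes "rapid g"
  shows "smooth (rift g)"
proof -
  have "smooth ((\<lambda>n. rift (\<lambda>\<xi>. (\<i> * of_real \<xi>) ^ n * g \<xi>)) 0)"
  proof (rule smooth_sequence)
    show "(rift (\<lambda>\<xi>. (\<i> * of_real \<xi>) ^ n * g \<xi>) has_vector_derivative
        rift (\<lambda>\<xi>. (\<i> * of_real \<xi>) ^ Suc n * g \<xi>) x) (at x)" for n x
      using rift_deriv[OF rapid_mult_power[OF assms, of \<i> n], of x] by (simp add: mult_ac)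
  qed
  then show ?thesis by simp
qed

lemma ift_measurable [measurable_dest]:
  assumes "rapid g"
  shows "ift g \<in> borel_measurable borel"
proof -
  have "isCont (ift g) x" for x
    using ift_deriv[OF assms] has_vector_derivative_continuous by blast
  then show ?thesis
    by (intro borel_measurable_continuous_onI continuous_at_imp_continuous_on) auto
qed

lemma rift_measurable [measurable_dest]: "rapid g \<Longrightarrow> rift g \<in> borel_measurable borel"
  unfolding rift_def[abs_def] using ift_measurable by measurable

lemma norm_rift_le: "rapid g \<Longrightarrow> \<bar>rift g x\<bar> \<le> (LINT \<xi>|lborel. cmod (g \<xi>))"
  unfolding rift_def using norm_ift_le[of g x] abs_Re_le_cmod[of "ift g x"] by linarith

lemma schwartz_L1_le:
  assumes "\<phi> \<in> schwartz"
  shows "(LINT x|lborel. cmod (\<phi> x))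
    \<le> integral\<^sup>L lborel lorentz * (\<Sum>j\<le>2. \<Sum>k\<le>2. schwartz_seminorm j k \<phi>)"
proof -
  have nn: "0 \<le> schwartz_seminorm j k \<phi>" for j k
    by (rule order_trans[OF _ schwartz_bound[OF assms, of 0]]) auto
  define S where "S = (\<Sum>j\<le>2. \<Sum>k\<le>2. schwartz_seminorm j k \<phi>)"
  have "schwartz_seminorm 0 0 \<phi> + schwartz_seminorm 2 0 \<phi> \<le> S"
    using nn by (simp add: S_def numeral_2_eq_2 add_nonneg_nonneg)
  moreover have "(1 + x\<^sup>2) * cmod (\<phi> x) \<le> schwartz_seminorm 0 0 \<phi> + schwartz_seminorm 2 0 \<phi>" for x
    using schwartz_bound[OF assms, of x 0 0] schwartz_bound[OF assms, of x 2 0]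
    by (simp add: distrib_right)
  ultimately have "(1 + x\<^sup>2) * cmod (\<phi> x) \<le> S" for x
    by (meson order_trans)
  then have le: "cmod (\<phi> x) \<le> lorentz x * S" for x
    by (simp add: lorentz_def field_simps add_pos_nonneg)
  have "(LINT x|lborel. cmod (\<phi> x)) \<le> (LINT x|lborel. lorentz x * S)"
    by (intro integral_mono integrable_norm rapid_integrable schwartz_rapid assms
        integrable_mult_left lorentz_integrable le)
  then show ?thesis by (simp add: S_def)
qed

lemma rift_schwartz_integrable:
  assumes "rapid g" "\<phi> \<in> schwartz"
  shows "integrable lborel (\<lambda>x. of_real (rift g x) * \<phi> x)"
  by (rule rapid_integrable_mult[OF schwartz_rapid[OF assms(2)], where B="LINT \<xi>|lborel. cmod (g \<xi>)"])
     (use assms(1) norm_rift_le in \<open>auto intro!: borel_measurable_of_real rift_measurable\<close>)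

lemma tempered_dist_of_rift:
  assumes g: "rapid g"
  shows "tempered (dist_of (rift g))"
  unfolding tempered_def
proof (intro conjI ballI allI impI)
  let ?B = "LINT \<xi>|lborel. cmod (g \<xi>)"
  show "dist_of (rift g) \<phi> = 0" if "\<phi> \<notin> schwartz" for \<phi>
    using that by (simp add: dist_of_def)
  show "dist_of (rift g) (\<lambda>x. \<phi> x + \<psi> x) = dist_of (rift g) \<phi> + dist_of (rift g) \<psi>"
    if "\<phi> \<in> schwartz" "\<psi> \<in> schwartz" for \<phi> \<psi>
    using that rift_schwartz_integrable[OF g] schwartz_add[OF that]
    by (simp add: dist_of_def distrib_left)
  show "dist_of (rift g) (\<lambda>x. c * \<phi> x) = c * dist_of (rift g) \<phi>" if "\<phi> \<in> schwartz" for \<phi> c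
  proof -
    have "(LINT x|lborel. of_real (rift g x) * (c * \<phi> x)) = (LINT x|lborel. c * (of_real (rift g x) * \<phi> x))"
      by (simp add: mult_ac)
    then show ?thesis
      using that schwartz_cmult[OF that, of c] by (simp add: dist_of_def)
  qed
  show "\<exists>C m. \<forall>\<phi>\<in>schwartz. cmod (dist_of (rift g) \<phi>) \<le> C * (\<Sum>j\<le>m. \<Sum>k\<le>m. schwartz_seminorm j k \<phi>)"
  proof (intro exI ballI)
    fix \<phi> assume \<phi>: "\<phi> \<in> schwartz"
    have B: "0 \<le> ?B" by (rule Bochner_Integration.integral_nonneg) auto
    have "cmod (dist_of (rift g) \<phi>) \<le> (LINT x|lborel. cmod (of_real (rift g x) * \<phi> x))"
      using \<phi> by (simp only: dist_of_def if_True integral_norm_bound)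
    also have "\<dots> \<le> (LINT x|lborel. ?B * cmod (\<phi> x))"
      by (intro integral_mono integrable_norm rift_schwartz_integrable g \<phi> integrable_mult_right
          rapid_integrable schwartz_rapid)
         (auto simp: norm_mult intro!: mult_right_mono norm_rift_le g)
    also have "\<dots> = ?B * (LINT x|lborel. cmod (\<phi> x))" by simp
    also have "\<dots> \<le> ?B * (integral\<^sup>L lborel lorentz * (\<Sum>j\<le>2. \<Sum>k\<le>2. schwartz_seminorm j k \<phi>))"
      by (intro mult_left_mono schwartz_L1_le \<phi> B)
    finally show "cmod (dist_of (rift g) \<phi>)
      \<le> (?B * integral\<^sup>L lborel lorentz) * (\<Sum>j\<le>2. \<Sum>k\<le>2. schwartz_seminorm j k \<phi>)"
      by (simp only: mult.assoc)
  qed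
qed

lemma real_dist_of: "real_dist (dist_of f)"
  unfolding real_dist_def
proof
  fix \<phi> assume \<phi>: "\<phi> \<in> schwartz"
  have "(LINT x|lborel. of_real (f x) * cnj (\<phi> x)) = (LINT x|lborel. cnj (of_real (f x) * \<phi> x))" by simp
  also have "\<dots> = cnj (LINT x|lborel. of_real (f x) * \<phi> x)" by (rule Bochner_Integration.integral_cnj)
  finally show "dist_of f (\<lambda>x. cnj (\<phi> x)) = cnj (dist_of f \<phi>)"
    using \<phi> schwartz_cnj[OF \<phi>] by (simp add: dist_of_def)
qed

text \<open>Parseval's formula: Fubini moves the inverse transform from \<open>g\<close> to \<open>fourier \<phi>\<close>, where Fourier
  inversion for Schwartz functions applies.\<close>

lemma has_fourier_fun_rift:
  assumes g: "rapid g" "hermitian g"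
  shows "has_fourier_fun (dist_of (rift g)) g"
  unfolding has_fourier_fun_def
proof (intro conjI ballI)
  have [measurable]: "g \<in> borel_measurable borel" by (rule rapid_measurable[OF g(1)])
  then show "g \<in> borel_measurable borel" .
  fix \<phi> assume \<phi>: "\<phi> \<in> schwartz"
  have r: "rapid \<phi>" "rapid (fourier \<phi>)" "fourier \<phi> \<in> schwartz"
    using \<phi> fourier_schwartz schwartz_rapid by blast+
  have [measurable]: "fourier \<phi> \<in> borel_measurable borel" by (rule rapid_measurable[OF r(2)])
  obtain B where B: "\<And>x. cmod (g x) \<le> B"
    using rapid_bound[OF g(1), of 0] by auto
  show "integrable lborel (\<lambda>\<xi>. g \<xi> * \<phi> \<xi>)"
    by (rule rapid_integrable_mult[OF r(1) _ B]) measurable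
  let ?f = "\<lambda>x \<xi>. exp (\<i> * of_real (x * \<xi>)) * g \<xi> * fourier \<phi> x"
  have int: "integrable (lborel \<Otimes>\<^sub>M lborel) (\<lambda>(x, \<xi>). ?f x \<xi>)"
    by (rule integrable_prod_bound[OF _ integrable_norm[OF rapid_integrable[OF r(2)]]
          integrable_norm[OF rapid_integrable[OF g(1)]]])
       (auto simp: norm_mult)
  have inner: "(LINT \<xi>|lborel. ?f x \<xi>)
      = (LINT \<xi>|lborel. exp (\<i> * of_real (x * \<xi>)) * g \<xi>) * fourier \<phi> x" for x
    by (rule integral_mult_left_zero)
  have "dist_fourier (dist_of (rift g)) \<phi> = (LINT x|lborel. ift g x * fourier \<phi> x)"
    using \<phi> r(3) by (simp add: dist_fourier_def dist_of_def ift_real[OF g])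
  also have "\<dots> = (LINT x|lborel. 1 / (2 * of_real pi) * (LINT \<xi>|lborel. ?f x \<xi>))"
    by (simp only: ift_def inner) (simp only: mult.assoc)
  also have "\<dots> = 1 / (2 * of_real pi) * (LINT x|lborel. LINT \<xi>|lborel. ?f x \<xi>)"
    by (rule integral_mult_right_zero)
  also have "(LINT x|lborel. LINT \<xi>|lborel. ?f x \<xi>) = (LINT \<xi>|lborel. LINT x|lborel. ?f x \<xi>)"
    by (rule lborel_pair.Fubini_integral[OF int, symmetric])
  also have "\<dots> = (LINT \<xi>|lborel. g \<xi> * (LINT x|lborel. exp (\<i> * of_real (x * \<xi>)) * fourier \<phi> x))"
    by (simp add: mult_ac flip: integral_mult_right_zero)
  also have "\<dots> = (LINT \<xi>|lborel. of_real (2 * pi) * (g \<xi> * \<phi> \<xi>))"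
    by (simp only: fourier_inversion[OF \<phi>]) (simp only: mult_ac)
  also have "\<dots> = of_real (2 * pi) * (LINT \<xi>|lborel. g \<xi> * \<phi> \<xi>)"
    by (rule integral_mult_right_zero)
  finally show "dist_fourier (dist_of (rift g)) \<phi> = (LINT \<xi>|lborel. g \<xi> * \<phi> \<xi>)"
    by simp
qed

text \<open>A pointwise form of the fact that polynomial decay controls all Sobolev norms. It serves both for
  integrability and as the dominating function for continuity in time.\<close>

lemma weight_le_lorentz:
  assumes k: "\<sigma> \<le> real k" and A: "cmod z \<le> A * lorentz \<xi>"
    and B: "\<bar>\<xi>\<bar> ^ (2 * k) * cmod z \<le> B"
  shows "(1 + \<xi>\<^sup>2) powr \<sigma> * (cmod z)\<^sup>2 \<le> 2 ^ k * (A + B) * A * lorentz \<xi>"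
proof -
  have "0 \<le> A * lorentz \<xi>" using A norm_ge_zero order_trans by blast
  then have A0: "0 \<le> A" using lorentz_pos[of \<xi>] by (simp add: zero_le_mult_iff)
  have "lorentz \<xi> \<le> 1" by (simp add: lorentz_def inverse_le_1_iff)
  then have zA: "cmod z \<le> A"
    using A A0 by (meson mult_left_le order_trans)
  have "(1 + \<xi>\<^sup>2) ^ k \<le> 2 ^ k * (1 + \<bar>\<xi>\<bar> ^ (2 * k))"
  proof (cases "\<xi>\<^sup>2 \<le> 1")
    case True
    then have "(1 + \<xi>\<^sup>2) ^ k \<le> 2 ^ k" by (intro power_mono) auto
    then show ?thesis by (rule order_trans) simp
  next
    case False
    then have "(1 + \<xi>\<^sup>2) ^ k \<le> (2 * \<xi>\<^sup>2) ^ k" by (intro power_mono) auto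
    also have "\<dots> = 2 ^ k * \<bar>\<xi>\<bar> ^ (2 * k)" by (simp add: power_mult_distrib power_mult)
    finally show ?thesis by (rule order_trans) simp
  qed
  moreover have "(1 + \<xi>\<^sup>2) powr \<sigma> \<le> (1 + \<xi>\<^sup>2) powr real k"
    using k by (intro powr_mono) auto
  moreover have "(1 + \<xi>\<^sup>2) powr real k = (1 + \<xi>\<^sup>2) ^ k"
    by (rule powr_realpow) (simp add: add_pos_nonneg)
  ultimately have "(1 + \<xi>\<^sup>2) powr \<sigma> * cmod z \<le> 2 ^ k * (1 + \<bar>\<xi>\<bar> ^ (2 * k)) * cmod z"
    by (intro mult_right_mono) auto
  also have "\<dots> = 2 ^ k * (cmod z + \<bar>\<xi>\<bar> ^ (2 * k) * cmod z)" by (simp add: algebra_simps)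
  also have "\<dots> \<le> 2 ^ k * (A + B)"
    by (intro mult_left_mono add_mono zA B) auto
  finally have *: "(1 + \<xi>\<^sup>2) powr \<sigma> * cmod z \<le> 2 ^ k * (A + B)" .
  have "(1 + \<xi>\<^sup>2) powr \<sigma> * (cmod z)\<^sup>2 = (1 + \<xi>\<^sup>2) powr \<sigma> * cmod z * cmod z"
    by (simp add: power2_eq_square)
  also have "\<dots> \<le> 2 ^ k * (A + B) * (A * lorentz \<xi>)"
    by (rule mult_mono[OF * A]) (auto intro: order_trans[OF _ *])
  finally show ?thesis by (simp add: mult.assoc)
qed

lemma rapid_weight_integrable:
  assumes "rapid g"
  shows "integrable lborel (\<lambda>\<xi>. (1 + \<xi>\<^sup>2) powr \<sigma> * (cmod (g \<xi>))\<^sup>2)"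
proof -
  have [measurable]: "g \<in> borel_measurable borel" by (rule rapid_measurable[OF assms])
  define k where "k = nat \<lceil>\<sigma>\<rceil>"
  have k: "\<sigma> \<le> real k" by (simp add: k_def real_nat_ceiling_ge)
  obtain A where A: "\<And>x. cmod (g x) \<le> A * lorentz x" using rapid_le_lorentz[OF assms] by metis
  obtain B where B: "\<And>x. \<bar>x\<bar> ^ (2 * k) * cmod (g x) \<le> B" using rapid_bound[OF assms] by metis
  show ?thesis
    by (rule integrable_le_lorentz[where C="2 ^ k * (A + B) * A"])
       (use weight_le_lorentz[OF k A B] in auto)
qed

lemma rift_sobolev:
  assumes "rapid g" "hermitian g"
  shows "dist_of (rift g) \<in> sobolev \<sigma>"
  using tempered_dist_of_rift[OF assms(1)] real_dist_of has_fourier_fun_rift[OF assms]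
    rapid_weight_integrable[OF assms(1)]
  by (auto simp: sobolev_def)

lemma rift_H_infinity:
  assumes "rapid g" "hermitian g"
  shows "rift g \<in> H_infinity"
  using rift_smooth[OF assms(1)] rift_schwartz_integrable[OF assms(1)] rift_sobolev[OF assms]
  by (auto simp: H_infinity_def)

section \<open>The Sobolev norm on distributions with a Fourier transform\<close>

lemma has_fourier_fun_hat: "has_fourier_fun V g \<Longrightarrow> has_fourier_fun V (hat V)"
  unfolding hat_def by (rule someI[where P="has_fourier_fun V"])

lemma hat_AE_eq: "has_fourier_fun V g \<Longrightarrow> AE \<xi> in lborel. hat V \<xi> = g \<xi>"
  using has_fourier_fun_hat has_fourier_fun_unique by blast

lemma has_fourier_fun_measurable [measurable_dest]:
  "has_fourier_fun V g \<Longrightarrow> g \<in> borel_measurable borel"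
  by (simp add: has_fourier_fun_def)

lemma has_fourier_fun_diff:
  assumes "has_fourier_fun V g" "has_fourier_fun W h"
  shows "has_fourier_fun (V - W) (\<lambda>\<xi>. g \<xi> - h \<xi>)"
  using assms
  by (auto simp: has_fourier_fun_def dist_fourier_def left_diff_distrib)

text \<open>\<open>hat V\<close> is a choice of representative, so every integral involving it is first rewritten with an
  explicit one.\<close>

lemma hat_integral_cong:
  assumes "has_fourier_fun V g"
    and [measurable]: "case_prod F \<in> borel_measurable (borel \<Otimes>\<^sub>M borel)"
  shows "(LINT \<xi>|lborel. F \<xi> (hat V \<xi>)) = (LINT \<xi>|lborel. F \<xi> (g \<xi>))"
proof (rule integral_cong_AE)
  have [measurable]: "g \<in> borel_measurable borel" "hat V \<in> borel_measurable borel"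
    using assms(1) has_fourier_fun_hat has_fourier_fun_measurable by blast+
  show "(\<lambda>\<xi>. F \<xi> (hat V \<xi>)) \<in> borel_measurable lborel" "(\<lambda>\<xi>. F \<xi> (g \<xi>)) \<in> borel_measurable lborel"
    by measurable
  show "AE \<xi> in lborel. F \<xi> (hat V \<xi>) = F \<xi> (g \<xi>)"
    using hat_AE_eq[OF assms(1)] by eventually_elim simp
qed

lemma sobolev_norm_eq:
  assumes "has_fourier_fun V g"
  shows "sobolev_norm s V = sqrt (LINT \<xi>|lborel. (1 + \<xi>\<^sup>2) powr s * (cmod (g \<xi>))\<^sup>2)"
  unfolding sobolev_norm_def
  by (subst hat_integral_cong[OF assms]) auto

lemma integrable_dominated:
  fixes f :: "'a \<Rightarrow> 'b::{banach, second_countable_topology}"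
  assumes "integrable M u" "f \<in> borel_measurable M" "\<And>x. x \<in> space M \<Longrightarrow> norm (f x) \<le> u x"
  shows "integrable M f"
  by (rule Bochner_Integration.integrable_bound[OF assms(1,2)])
     (use assms(3) in \<open>fastforce intro!: AE_I2 intro: order_trans\<close>)

text \<open>The quantitative part of membership in \<open>H\<^sup>s\<close>, with the representative exposed. It is closed under
  differences, hence holds for the remainders in the definition of the Frechet derivative.\<close>

definition sob :: "real \<Rightarrow> dist \<Rightarrow> (real \<Rightarrow> complex) \<Rightarrow> bool" where
  "sob s V g \<longleftrightarrow> has_fourier_fun V g \<and>
     integrable lborel (\<lambda>\<xi>. (1 + \<xi>\<^sup>2) powr s * (cmod (g \<xi>))\<^sup>2)"

lemma sobolev_sob:
  assumes "V \<in> sobolev s"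
  shows "sob s V (hat V)"
proof -
  obtain g where g: "has_fourier_fun V g" "integrable lborel (\<lambda>\<xi>. (1 + \<xi>\<^sup>2) powr s * (cmod (g \<xi>))\<^sup>2)"
    using assms by (auto simp: sobolev_def)
  have [measurable]: "g \<in> borel_measurable borel" "hat V \<in> borel_measurable borel"
    using g(1) has_fourier_fun_hat has_fourier_fun_measurable by blast+
  have "integrable lborel (\<lambda>\<xi>. (1 + \<xi>\<^sup>2) powr s * (cmod (hat V \<xi>))\<^sup>2)"
    by (rule integrable_cong_AE_imp[OF g(2)])
       (measurable, use hat_AE_eq[OF g(1)] in \<open>eventually_elim, simp\<close>)
  then show ?thesis
    using has_fourier_fun_hat[OF g(1)] by (simp add: sob_def)
qed

lemma sob_diff:
  assumes "sob s V g" "sob s W h"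
  shows "sob s (V - W) (\<lambda>\<xi>. g \<xi> - h \<xi>)"
  unfolding sob_def
proof
  have g: "has_fourier_fun V g" and h: "has_fourier_fun W h" using assms by (auto simp: sob_def)
  then show "has_fourier_fun (V - W) (\<lambda>\<xi>. g \<xi> - h \<xi>)" by (rule has_fourier_fun_diff)
  have [measurable]: "g \<in> borel_measurable borel" "h \<in> borel_measurable borel"
    using g h has_fourier_fun_measurable by blast+
  have le: "(cmod (a - b))\<^sup>2 \<le> 2 * (cmod a)\<^sup>2 + 2 * (cmod b)\<^sup>2" for a b
  proof -
    have "(cmod (a - b))\<^sup>2 \<le> (cmod a + cmod b)\<^sup>2"
      by (intro power_mono norm_triangle_ineq4) auto
    also have "\<dots> \<le> 2 * (cmod a)\<^sup>2 + 2 * (cmod b)\<^sup>2"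
      using zero_le_power2[of "cmod a - cmod b"] by (simp add: power2_sum power2_diff)
    finally show ?thesis .
  qed
  have "integrable lborel (\<lambda>\<xi>. 2 * ((1 + \<xi>\<^sup>2) powr s * (cmod (g \<xi>))\<^sup>2) + 2 * ((1 + \<xi>\<^sup>2) powr s * (cmod (h \<xi>))\<^sup>2))"
    using assms by (intro Bochner_Integration.integrable_add integrable_mult_right) (auto simp: sob_def)
  then show "integrable lborel (\<lambda>\<xi>. (1 + \<xi>\<^sup>2) powr s * (cmod (g \<xi> - h \<xi>))\<^sup>2)"
  proof (rule Bochner_Integration.integrable_bound)
    show "AE \<xi> in lborel. norm ((1 + \<xi>\<^sup>2) powr s * (cmod (g \<xi> - h \<xi>))\<^sup>2) \<le>
        norm (2 * ((1 + \<xi>\<^sup>2) powr s * (cmod (g \<xi>))\<^sup>2) + 2 * ((1 + \<xi>\<^sup>2) powr s * (cmod (h \<xi>))\<^sup>2))"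
    proof (intro AE_I2)
      fix \<xi>
      have "(1 + \<xi>\<^sup>2) powr s * (cmod (g \<xi> - h \<xi>))\<^sup>2 \<le> (1 + \<xi>\<^sup>2) powr s * (2 * (cmod (g \<xi>))\<^sup>2 + 2 * (cmod (h \<xi>))\<^sup>2)"
        by (intro mult_left_mono le) auto
      then show "norm ((1 + \<xi>\<^sup>2) powr s * (cmod (g \<xi> - h \<xi>))\<^sup>2) \<le>
        norm (2 * ((1 + \<xi>\<^sup>2) powr s * (cmod (g \<xi>))\<^sup>2) + 2 * ((1 + \<xi>\<^sup>2) powr s * (cmod (h \<xi>))\<^sup>2))"
        by (simp add: algebra_simps)
    qed
  qed measurable
qed

lemma sobolev_norm_nonneg: "0 \<le> sobolev_norm s V"
  unfolding sobolev_norm_def by (intro real_sqrt_ge_zero Bochner_Integration.integral_nonneg) auto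

lemma le_sqrt_of_AM_GM:
  fixes y L Y :: real
  assumes "0 < L" "0 \<le> Y" and le: "\<And>l. 0 < l \<Longrightarrow> y \<le> (l * L + Y / l) / 2"
  shows "y \<le> sqrt (L * Y)"
proof (cases "Y = 0")
  case True
  have "y \<le> e" if "0 < e" for e
    using le[of "2 * e / L"] that assms(1) True by simp
  then have "y \<le> 0" by (rule field_le_epsilon[of y 0, simplified])
  then show ?thesis by (simp add: True)
next
  case False
  define l where "l = sqrt Y / sqrt L"
  have "0 < l" using False assms by (simp add: l_def)
  have "l * L = sqrt Y * (L / sqrt L)" "Y / l = (Y / sqrt Y) * sqrt L" by (simp_all add: l_def)
  then have 1: "l * L = sqrt (L * Y)" and 2: "Y / l = sqrt (L * Y)"
    using assms(1,2) by (simp_all add: real_div_sqrt real_sqrt_mult)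
  show ?thesis using le[OF \<open>0 < l\<close>] by (simp add: 1 2)
qed

text \<open>The Cauchy-Schwarz inequality on the window, where \<open>(1 + \<xi>\<^sup>2) powr s \<ge> 2 powr s\<close>. It is obtained from the
  inequality of the means with a free parameter \<open>l\<close>, which at the same time gives integrability.\<close>

lemma pairing_le:
  assumes V: "sob s V g" and s: "s \<le> 0" and ab: "-1 \<le> a" "a < b" "b \<le> 1"
    and [measurable]: "w \<in> borel_measurable borel" and w: "\<And>\<xi>. cmod (w \<xi>) \<le> indicator {a..b} \<xi>"
  shows "integrable lborel (\<lambda>\<xi>. w \<xi> * g \<xi>)"
    and "cmod (LINT \<xi>|lborel. w \<xi> * g \<xi>) \<le> sqrt ((b - a) * 2 powr (- s)) * sobolev_norm s V"
proof -
  have g: "has_fourier_fun V g" and int: "integrable lborel (\<lambda>\<xi>. (1 + \<xi>\<^sup>2) powr s * (cmod (g \<xi>))\<^sup>2)"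
    using V by (auto simp: sob_def)
  have [measurable]: "g \<in> borel_measurable borel" by (rule has_fourier_fun_measurable[OF g])
  define X where "X = (LINT \<xi>|lborel. (1 + \<xi>\<^sup>2) powr s * (cmod (g \<xi>))\<^sup>2)"
  have X: "0 \<le> X" unfolding X_def by (intro Bochner_Integration.integral_nonneg) auto
  have norm: "sobolev_norm s V = sqrt X" unfolding X_def by (rule sobolev_norm_eq[OF g])
  have indi: "integrable lborel (\<lambda>\<xi>. indicator {a..b} \<xi> :: real)"
    by (rule integrable_real_indicator) (use ab in auto)
  have both: "integrable lborel (\<lambda>\<xi>. w \<xi> * g \<xi>) \<and>
      cmod (LINT \<xi>|lborel. w \<xi> * g \<xi>) \<le> (l * (b - a) + 2 powr (- s) * X / l) / 2" if l: "0 < l" for l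
  proof -
    let ?u = "\<lambda>\<xi>. (l * indicator {a..b} \<xi> + (2 powr (- s) / l) * ((1 + \<xi>\<^sup>2) powr s * (cmod (g \<xi>))\<^sup>2)) / 2"
    have ui: "integrable lborel ?u"
      by (intro integrable_divide Bochner_Integration.integrable_add integrable_mult_right indi int)
    have le: "norm (w \<xi> * g \<xi>) \<le> ?u \<xi>" for \<xi>
    proof (cases "\<xi> \<in> {a..b}")
      case False
      then have "w \<xi> = 0" using w[of \<xi>] by simp
      then show ?thesis using l by simp
    next
      case True
      then have "\<bar>\<xi>\<bar> \<le> 1" using ab by auto
      then have "\<xi>\<^sup>2 \<le> 1" by (simp add: abs_square_le_1)
      then have "2 powr s \<le> (1 + \<xi>\<^sup>2) powr s"
        using s by (intro powr_mono2') (auto simp: add_pos_nonneg)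
      then have "2 powr (- s) * 2 powr s \<le> 2 powr (- s) * (1 + \<xi>\<^sup>2) powr s"
        by (intro mult_left_mono) auto
      then have one: "1 \<le> 2 powr (- s) * (1 + \<xi>\<^sup>2) powr s" by (simp flip: powr_add)
      have "norm (w \<xi> * g \<xi>) \<le> 1 * cmod (g \<xi>)"
        unfolding norm_mult using w[of \<xi>] True by (intro mult_right_mono) auto
      also have "\<dots> \<le> (l + (cmod (g \<xi>))\<^sup>2 / l) / 2"
        using zero_le_power2[of "l - cmod (g \<xi>)"] l by (simp add: field_simps power2_eq_square)
      also have "\<dots> \<le> (l + (2 powr (- s) * (1 + \<xi>\<^sup>2) powr s) * ((cmod (g \<xi>))\<^sup>2 / l)) / 2"
        using mult_right_mono[OF one, of "(cmod (g \<xi>))\<^sup>2 / l"] l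
        by (intro divide_right_mono add_left_mono) auto
      also have "\<dots> = ?u \<xi>" using True by (simp add: field_simps)
      finally show ?thesis .
    qed
    have int_wg: "integrable lborel (\<lambda>\<xi>. w \<xi> * g \<xi>)"
      by (rule integrable_dominated[OF ui _ le]) measurable
    have "cmod (LINT \<xi>|lborel. w \<xi> * g \<xi>) \<le> integral\<^sup>L lborel ?u"
      by (rule Bochner_Integration.integral_norm_bound_integral[OF int_wg ui le])
    also have "\<dots> = (l * (b - a) + (2 powr (- s) / l) * X) / 2"
    proof -
      have "(LINT \<xi>|lborel. l * indicator {a..b} \<xi>) = l * (b - a)"
        using ab by simp
      moreover have "(LINT \<xi>|lborel. (2 powr (- s) / l) * ((1 + \<xi>\<^sup>2) powr s * (cmod (g \<xi>))\<^sup>2)) = (2 powr (- s) / l) * X"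
        unfolding X_def by (rule integral_mult_right_zero)
      ultimately show ?thesis
        by (simp only: integral_divide_zero Bochner_Integration.integral_add[OF integrable_mult_right[OF indi] integrable_mult_right[OF int]])
    qed
    finally show ?thesis using int_wg by simp
  qed
  show "integrable lborel (\<lambda>\<xi>. w \<xi> * g \<xi>)" using both[of 1] by simp
  have "cmod (LINT \<xi>|lborel. w \<xi> * g \<xi>) \<le> sqrt ((b - a) * (2 powr (- s) * X))"
    by (intro le_sqrt_of_AM_GM) (use ab X both in auto)
  then show "cmod (LINT \<xi>|lborel. w \<xi> * g \<xi>) \<le> sqrt ((b - a) * 2 powr (- s)) * sobolev_norm s V"
    by (simp add: norm real_sqrt_mult mult.assoc)
qed

section \<open>Convolution\<close>

definition conv :: "(real \<Rightarrow> complex) \<Rightarrow> (real \<Rightarrow> complex) \<Rightarrow> real \<Rightarrow> complex" where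
  "conv g h \<xi> = (LINT \<eta>|lborel. g \<eta> * h (\<xi> - \<eta>))"

lemma conv_measurable [measurable]:
  assumes [measurable]: "g \<in> borel_measurable borel" "h \<in> borel_measurable borel"
  shows "conv g h \<in> borel_measurable borel"
proof -
  have "(\<lambda>\<xi>. LINT \<eta>|lborel. g \<eta> * h (\<xi> - \<eta>)) \<in> borel_measurable borel"
    by (rule lborel.borel_measurable_lebesgue_integral) measurable
  then show ?thesis by (simp add: conv_def[abs_def])
qed

lemma integrable_reflect:
  fixes f :: "real \<Rightarrow> 'a::{banach, second_countable_topology}"
  shows "integrable lborel f \<Longrightarrow> integrable lborel (\<lambda>\<eta>. f (\<xi> - \<eta>))"
  using lborel_integrable_real_affine[of f "-1" \<xi>] by simp

lemma integral_reflect: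
  fixes f :: "real \<Rightarrow> 'a::{banach, second_countable_topology}"
  shows "(LINT \<eta>|lborel. f (\<xi> - \<eta>)) = integral\<^sup>L lborel f"
  using lborel_integral_real_affine[of "-1" f \<xi>] by simp

text \<open>One of \<open>\<eta>\<close> and \<open>\<xi> - \<eta>\<close> is at least comparable to \<open>\<xi>\<close>. Integrating in \<open>\<eta>\<close> shows that the convolution
  square of the profile is bounded by a multiple of the profile.\<close>

lemma lorentz_product:
  "lorentz \<eta> * lorentz (\<xi> - \<eta>) \<le> 2 * lorentz \<xi> * (lorentz \<eta> + lorentz (\<xi> - \<eta>))"
proof -
  define a b c where "a = 1 + \<eta>\<^sup>2" and "b = 1 + (\<xi> - \<eta>)\<^sup>2" and "c = 1 + \<xi>\<^sup>2"
  have pos: "0 < a" "0 < b" "0 < c" by (simp_all add: a_def b_def c_def add_pos_nonneg)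
  have "\<xi>\<^sup>2 \<le> 2 * \<eta>\<^sup>2 + 2 * (\<xi> - \<eta>)\<^sup>2"
    using zero_le_power2[of "\<xi> - 2 * \<eta>"] by (simp add: power2_eq_square algebra_simps)
  then have "c \<le> 2 * (a + b)" by (simp add: a_def b_def c_def)
  then have "inverse a * inverse b * inverse c * c \<le> inverse a * inverse b * inverse c * (2 * (a + b))"
    using pos by (intro mult_left_mono) auto
  then show ?thesis
    using pos unfolding lorentz_def a_def[symmetric] b_def[symmetric] c_def[symmetric]
    by (simp add: field_simps)
qed

text \<open>A single pointwise majorant thus survives the quadratic nonlinearity, and no separate
  \<open>L\<^sup>1\<close> and \<open>L\<^sup>\<infinity>\<close> bounds are carried along.\<close>

lemma conv_integrable:
  assumes [measurable]: "g \<in> borel_measurable borel" "h \<in> borel_measurable borel"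
    and g: "\<And>\<eta>. cmod (g \<eta>) \<le> A * lorentz \<eta>" and h: "\<And>\<eta>. cmod (h \<eta>) \<le> B * lorentz \<eta>"
    and A: "0 \<le> A"
  shows "integrable lborel (\<lambda>\<eta>. g \<eta> * h (\<xi> - \<eta>))"
    and "cmod (conv g h \<xi>) \<le> A * B * (4 * integral\<^sup>L lborel lorentz) * lorentz \<xi>"
proof -
  have "0 \<le> B * lorentz 0" using h[of 0] norm_ge_zero order_trans by blast
  then have B: "0 \<le> B" by (simp add: lorentz_def)
  let ?u = "\<lambda>\<eta>. A * B * (2 * lorentz \<xi> * (lorentz \<eta> + lorentz (\<xi> - \<eta>)))"
  have ui: "integrable lborel ?u"
    by (intro integrable_mult_right Bochner_Integration.integrable_add lorentz_integrable integrable_reflect)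
  have le: "norm (g \<eta> * h (\<xi> - \<eta>)) \<le> ?u \<eta>" for \<eta>
  proof -
    have "norm (g \<eta> * h (\<xi> - \<eta>)) \<le> (A * lorentz \<eta>) * (B * lorentz (\<xi> - \<eta>))"
      unfolding norm_mult using A by (intro mult_mono g h) auto
    also have "\<dots> = A * B * (lorentz \<eta> * lorentz (\<xi> - \<eta>))" by simp
    also have "\<dots> \<le> ?u \<eta>" by (intro mult_left_mono lorentz_product) (use A B in auto)
    finally show ?thesis .
  qed
  show int: "integrable lborel (\<lambda>\<eta>. g \<eta> * h (\<xi> - \<eta>))"
    by (rule Bochner_Integration.integrable_bound[OF ui]) (use le in \<open>auto intro!: AE_I2 order_trans[OF le]\<close>)
  have "cmod (conv g h \<xi>) \<le> integral\<^sup>L lborel ?u"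
    unfolding conv_def by (rule Bochner_Integration.integral_norm_bound_integral[OF int ui]) (rule le)
  also have "\<dots> = A * B * (2 * lorentz \<xi> * (integral\<^sup>L lborel lorentz + integral\<^sup>L lborel lorentz))"
    by (simp add: integral_reflect integrable_reflect lorentz_integrable)
  finally show "cmod (conv g h \<xi>) \<le> A * B * (4 * integral\<^sup>L lborel lorentz) * lorentz \<xi>"
    by (simp add: mult_ac)
qed

lemma conv_power_bound:
  assumes [measurable]: "g \<in> borel_measurable borel" "h \<in> borel_measurable borel"
    and A: "0 \<le> A" "\<And>x. cmod (g x) \<le> A * lorentz x"
    and B: "0 \<le> B" "\<And>x. cmod (h x) \<le> B * lorentz x"
    and G: "\<And>x. \<bar>x\<bar> ^ k * cmod (g x) \<le> G" and H: "\<And>x. \<bar>x\<bar> ^ k * cmod (h x) \<le> H"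
  shows "\<bar>\<xi>\<bar> ^ k * cmod (conv g h \<xi>) \<le> 2 ^ k * (G * B + H * A) * integral\<^sup>L lborel lorentz"
proof -
  note int = conv_integrable(1)[of g h A B, OF _ _ A(2) B(2) A(1)]
  have "0 \<le> \<bar>0::real\<bar> ^ k * cmod (g 0)" "0 \<le> \<bar>0::real\<bar> ^ k * cmod (h 0)" by simp_all
  then have GH: "0 \<le> G" "0 \<le> H" using G[of 0] H[of 0] by linarith+
  let ?u = "\<lambda>\<eta>. 2 ^ k * (G * (B * lorentz (\<xi> - \<eta>)) + H * (A * lorentz \<eta>))"
  have ui: "integrable lborel ?u"
    by (intro integrable_mult_right Bochner_Integration.integrable_add integrable_reflect lorentz_integrable)
  have le: "norm (of_real (\<bar>\<xi>\<bar> ^ k) * (g \<eta> * h (\<xi> - \<eta>))) \<le> ?u \<eta>" for \<eta>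
  proof -
    have "\<bar>\<xi>\<bar> ^ k \<le> (2 * max \<bar>\<eta>\<bar> \<bar>\<xi> - \<eta>\<bar>) ^ k" by (intro power_mono) (auto simp: max_def abs_if)
    also have "\<dots> = 2 ^ k * max \<bar>\<eta>\<bar> \<bar>\<xi> - \<eta>\<bar> ^ k" by (simp add: power_mult_distrib)
    also have "\<dots> \<le> 2 ^ k * (\<bar>\<eta>\<bar> ^ k + \<bar>\<xi> - \<eta>\<bar> ^ k)"
      by (intro mult_left_mono) (auto simp: max_def)
    finally have "norm (of_real (\<bar>\<xi>\<bar> ^ k) * (g \<eta> * h (\<xi> - \<eta>)))
        \<le> 2 ^ k * (\<bar>\<eta>\<bar> ^ k + \<bar>\<xi> - \<eta>\<bar> ^ k) * (cmod (g \<eta>) * cmod (h (\<xi> - \<eta>)))"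
      unfolding norm_mult by (intro mult_right_mono) (auto simp: norm_power)
    also have "\<dots> = 2 ^ k * ((\<bar>\<eta>\<bar> ^ k * cmod (g \<eta>)) * cmod (h (\<xi> - \<eta>)) + (\<bar>\<xi> - \<eta>\<bar> ^ k * cmod (h (\<xi> - \<eta>))) * cmod (g \<eta>))"
      by (simp add: algebra_simps)
    also have "\<dots> \<le> ?u \<eta>"
      using GH by (intro mult_left_mono add_mono mult_mono G H A B) auto
    finally show ?thesis .
  qed
  have "\<bar>\<xi>\<bar> ^ k * cmod (conv g h \<xi>) = cmod (LINT \<eta>|lborel. of_real (\<bar>\<xi>\<bar> ^ k) * (g \<eta> * h (\<xi> - \<eta>)))"
    unfolding conv_def integral_mult_right_zero norm_mult by (simp add: norm_power)
  also have "\<dots> \<le> integral\<^sup>L lborel ?u"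
    by (rule Bochner_Integration.integral_norm_bound_integral[OF integrable_mult_right[OF int] ui]) (measurable, rule le)
  also have "\<dots> = 2 ^ k * (G * B + H * A) * integral\<^sup>L lborel lorentz"
    using integral_reflect[of lorentz \<xi>]
    by (simp add: integrable_reflect lorentz_integrable algebra_simps)
  finally show ?thesis .
qed

lemma rapid_conv:
  assumes g: "rapid g" and h: "rapid h"
  shows "rapid (conv g h)"
  unfolding rapid_def
proof (intro conjI allI)
  have [measurable]: "g \<in> borel_measurable borel" "h \<in> borel_measurable borel"
    using g h by (auto intro: rapid_measurable)
  show "conv g h \<in> borel_measurable borel" by measurable
  fix k
  obtain G where G: "\<And>x. \<bar>x\<bar> ^ k * cmod (g x) \<le> G" using rapid_bound[OF g] by metis
  obtain H where H: "\<And>x. \<bar>x\<bar> ^ k * cmod (h x) \<le> H" using rapid_bound[OF h] by metis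
  obtain A where A: "0 \<le> A" "\<And>x. cmod (g x) \<le> A * lorentz x" using rapid_le_lorentz[OF g] by metis
  obtain B where B: "0 \<le> B" "\<And>x. cmod (h x) \<le> B * lorentz x" using rapid_le_lorentz[OF h] by metis
  show "\<exists>C. \<forall>x. \<bar>x\<bar> ^ k * cmod (conv g h x) \<le> C"
    using conv_power_bound[of g h A B k G H, OF _ _ A B G H] by (auto intro: exI)
qed

lemma hermitian_conv:
  assumes "hermitian g" "hermitian h"
  shows "hermitian (conv g h)"
  unfolding hermitian_def
proof
  fix \<xi>
  have "conv g h (- \<xi>) = (LINT \<eta>|lborel. g (0 - \<eta>) * h (- \<xi> - (0 - \<eta>)))"
    unfolding conv_def by (rule integral_reflect[of "\<lambda>\<eta>. g \<eta> * h (- \<xi> - \<eta>)" 0, symmetric])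
  also have "\<dots> = (LINT \<eta>|lborel. cnj (g \<eta> * h (\<xi> - \<eta>)))"
    using assms by (simp add: hermitian_def) (metis minus_diff_eq uminus_add_conv_diff)
  also have "\<dots> = cnj (conv g h \<xi>)"
    unfolding conv_def by (rule Bochner_Integration.integral_cnj)
  finally show "conv g h (- \<xi>) = cnj (conv g h \<xi>)" .
qed

lemma ift_mult:
  assumes g: "rapid g" and h: "rapid h"
  shows "ift g x * ift h x = ift (\<lambda>\<xi>. conv g h \<xi> / (2 * of_real pi)) x"
proof -
  have [measurable]: "g \<in> borel_measurable borel" "h \<in> borel_measurable borel"
    using g h by (auto intro: rapid_measurable)
  let ?e = "\<lambda>\<xi>. exp (\<i> * of_real (x * \<xi>))"
  let ?f = "\<lambda>\<xi> \<eta>. ?e \<xi> * (g \<eta> * h (\<xi> - \<eta>))"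
  have int: "integrable (lborel \<Otimes>\<^sub>M lborel) (\<lambda>(\<eta>, \<xi>). ?f \<xi> \<eta>)"
  proof (rule lborel_pair.Fubini_integrable)
    show "(\<lambda>(\<eta>, \<xi>). ?f \<xi> \<eta>) \<in> borel_measurable (lborel \<Otimes>\<^sub>M lborel)" by measurable
    have hi: "integrable lborel (\<lambda>\<xi>. h (\<xi> - \<eta>))" for \<eta>
      using lborel_integrable_real_affine[OF rapid_integrable[OF h], of 1 "-\<eta>"] by simp
    have "(LINT \<xi>|lborel. cmod (h (\<xi> - \<eta>))) = (LINT \<xi>|lborel. cmod (h \<xi>))" for \<eta>
      using lborel_integral_real_affine[of 1 "\<lambda>\<xi>. cmod (h \<xi>)" "-\<eta>"] by simp
    then show "integrable lborel (\<lambda>\<eta>. LINT \<xi>|lborel. norm (case (\<eta>, \<xi>) of (\<eta>, \<xi>) \<Rightarrow> ?f \<xi> \<eta>))"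
      by (simp add: norm_mult rapid_integrable g)
    show "AE \<eta> in lborel. integrable lborel (\<lambda>\<xi>. case (\<eta>, \<xi>) of (\<eta>, \<xi>) \<Rightarrow> ?f \<xi> \<eta>)"
    proof (intro AE_I2)
      fix \<eta>
      have "integrable lborel (\<lambda>\<xi>. g \<eta> * h (\<xi> - \<eta>))" by (intro integrable_mult_right hi)
      then show "integrable lborel (\<lambda>\<xi>. case (\<eta>, \<xi>) of (\<eta>, \<xi>) \<Rightarrow> ?f \<xi> \<eta>)"
        by (rule Bochner_Integration.integrable_bound) (auto simp: norm_mult)
    qed
  qed
  have inner: "(LINT \<xi>|lborel. ?f \<xi> \<eta>) = (?e \<eta> * g \<eta>) * (LINT \<xi>|lborel. ?e \<xi> * h \<xi>)" for \<eta>
  proof -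
    have "(LINT \<xi>|lborel. ?f \<xi> \<eta>) = (LINT \<xi>|lborel. ?f (\<eta> + 1 * \<xi>) \<eta>)"
      using lborel_integral_real_affine[of 1 "\<lambda>\<xi>. ?f \<xi> \<eta>" \<eta>] by simp
    also have "\<dots> = (LINT \<xi>|lborel. (?e \<eta> * g \<eta>) * (?e \<xi> * h \<xi>))"
      by (intro Bochner_Integration.integral_cong) (auto simp: distrib_left exp_add)
    finally show ?thesis by simp
  qed
  have "(LINT \<xi>|lborel. ?e \<xi> * (conv g h \<xi> / (2 * of_real pi)))
      = (LINT \<xi>|lborel. (LINT \<eta>|lborel. ?f \<xi> \<eta>) / (2 * of_real pi))"
    by (simp add: conv_def)
  also have "\<dots> = (LINT \<xi>|lborel. LINT \<eta>|lborel. ?f \<xi> \<eta>) / (2 * of_real pi)"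
    by (rule integral_divide_zero)
  also have "(LINT \<xi>|lborel. LINT \<eta>|lborel. ?f \<xi> \<eta>) = (LINT \<eta>|lborel. LINT \<xi>|lborel. ?f \<xi> \<eta>)"
    by (rule lborel_pair.Fubini_integral[OF int])
  also have "\<dots> = (LINT \<eta>|lborel. ?e \<eta> * g \<eta>) * (LINT \<xi>|lborel. ?e \<xi> * h \<xi>)"
    by (simp only: inner integral_mult_left_zero)
  finally show ?thesis by (simp add: ift_def)
qed

lemma deriv_rift_square:
  assumes g: "rapid g" "hermitian g"
  shows "deriv (\<lambda>y. (rift g y)\<^sup>2) = rift (\<lambda>\<xi>. \<i> * of_real \<xi> * conv g g \<xi> / (2 * of_real pi))"
proof
  fix x
  let ?q = "\<lambda>\<xi>. conv g g \<xi> / (2 * of_real pi)"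
  have q: "rapid ?q"
    by (rule rapid_dominated[OF rapid_conv[OF g(1) g(1)], of _ "1 / (2 * pi)"])
       (use g(1) in \<open>auto simp: norm_divide intro!: borel_measurable_divide conv_measurable rapid_measurable\<close>)
  have "(\<lambda>y. (rift g y)\<^sup>2) = rift ?q"
  proof
    fix y
    have "complex_of_real ((rift g y)\<^sup>2) = ift g y * ift g y"
      by (simp add: ift_real[OF g] power2_eq_square)
    also have "\<dots> = ift ?q y" by (rule ift_mult[OF g(1) g(1)])
    finally show "(rift g y)\<^sup>2 = rift ?q y"
      unfolding rift_def by (metis Re_complex_of_real)
  qed
  moreover have "(rift ?q has_real_derivative rift (\<lambda>\<xi>. \<i> * of_real \<xi> * ?q \<xi>) x) (at x)"
    using rift_deriv[OF q] by (simp only: has_real_derivative_iff_has_vector_derivative)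
  ultimately show "deriv (\<lambda>y. (rift g y)\<^sup>2) x = rift (\<lambda>\<xi>. \<i> * of_real \<xi> * conv g g \<xi> / (2 * of_real pi)) x"
    by (simp add: DERIV_imp_deriv)
qed

section \<open>The Duhamel iterates\<close>

definition evol :: "real \<Rightarrow> real \<Rightarrow> real \<Rightarrow> complex" where
  "evol p t \<xi> = exp (\<i> * of_real (t * \<xi> ^ 3) - of_real (t * \<bar>\<xi>\<bar> powr p))"

lemma norm_evol: "cmod (evol p t \<xi>) = exp (- (t * \<bar>\<xi>\<bar> powr p))"
  by (simp add: evol_def norm_exp_eq_Re)

lemma norm_evol_le: "0 \<le> t \<Longrightarrow> cmod (evol p t \<xi>) \<le> 1"
  by (simp add: norm_evol)

lemma evol_add: "evol p (a + b) \<xi> = evol p a \<xi> * evol p b \<xi>"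
  by (simp add: evol_def algebra_simps flip: exp_add)

lemma evol_0 [simp]: "evol p 0 \<xi> = 1"
  by (simp add: evol_def)

lemma hermitian_evol: "evol p t (- \<xi>) = cnj (evol p t \<xi>)"
  by (simp add: evol_def exp_cnj)

lemma evol_measurable [measurable]: "case_prod (evol p) \<in> borel_measurable (borel \<Otimes>\<^sub>M borel)"
  unfolding evol_def by measurable

lemma continuous_evol: "continuous_on S (\<lambda>t. evol p t \<xi>)"
  unfolding evol_def by (intro continuous_intros)

lemma semigroup_ift: "semigroup p t f x = ift (\<lambda>\<xi>. evol p t \<xi> * hat (dist_of f) \<xi>) x"
  by (simp add: semigroup_def ift_def evol_def)

lemma semigroup_rift:
  assumes "rapid g" "hermitian g"
  shows "semigroup p t (rift g) x = ift (\<lambda>\<xi>. evol p t \<xi> * g \<xi>) x"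
proof -
  have "(LINT \<xi>|lborel. exp (\<i> * of_real (x * \<xi>)) * (evol p t \<xi> * hat (dist_of (rift g)) \<xi>))
      = (LINT \<xi>|lborel. exp (\<i> * of_real (x * \<xi>)) * (evol p t \<xi> * g \<xi>))"
    by (rule hat_integral_cong[OF has_fourier_fun_rift[OF assms]]) measurable
  then show ?thesis by (simp add: semigroup_ift ift_def)
qed

lemma conv_measurable_family:
  assumes [measurable]: "case_prod G \<in> borel_measurable (borel \<Otimes>\<^sub>M borel)"
    "case_prod H \<in> borel_measurable (borel \<Otimes>\<^sub>M borel)"
  shows "(\<lambda>(t, \<xi>). conv (G t) (H t) \<xi>) \<in> borel_measurable (borel \<Otimes>\<^sub>M borel)"
  unfolding conv_def split_beta'
  by (rule lborel.borel_measurable_lebesgue_integral) measurable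

lemma sums_integral_dominated:
  fixes f :: "nat \<Rightarrow> 'a \<Rightarrow> complex"
  assumes [measurable]: "\<And>n. f n \<in> borel_measurable M" and u: "integrable M u"
    and le: "\<And>n x. x \<in> space M \<Longrightarrow> cmod (f n x) \<le> C n * u x" and C: "summable C"
  shows "(\<lambda>n. integral\<^sup>L M (f n)) sums (LINT x|M. (\<Sum>n. f n x))"
    and "integrable M (\<lambda>x. (\<Sum>n. f n x))"
proof -
  have fi: "integrable M (f n)" for n
    by (rule Bochner_Integration.integrable_bound[OF integrable_mult_right[OF u, of "C n"]])
       (auto intro!: AE_I2 order_trans[OF le])
  have sn: "summable (\<lambda>n. norm (f n x))" if "x \<in> space M" for x
    by (rule summable_comparison_test[OF _ summable_mult2[OF C, of "u x"]])
       (use le[OF that] in auto)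
  have "norm (LINT x|M. norm (f n x)) \<le> C n * integral\<^sup>L M u" for n
  proof -
    have "(LINT x|M. norm (f n x)) \<le> (LINT x|M. C n * u x)"
      by (intro integral_mono integrable_norm fi integrable_mult_right u le)
    moreover have "0 \<le> (LINT x|M. norm (f n x))"
      by (rule Bochner_Integration.integral_nonneg) auto
    ultimately show ?thesis by simp
  qed
  then have si: "summable (\<lambda>n. LINT x|M. norm (f n x))"
    by (intro summable_comparison_test[OF _ summable_mult2[OF C, of "integral\<^sup>L M u"]]) auto
  show "(\<lambda>n. integral\<^sup>L M (f n)) sums (LINT x|M. (\<Sum>n. f n x))"
    by (rule sums_integral[OF fi AE_I2[OF sn] si])
  show "integrable M (\<lambda>x. (\<Sum>n. f n x))"
    by (rule integrable_suminf[OF fi AE_I2[OF sn] si])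
qed

lemma summable_power_geometric: "summable (\<lambda>n. (real n + 1) ^ k * (1/2) ^ n)"
proof -
  define r where "r = ln (3/2 :: real)"
  define M where "M = (real k + 1) / r"
  have r: "0 < r" by (simp add: r_def)
  then have M: "0 < M" by (simp add: M_def)
  have le: "(real n + 1) ^ k * (1/2) ^ n \<le> M ^ k * (3/2) * (3/4) ^ n" for n
  proof -
    have "real n + 1 = M * ((real n + 1) / M)" using M by simp
    also have "\<dots> \<le> M * exp ((real n + 1) / M)"
      using M exp_ge_add_one_self[of "(real n + 1) / M"] by (intro mult_left_mono) linarith+
    finally have "(real n + 1) ^ k \<le> (M * exp ((real n + 1) / M)) ^ k"
      by (intro power_mono) auto
    also have "\<dots> = M ^ k * exp (real k * ((real n + 1) / M))"
      using exp_of_nat_mult[of k "(real n + 1) / M"] by (simp add: power_mult_distrib)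
    also have "\<dots> \<le> M ^ k * exp ((real n + 1) * r)"
    proof (intro mult_left_mono iffD2[OF exp_le_cancel_iff])
      have "real k / M \<le> r" using r by (simp add: M_def field_simps)
      then show "real k * ((real n + 1) / M) \<le> (real n + 1) * r"
        using mult_left_mono[of "real k / M" r "real n + 1"] by (simp add: mult_ac)
    qed (use M in simp)
    also have "exp ((real n + 1) * r) = (3/2) ^ Suc n"
      using exp_of_nat_mult[of "Suc n" r] by (simp add: r_def add.commute)
    finally have "(real n + 1) ^ k * (1/2) ^ n \<le> M ^ k * (3/2) ^ Suc n * (1/2) ^ n"
      by (intro mult_right_mono) auto
    also have "\<dots> = M ^ k * (3/2) * ((3/2) * (1/2)) ^ n"
      unfolding power_mult_distrib by simp
    finally show ?thesis by simp
  qed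
  have "summable (\<lambda>n. M ^ k * (3/2) * (3/4 :: real) ^ n)"
    by (intro summable_mult summable_geometric) simp
  then show ?thesis
    by (rule summable_comparison_test_ev[OF always_eventually, rotated]) (use le in auto)
qed

text \<open>The factor \<open>1 / Suc n\<close> is what pays for the derivative in the nonlinearity.\<close>

lemma set_integral_power_bound:
  fixes h :: "real \<Rightarrow> complex"
  assumes [measurable]: "h \<in> borel_measurable borel" and t: "0 \<le> t"
    and le: "\<And>\<tau>. 0 \<le> \<tau> \<Longrightarrow> \<tau> \<le> t \<Longrightarrow> cmod (h \<tau>) \<le> B * \<tau> ^ n"
  shows "set_integrable lborel {0..t} h"
    and "cmod (LINT \<tau>:{0..t}|lborel. h \<tau>) \<le> B * t ^ Suc n / Suc n"
proof -
  let ?u = "\<lambda>\<tau>. B * (\<tau> ^ n * indicator {0..t} \<tau>)"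
  have ui: "integrable lborel ?u"
    by (intro integrable_mult_right borel_integrable_atLeastAtMost) simp
  have uv: "integral\<^sup>L lborel ?u = B * (t ^ Suc n / Suc n)"
    using integral_power[OF t, of n] by simp
  have le': "norm (indicator {0..t} \<tau> *\<^sub>R h \<tau>) \<le> ?u \<tau>" for \<tau>
    using le[of \<tau>] by (auto simp: indicator_def)
  show int: "set_integrable lborel {0..t} h"
    unfolding set_integrable_def
    by (rule integrable_dominated[OF ui _ le']) measurable
  have "cmod (LINT \<tau>:{0..t}|lborel. h \<tau>) \<le> integral\<^sup>L lborel ?u"
    unfolding set_lebesgue_integral_def
    by (rule Bochner_Integration.integral_norm_bound_integral[OF int[unfolded set_integrable_def] ui le'])
  then show "cmod (LINT \<tau>:{0..t}|lborel. h \<tau>) \<le> B * t ^ Suc n / Suc n"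
    unfolding uv by simp
qed

text \<open>The Taylor coefficients in \<open>\<epsilon>\<close> of the Fourier transform of the solution with datum \<open>\<epsilon> f\<close>: the
  coefficient of \<open>\<epsilon> ^ Suc n\<close> is \<open>duhamel p f n\<close>. Starting the index at zero makes the nonlinearity an
  ordinary Cauchy product.\<close>

fun duhamel :: "real \<Rightarrow> (real \<Rightarrow> complex) \<Rightarrow> nat \<Rightarrow> real \<Rightarrow> real \<Rightarrow> complex" where
  "duhamel p f 0 t \<xi> = evol p t \<xi> * f \<xi>"
| "duhamel p f (Suc n) t \<xi> = - (\<i> * of_real \<xi> / (4 * of_real pi)) *
     (LINT \<tau>:{0..t}|lborel. evol p (t - \<tau>) \<xi> *
        (\<Sum>j\<le>n. conv (duhamel p f j \<tau>) (duhamel p f (n - j) \<tau>) \<xi>))"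

text \<open>A rescaled Catalan recursion.\<close>

fun majorant :: "real \<Rightarrow> real \<Rightarrow> nat \<Rightarrow> real" where
  "majorant A K 0 = A"
| "majorant A K (Suc n) = K * (\<Sum>j\<le>n. majorant A K j * majorant A K (n - j))"

lemma majorant_nonneg: "0 \<le> A \<Longrightarrow> 0 \<le> K \<Longrightarrow> 0 \<le> majorant A K n"
proof (induction n rule: less_induct)
  case (less n)
  then show ?case by (cases n) (auto intro!: mult_nonneg_nonneg sum_nonneg)
qed

text \<open>The partial sums of the generating function satisfy \<open>S' \<le> A + K x S\<^sup>2\<close> from one degree to the next,
  and the interval below \<open>2 A\<close> is invariant under this map when \<open>4 K A x \<le> 1\<close>.\<close>

lemma majorant_geometric:
  assumes A: "0 \<le> A" and K: "0 \<le> K" and x: "0 \<le> x" "4 * K * A * x \<le> 1"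
  shows "majorant A K n * x ^ n \<le> 2 * A"
proof -
  let ?c = "majorant A K"
  have nn: "0 \<le> ?c n * x ^ n" for n using majorant_nonneg[OF A K] x by simp
  have "(\<Sum>m\<le>n. ?c m * x ^ m) \<le> 2 * A" for n
  proof (induction n)
    case (Suc n)
    let ?S = "\<Sum>m\<le>n. ?c m * x ^ m"
    have S0: "0 \<le> ?S" by (intro sum_nonneg nn)
    have "(\<Sum>m\<le>Suc n. ?c m * x ^ m) = A + (\<Sum>m\<le>n. ?c (Suc m) * x ^ Suc m)"
      by (subst sum.atMost_Suc_shift) simp
    also have "(\<Sum>m\<le>n. ?c (Suc m) * x ^ Suc m)
        = K * x * (\<Sum>m\<le>n. \<Sum>j\<le>m. (?c j * x ^ j) * (?c (m - j) * x ^ (m - j)))"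
      unfolding sum_distrib_left
    proof (intro sum.cong refl)
      fix m assume "m \<in> {..n}"
      have "(?c j * x ^ j) * (?c (m - j) * x ^ (m - j)) = ?c j * ?c (m - j) * x ^ m" if "j \<le> m" for j
        using power_add[of x j "m - j"] that by (simp add: mult_ac)
      then have "(\<Sum>j\<le>m. K * x * ((?c j * x ^ j) * (?c (m - j) * x ^ (m - j))))
          = (\<Sum>j\<le>m. K * x * (?c j * ?c (m - j) * x ^ m))"
        by (intro sum.cong refl) (simp only: atMost_iff)
      then show "?c (Suc m) * x ^ Suc m = (\<Sum>j\<le>m. K * x * ((?c j * x ^ j) * (?c (m - j) * x ^ (m - j))))"
        by (simp add: sum_distrib_left sum_distrib_right mult_ac)
    qed
    also have "(\<Sum>m\<le>n. \<Sum>j\<le>m. (?c j * x ^ j) * (?c (m - j) * x ^ (m - j)))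
        = (\<Sum>(i, j)\<in>{(i, j). i + j \<le> n}. (?c i * x ^ i) * (?c j * x ^ j))"
      by (rule sum.triangle_reindex_eq[symmetric])
    also have "\<dots> \<le> (\<Sum>(i, j)\<in>{..n} \<times> {..n}. (?c i * x ^ i) * (?c j * x ^ j))"
      by (rule sum_mono2) (auto intro!: mult_nonneg_nonneg[OF nn nn])
    also have "\<dots> = ?S * ?S"
      by (simp add: sum_product sum.cartesian_product)
    also have "A + K * x * (?S * ?S) \<le> A + K * x * ((2 * A) * (2 * A))"
      using K x S0 Suc by (intro add_left_mono mult_left_mono mult_mono) auto
    also have "\<dots> \<le> 2 * A"
      using mult_right_mono[OF x(2) A] by (simp add: mult_ac)
    finally show ?case using K x by (simp add: mult_left_mono)
  qed (use A in simp)
  moreover have "?c n * x ^ n \<le> (\<Sum>m\<le>n. ?c m * x ^ m)"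
    by (rule member_le_sum[of n "{..n}" "\<lambda>m. ?c m * x ^ m"]) (use nn in auto)
  ultimately show ?thesis by (meson order_trans)
qed

text \<open>Compact frequency support of the datum is what makes the loss of one derivative harmless, since
  supports grow only linearly with the order of the iterate.\<close>

locale band_limited =
  fixes p A R :: real and f :: "real \<Rightarrow> complex"
  assumes f_meas [measurable]: "f \<in> borel_measurable borel"
    and f_le: "\<And>\<xi>. cmod (f \<xi>) \<le> A * lorentz \<xi>"
    and f_supp: "\<And>\<xi>. R < \<bar>\<xi>\<bar> \<Longrightarrow> f \<xi> = 0"
    and f_herm: "hermitian f"
    and A_nonneg: "0 \<le> A" and R_nonneg: "0 \<le> R"
begin

abbreviation "a \<equiv> duhamel p f"
definition "W = integral\<^sup>L lborel lorentz"
definition "K = 2 * R * W"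

lemma W_nonneg: "0 \<le> W"
  unfolding W_def by (rule Bochner_Integration.integral_nonneg) simp

lemma K_nonneg: "0 \<le> K"
  unfolding K_def using W_nonneg R_nonneg by simp

lemma a_measurable: "case_prod (a n) \<in> borel_measurable (borel \<Otimes>\<^sub>M borel)"
proof (induction n rule: less_induct)
  case (less n)
  show ?case
  proof (cases n)
    case 0
    have "(\<lambda>(t, \<xi>). evol p t \<xi> * f \<xi>) \<in> borel_measurable (borel \<Otimes>\<^sub>M borel)" by measurable
    then show ?thesis by (simp add: 0 split_beta')
  next
    case (Suc m)
    define q where "q = (\<lambda>\<tau> \<xi>. \<Sum>j\<le>m. conv (a j \<tau>) (a (m - j) \<tau>) \<xi>)"
    have cm: "(\<lambda>(\<tau>, \<xi>). conv (a j \<tau>) (a (m - j) \<tau>) \<xi>) \<in> borel_measurable (borel \<Otimes>\<^sub>M borel)"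
      if "j \<le> m" for j
      using less.IH[of j] less.IH[of "m - j"] that Suc by (intro conv_measurable_family) auto
    have [measurable]: "case_prod q \<in> borel_measurable (borel \<Otimes>\<^sub>M borel)"
      unfolding q_def split_beta' by (rule borel_measurable_sum) (use cm in \<open>simp add: split_beta'\<close>)
    have "(\<lambda>z. LINT \<tau>|lborel. (if 0 \<le> \<tau> \<and> \<tau> \<le> fst z then 1 else 0) *\<^sub>R (evol p (fst z - \<tau>) (snd z) * q \<tau> (snd z)))
        \<in> borel_measurable (borel \<Otimes>\<^sub>M borel)"
      by (rule lborel.borel_measurable_lebesgue_integral) measurable
    then have "(\<lambda>z. - (\<i> * of_real (snd z) / (4 * of_real pi)) * (LINT \<tau>|lborel.
          (if 0 \<le> \<tau> \<and> \<tau> \<le> fst z then 1 else 0) *\<^sub>R (evol p (fst z - \<tau>) (snd z) * q \<tau> (snd z))))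
        \<in> borel_measurable (borel \<Otimes>\<^sub>M borel)"
      by measurable
    also have "(\<lambda>z. - (\<i> * of_real (snd z) / (4 * of_real pi)) * (LINT \<tau>|lborel.
          (if 0 \<le> \<tau> \<and> \<tau> \<le> fst z then 1 else 0) *\<^sub>R (evol p (fst z - \<tau>) (snd z) * q \<tau> (snd z)))) = case_prod (a n)"
      by (auto simp: Suc q_def set_lebesgue_integral_def indicator_def fun_eq_iff intro!: Bochner_Integration.integral_cong)
    finally show ?thesis .
  qed
qed

lemma a_measurable1 [measurable]: "a n t \<in> borel_measurable borel"
  using measurable_compose[OF measurable_Pair1' a_measurable[of n], of t] by (simp add: o_def)

lemma conv_sum_measurable:
  "(\<lambda>(\<tau>, \<xi>). \<Sum>j\<le>m. conv (a j \<tau>) (a (m - j) \<tau>) \<xi>) \<in> borel_measurable (borel \<Otimes>\<^sub>M borel)"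
  unfolding split_beta'
  by (rule borel_measurable_sum)
     (use conv_measurable_family[OF a_measurable a_measurable] in \<open>simp add: split_beta'\<close>)

lemma a_support: "(real n + 1) * R < \<bar>\<xi>\<bar> \<Longrightarrow> a n t \<xi> = 0"
proof (induction n arbitrary: t \<xi> rule: less_induct)
  case (less n)
  show ?case
  proof (cases n)
    case 0
    then show ?thesis using less.prems f_supp by simp
  next
    case (Suc m)
    have "conv (a j \<tau>) (a (m - j) \<tau>) \<xi> = 0" if j: "j \<le> m" for j \<tau>
    proof -
      have "a j \<tau> \<eta> * a (m - j) \<tau> (\<xi> - \<eta>) = 0" for \<eta>
      proof (rule ccontr)
        assume "a j \<tau> \<eta> * a (m - j) \<tau> (\<xi> - \<eta>) \<noteq> 0"
        then have "\<bar>\<eta>\<bar> \<le> (real j + 1) * R" "\<bar>\<xi> - \<eta>\<bar> \<le> (real (m - j) + 1) * R"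
          using less.IH[of j \<eta> \<tau>] less.IH[of "m - j" "\<xi> - \<eta>" \<tau>] j Suc by fastforce+
        then have "\<bar>\<xi>\<bar> \<le> (real j + 1) * R + (real (m - j) + 1) * R" by linarith
        also have "\<dots> = (real n + 1) * R" using j Suc by (simp add: of_nat_diff algebra_simps)
        finally show False using less.prems by simp
      qed
      then show ?thesis unfolding conv_def by (simp only: Bochner_Integration.integral_zero)
    qed
    then show ?thesis by (simp add: Suc)
  qed
qed

lemma conv_sum_bound:
  assumes c: "\<And>j. j \<le> m \<Longrightarrow> 0 \<le> c j" and \<tau>: "0 \<le> \<tau>"
    and le: "\<And>j \<eta>. j \<le> m \<Longrightarrow> cmod (a j \<tau> \<eta>) \<le> c j * \<tau> ^ j * lorentz \<eta>"
  shows "cmod (\<Sum>j\<le>m. conv (a j \<tau>) (a (m - j) \<tau>) \<xi>)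
    \<le> (\<Sum>j\<le>m. c j * c (m - j)) * (4 * W) * lorentz \<xi> * \<tau> ^ m"
proof -
  have "cmod (conv (a j \<tau>) (a (m - j) \<tau>) \<xi>) \<le> (c j * c (m - j)) * (4 * W) * lorentz \<xi> * \<tau> ^ m"
    if j: "j \<le> m" for j
  proof -
    have "cmod (conv (a j \<tau>) (a (m - j) \<tau>) \<xi>)
        \<le> (c j * \<tau> ^ j) * (c (m - j) * \<tau> ^ (m - j)) * (4 * integral\<^sup>L lborel lorentz) * lorentz \<xi>"
      by (rule conv_integrable(2)) (use j c \<tau> le in auto)
    also have "\<dots> = (c j * c (m - j)) * (4 * W) * lorentz \<xi> * (\<tau> ^ j * \<tau> ^ (m - j))"
      by (simp add: W_def)
    also have "\<tau> ^ j * \<tau> ^ (m - j) = \<tau> ^ m" using j by (simp flip: power_add)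
    finally show ?thesis .
  qed
  then show ?thesis
    unfolding sum_distrib_right by (intro sum_norm_le) auto
qed

text \<open>The support bounds \<open>\<bar>\<xi>\<bar>\<close> by \<open>(n + 1) R\<close> and the time integral contributes \<open>1 / n\<close>. The quotient is at
  most \<open>2 R\<close>, so the constants obey a recursion without factorial growth.\<close>

lemma a_bound:
  assumes "0 \<le> t"
  shows "cmod (a n t \<xi>) \<le> majorant A K n * t ^ n * lorentz \<xi>"
  using assms
proof (induction n arbitrary: t \<xi> rule: less_induct)
  case (less n)
  let ?c = "majorant A K"
  have c: "0 \<le> ?c j" for j by (rule majorant_nonneg[OF A_nonneg K_nonneg])
  show ?case
  proof (cases n)
    case 0
    have "cmod (a 0 t \<xi>) \<le> 1 * (A * lorentz \<xi>)"
      unfolding duhamel.simps norm_mult by (intro mult_mono norm_evol_le f_le less.prems) auto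
    then show ?thesis by (simp add: 0)
  next
    case (Suc m)
    show ?thesis
    proof (cases "(real n + 1) * R < \<bar>\<xi>\<bar>")
      case True
      then show ?thesis using a_support[OF True] c less.prems by simp
    next
      case False
      define S where "S = (\<Sum>j\<le>m. ?c j * ?c (m - j))"
      have S: "0 \<le> S" unfolding S_def by (intro sum_nonneg mult_nonneg_nonneg c)
      define h where "h = (\<lambda>\<tau>. evol p (t - \<tau>) \<xi> * (\<Sum>j\<le>m. conv (a j \<tau>) (a (m - j) \<tau>) \<xi>))"
      note [measurable] = conv_sum_measurable[of m]
      have hm: "h \<in> borel_measurable borel"
      proof -
        have "(\<lambda>\<tau>. \<Sum>j\<le>m. conv (a j \<tau>) (a (m - j) \<tau>) \<xi>) \<in> borel_measurable borel"
          using measurable_compose[OF measurable_Pair2' conv_sum_measurable[of m], of \<xi>] by simp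
        then show ?thesis unfolding h_def by measurable
      qed
      have hb: "cmod (h \<tau>) \<le> (S * (4 * W) * lorentz \<xi>) * \<tau> ^ m" if "0 \<le> \<tau>" "\<tau> \<le> t" for \<tau>
      proof -
        have "cmod (h \<tau>) \<le> 1 * (S * (4 * W) * lorentz \<xi> * \<tau> ^ m)"
          unfolding h_def norm_mult S_def
          by (intro mult_mono norm_evol_le conv_sum_bound c) (use that less.IH Suc in auto)
        then show ?thesis by simp
      qed
      have "cmod (a n t \<xi>) = \<bar>\<xi>\<bar> / (4 * pi) * cmod (LINT \<tau>:{0..t}|lborel. h \<tau>)"
        by (simp add: Suc h_def norm_mult norm_divide)
      also have "\<dots> \<le> \<bar>\<xi>\<bar> / (4 * pi) * ((S * (4 * W) * lorentz \<xi>) * t ^ n / n)"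
        using set_integral_power_bound(2)[OF hm less.prems hb] by (intro mult_left_mono) (auto simp: Suc)
      also have "\<dots> = (\<bar>\<xi>\<bar> / n) / pi * (S * W * t ^ n * lorentz \<xi>)"
        using Suc by (simp add: field_simps)
      also have "\<dots> \<le> (2 * R) * (S * W * t ^ n * lorentz \<xi>)"
      proof (intro mult_right_mono)
        have "\<bar>\<xi>\<bar> / n \<le> 2 * R"
        proof -
          have "\<bar>\<xi>\<bar> \<le> (real n + 1) * R" using False by simp
          also have "\<dots> \<le> (2 * real n) * R" using Suc R_nonneg by (intro mult_right_mono) auto
          finally show ?thesis using Suc by (simp add: divide_le_eq mult_ac)
        qed
        moreover have "\<bar>\<xi>\<bar> / n / pi \<le> \<bar>\<xi>\<bar> / n"
          using divide_left_mono[of 1 pi "\<bar>\<xi>\<bar> / n"] pi_ge_two by simp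
        ultimately show "\<bar>\<xi>\<bar> / n / pi \<le> 2 * R" by linarith
        show "0 \<le> S * W * t ^ n * lorentz \<xi>" using S W_nonneg less.prems by simp
      qed
      also have "\<dots> = ?c n * t ^ n * lorentz \<xi>"
        by (simp add: Suc S_def K_def)
      finally show ?thesis .
    qed
  qed
qed

lemma a_hermitian: "hermitian (a n t)"
proof (induction n arbitrary: t rule: less_induct)
  case (less n)
  show ?case
  proof (cases n)
    case 0
    then show ?thesis using f_herm by (simp add: hermitian_def hermitian_evol)
  next
    case (Suc m)
    have cj: "conv (a j \<tau>) (a (m - j) \<tau>) (- \<xi>) = cnj (conv (a j \<tau>) (a (m - j) \<tau>) \<xi>)" if "j \<le> m" for j \<tau> \<xi>
      using hermitian_conv[OF less.IH[of j \<tau>] less.IH[of "m - j" \<tau>]] that Suc by (simp add: hermitian_def)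
    show ?thesis
      unfolding hermitian_def
    proof
      fix \<xi>
      let ?h = "\<lambda>\<xi> \<tau>. evol p (t - \<tau>) \<xi> * (\<Sum>j\<le>m. conv (a j \<tau>) (a (m - j) \<tau>) \<xi>)"
      have h: "?h (- \<xi>) \<tau> = cnj (?h \<xi> \<tau>)" for \<tau>
        by (simp add: cj hermitian_evol)
      have "(LINT \<tau>:{0..t}|lborel. ?h (- \<xi>) \<tau>) = (LINT \<tau>|lborel. cnj (indicator {0..t} \<tau> *\<^sub>R ?h \<xi> \<tau>))"
        unfolding set_lebesgue_integral_def h by (simp only: complex_cnj_scaleR)
      also have "\<dots> = cnj (LINT \<tau>:{0..t}|lborel. ?h \<xi> \<tau>)"
        unfolding set_lebesgue_integral_def by (rule Bochner_Integration.integral_cnj)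
      finally have "(LINT \<tau>:{0..t}|lborel. ?h (- \<xi>) \<tau>) = cnj (LINT \<tau>:{0..t}|lborel. ?h \<xi> \<tau>)" .
      then show "a n t (- \<xi>) = cnj (a n t \<xi>)"
        unfolding Suc duhamel.simps by simp
    qed
  qed
qed

end

section \<open>From the frequency side to solutions of the integral equation\<close>

lemma lorentz_le_1: "lorentz x \<le> 1"
  by (simp add: lorentz_def inverse_le_1_iff)

text \<open>For a family of rapidly decreasing Hermitian functions with bounds uniform in time, the Duhamel
  identity on the frequency side suffices: the multiplier acts on the nonlinearity through
  \<open>deriv_rift_square\<close>, Fubini exchanges the time integral with the inverse transform, and continuity
  into every \<open>H\<^sup>\<sigma>\<close> follows by dominated convergence, as the identity itself makes \<open>U\<close> continuous in time for
  each \<open>\<xi>\<close>.\<close>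

lemma mild_solution:
  fixes U :: "real \<Rightarrow> real \<Rightarrow> complex"
  assumes Um [measurable]: "case_prod U \<in> borel_measurable (borel \<Otimes>\<^sub>M borel)"
    and decay: "\<And>k. \<exists>C. \<forall>t\<in>{0..T}. \<forall>\<xi>. \<bar>\<xi>\<bar> ^ k * cmod (U t \<xi>) \<le> C"
    and herm: "\<And>t. t \<in> {0..T} \<Longrightarrow> hermitian (U t)"
    and g: "rapid g" "hermitian g"
    and duh: "\<And>t \<xi>. t \<in> {0..T} \<Longrightarrow> U t \<xi> = evol p t \<xi> * g \<xi>
      - (\<i> * of_real \<xi> / (4 * of_real pi)) * (LINT \<tau>:{0..t}|lborel. evol p (t - \<tau>) \<xi> * conv (U \<tau>) (U \<tau>) \<xi>)"
  shows "is_solution p T (rift g) (\<lambda>t. rift (U t))"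
proof -
  define N where "N = (\<lambda>\<tau> \<xi>. conv (U \<tau>) (U \<tau>) \<xi>)"
  have U1 [measurable]: "U t \<in> borel_measurable borel" for t
    using measurable_compose[OF measurable_Pair1' Um, of t] by simp
  have N2 [measurable]: "case_prod N \<in> borel_measurable (borel \<Otimes>\<^sub>M borel)"
    unfolding N_def by (rule conv_measurable_family) measurable
  have rapid: "rapid (U t)" if "t \<in> {0..T}" for t
    using decay that U1 unfolding rapid_def by blast
  obtain A where A: "0 \<le> A" "\<And>t \<xi>. t \<in> {0..T} \<Longrightarrow> cmod (U t \<xi>) \<le> A * lorentz \<xi>"
  proof -
    obtain C0 C2 where C: "\<And>t \<xi>. t \<in> {0..T} \<Longrightarrow> \<bar>\<xi>\<bar> ^ 0 * cmod (U t \<xi>) \<le> C0"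
      "\<And>t \<xi>. t \<in> {0..T} \<Longrightarrow> \<bar>\<xi>\<bar> ^ 2 * cmod (U t \<xi>) \<le> C2"
      using decay by metis
    have "cmod (U t \<xi>) \<le> \<bar>C0 + C2\<bar> * lorentz \<xi>" if "t \<in> {0..T}" for t \<xi>
    proof -
      have "(1 + \<xi>\<^sup>2) * cmod (U t \<xi>) \<le> \<bar>C0 + C2\<bar>"
        using C(1)[OF that, of \<xi>] C(2)[OF that, of \<xi>] by (simp add: distrib_right)
      then show ?thesis by (simp add: lorentz_def field_simps add_pos_nonneg)
    qed
    then show ?thesis using that[of "\<bar>C0 + C2\<bar>"] by simp
  qed
  have N_decay: "\<exists>C. \<forall>t\<in>{0..T}. \<forall>\<xi>. \<bar>\<xi>\<bar> ^ k * cmod (N t \<xi>) \<le> C" for k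
  proof -
    obtain C where C: "\<And>t \<xi>. t \<in> {0..T} \<Longrightarrow> \<bar>\<xi>\<bar> ^ k * cmod (U t \<xi>) \<le> C"
      using decay[of k] by blast
    show ?thesis
      unfolding N_def using conv_power_bound[OF U1 U1 A(1) A(2) A(1) A(2) C C] by blast
  qed
  obtain B where B: "0 \<le> B" "\<And>t \<xi>. t \<in> {0..T} \<Longrightarrow> \<bar>\<xi>\<bar> * cmod (N t \<xi>) \<le> B * lorentz \<xi>"
  proof -
    obtain C1 C3 where C: "\<And>t \<xi>. t \<in> {0..T} \<Longrightarrow> \<bar>\<xi>\<bar> ^ 1 * cmod (N t \<xi>) \<le> C1"
      "\<And>t \<xi>. t \<in> {0..T} \<Longrightarrow> \<bar>\<xi>\<bar> ^ 3 * cmod (N t \<xi>) \<le> C3"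
      using N_decay by metis
    have "\<bar>\<xi>\<bar> * cmod (N t \<xi>) \<le> \<bar>C1 + C3\<bar> * lorentz \<xi>" if "t \<in> {0..T}" for t \<xi>
    proof -
      have "(1 + \<xi>\<^sup>2) * (\<bar>\<xi>\<bar> * cmod (N t \<xi>)) = \<bar>\<xi>\<bar> ^ 1 * cmod (N t \<xi>) + \<bar>\<xi>\<bar> ^ 3 * cmod (N t \<xi>)"
      proof -
        have "\<bar>\<xi>\<bar> ^ 3 = \<xi>\<^sup>2 * \<bar>\<xi>\<bar>" by (simp add: power3_eq_cube power2_eq_square)
        then show ?thesis by (simp add: distrib_right)
      qed
      also have "\<dots> \<le> \<bar>C1 + C3\<bar>"
        using C(1)[OF that, of \<xi>] C(2)[OF that, of \<xi>] by linarith
      finally show ?thesis by (simp add: lorentz_def field_simps add_pos_nonneg)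
    qed
    then show ?thesis using that[of "\<bar>C1 + C3\<bar>"] by simp
  qed

  have equation: "complex_of_real (rift (U t) x) = semigroup p t (rift g) x -
        1/2 * (LINT \<tau>:{0..t}|lborel. semigroup p (t - \<tau>) (deriv (\<lambda>y. (rift (U \<tau>) y)\<^sup>2)) x)"
    if t: "t \<in> {0..T}" for t x
  proof -
    let ?e = "\<lambda>\<xi>. exp (\<i> * of_real (x * \<xi>))"
    define h where "h = (\<lambda>\<tau> \<xi>. \<i> * of_real \<xi> * N \<tau> \<xi> / (2 * of_real pi))"
    have h2 [measurable]: "case_prod h \<in> borel_measurable (borel \<Otimes>\<^sub>M borel)"
      unfolding h_def by measurable
    have h_le: "cmod (h \<tau> \<xi>) \<le> B * lorentz \<xi>" if "\<tau> \<in> {0..T}" for \<tau> \<xi>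
    proof -
      have "cmod (h \<tau> \<xi>) = \<bar>\<xi>\<bar> * cmod (N \<tau> \<xi>) / (2 * pi)"
        by (simp add: h_def norm_mult norm_divide)
      also have "\<dots> \<le> \<bar>\<xi>\<bar> * cmod (N \<tau> \<xi>) / 1"
        using pi_ge_two by (intro divide_left_mono) auto
      finally show ?thesis using B(2)[OF that, of \<xi>] by simp
    qed
    have sg: "semigroup p (t - \<tau>) (deriv (\<lambda>y. (rift (U \<tau>) y)\<^sup>2)) x = ift (\<lambda>\<xi>. evol p (t - \<tau>) \<xi> * h \<tau> \<xi>) x"
      if \<tau>: "\<tau> \<in> {0..t}" for \<tau>
    proof -
      have \<tau>T: "\<tau> \<in> {0..T}" using \<tau> t by auto
      have hr: "rapid (h \<tau>)"
      proof (rule rapid_dominated[OF rapid_mult_power[OF rapid_conv[OF rapid[OF \<tau>T] rapid[OF \<tau>T]], of 1 1], of _ 1])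
        show "h \<tau> \<in> borel_measurable borel" unfolding h_def by measurable
        show "cmod (h \<tau> \<xi>) \<le> 1 * cmod ((1 * of_real \<xi>) ^ 1 * conv (U \<tau>) (U \<tau>) \<xi>)" for \<xi>
          using pi_ge_two divide_left_mono[of 1 "2 * pi" "\<bar>\<xi>\<bar> * cmod (N \<tau> \<xi>)"]
          by (simp add: h_def N_def norm_mult norm_divide)
      qed
      have hh: "hermitian (h \<tau>)"
        using hermitian_conv[OF herm[OF \<tau>T] herm[OF \<tau>T]] by (simp add: hermitian_def h_def N_def)
      show ?thesis
        unfolding deriv_rift_square[OF rapid[OF \<tau>T] herm[OF \<tau>T]]
        using semigroup_rift[OF hr hh] by (simp add: h_def N_def)
    qed
    let ?F = "\<lambda>\<tau> \<xi>. indicator {0..t} \<tau> *\<^sub>R (?e \<xi> * (evol p (t - \<tau>) \<xi> * h \<tau> \<xi>))"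
    have int: "integrable (lborel \<Otimes>\<^sub>M lborel) (\<lambda>(\<tau>, \<xi>). ?F \<tau> \<xi>)"
    proof (rule integrable_prod_bound)
      show "integrable lborel (\<lambda>\<tau>. indicator {0..t} \<tau> :: real)"
        by (rule integrable_real_indicator) (use t in auto)
      show "integrable lborel (\<lambda>\<xi>. B * lorentz \<xi>)"
        by (intro integrable_mult_right lorentz_integrable)
      show "cmod (?F \<tau> \<xi>) \<le> indicator {0..t} \<tau> * (B * lorentz \<xi>)" for \<tau> \<xi>
      proof (cases "\<tau> \<in> {0..t}")
        case True
        have "cmod (evol p (t - \<tau>) \<xi>) * cmod (h \<tau> \<xi>) \<le> 1 * (B * lorentz \<xi>)"
          using True t by (intro mult_mono norm_evol_le h_le) auto
        then show ?thesis using True by (simp add: norm_mult)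
      qed simp
    qed measurable
    \<comment> \<open>The Duhamel identity expresses the time integral through \<open>U\<close>, from which it inherits integrability in \<open>\<xi>\<close>.\<close>
    define J where "J = (\<lambda>\<xi>. LINT \<tau>:{0..t}|lborel. evol p (t - \<tau>) \<xi> * h \<tau> \<xi>)"
    have J: "J \<xi> = 2 * (evol p t \<xi> * g \<xi> - U t \<xi>)" for \<xi>
    proof -
      have "J \<xi> = (LINT \<tau>:{0..t}|lborel. (\<i> * of_real \<xi> / (2 * of_real pi)) * (evol p (t - \<tau>) \<xi> * N \<tau> \<xi>))"
        unfolding J_def h_def by (intro set_lebesgue_integral_cong) auto
      also have "\<dots> = (\<i> * of_real \<xi> / (2 * of_real pi)) * (LINT \<tau>:{0..t}|lborel. evol p (t - \<tau>) \<xi> * N \<tau> \<xi>)"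
        by (rule set_integral_mult_right)
      also have "\<dots> = 2 * ((\<i> * of_real \<xi> / (4 * of_real pi)) * (LINT \<tau>:{0..t}|lborel. evol p (t - \<tau>) \<xi> * N \<tau> \<xi>))"
        by simp
      also have "\<dots> = 2 * (evol p t \<xi> * g \<xi> - U t \<xi>)"
        unfolding duh[OF t] N_def by simp
      finally show ?thesis .
    qed
    have "(LINT \<tau>:{0..t}|lborel. semigroup p (t - \<tau>) (deriv (\<lambda>y. (rift (U \<tau>) y)\<^sup>2)) x)
        = (LINT \<tau>:{0..t}|lborel. ift (\<lambda>\<xi>. evol p (t - \<tau>) \<xi> * h \<tau> \<xi>) x)"
      by (intro set_lebesgue_integral_cong) (use sg in auto)
    also have "\<dots> = (LINT \<tau>|lborel. 1 / (2 * of_real pi) * (LINT \<xi>|lborel. ?F \<tau> \<xi>))"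
      unfolding set_lebesgue_integral_def ift_def integral_scaleR_right by (simp add: scaleR_conv_of_real mult_ac)
    also have "\<dots> = 1 / (2 * of_real pi) * (LINT \<tau>|lborel. LINT \<xi>|lborel. ?F \<tau> \<xi>)"
      by (rule integral_mult_right_zero)
    also have "(LINT \<tau>|lborel. LINT \<xi>|lborel. ?F \<tau> \<xi>) = (LINT \<xi>|lborel. LINT \<tau>|lborel. ?F \<tau> \<xi>)"
      by (rule lborel_pair.Fubini_integral[OF int, symmetric])
    also have "\<dots> = (LINT \<xi>|lborel. ?e \<xi> * J \<xi>)"
      unfolding J_def set_lebesgue_integral_def
      by (subst integral_mult_right_zero[symmetric]) (simp only: mult_scaleR_right)
    also have "\<dots> = (LINT \<xi>|lborel. 2 * (?e \<xi> * (evol p t \<xi> * g \<xi>) - ?e \<xi> * U t \<xi>))"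
      by (simp only: J right_diff_distrib mult.left_commute)
    also have "\<dots> = 2 * (LINT \<xi>|lborel. ?e \<xi> * (evol p t \<xi> * g \<xi>) - ?e \<xi> * U t \<xi>)"
      by (rule integral_mult_right_zero)
    also have "(LINT \<xi>|lborel. ?e \<xi> * (evol p t \<xi> * g \<xi>) - ?e \<xi> * U t \<xi>)
        = (LINT \<xi>|lborel. ?e \<xi> * (evol p t \<xi> * g \<xi>)) - (LINT \<xi>|lborel. ?e \<xi> * U t \<xi>)"
    proof (rule Bochner_Integration.integral_diff)
      have "rapid (\<lambda>\<xi>. evol p t \<xi> * g \<xi>)"
      proof (rule rapid_dominated[OF g(1), of _ 1])
        show "(\<lambda>\<xi>. evol p t \<xi> * g \<xi>) \<in> borel_measurable borel"
          using rapid_measurable[OF g(1)] by measurable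
        show "cmod (evol p t \<xi> * g \<xi>) \<le> 1 * cmod (g \<xi>)" for \<xi>
          unfolding norm_mult using t by (intro mult_right_mono norm_evol_le) auto
      qed
      then show "integrable lborel (\<lambda>\<xi>. ?e \<xi> * (evol p t \<xi> * g \<xi>))" by (rule ift_integrable)
      show "integrable lborel (\<lambda>\<xi>. ?e \<xi> * U t \<xi>)" by (rule ift_integrable[OF rapid[OF t]])
    qed
    finally have "(LINT \<tau>:{0..t}|lborel. semigroup p (t - \<tau>) (deriv (\<lambda>y. (rift (U \<tau>) y)\<^sup>2)) x)
        = 2 * (semigroup p t (rift g) x - ift (U t) x)"
      unfolding semigroup_rift[OF g] ift_def by (simp add: right_diff_distrib)
    then show ?thesis
      by (simp add: ift_real[OF rapid[OF t] herm[OF t]] diff_divide_distrib)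
  qed

  have cont: "continuous_on {0..T} (\<lambda>t. U t \<xi>)" for \<xi>
  proof -
    obtain C where C: "\<And>t \<xi>. t \<in> {0..T} \<Longrightarrow> \<bar>\<xi>\<bar> ^ 0 * cmod (N t \<xi>) \<le> C"
      using N_decay[of 0] by blast
    define G where "G = (\<lambda>\<tau>. evol p (- \<tau>) \<xi> * N \<tau> \<xi>)"
    have Gm [measurable]: "G \<in> borel_measurable borel" unfolding G_def by measurable
    have G_le: "cmod (G \<tau>) \<le> (exp (T * \<bar>\<xi>\<bar> powr p) * C) * \<tau> ^ 0" if "0 \<le> \<tau>" "\<tau> \<le> T" for \<tau>
      unfolding G_def norm_mult norm_evol
      using C[of \<tau> \<xi>] that by (simp, intro mult_mono) (auto intro!: mult_right_mono)
    have Gi: "set_integrable lborel {0..t} G" if "t \<in> {0..T}" for t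
      by (rule set_integral_power_bound(1)[OF Gm _ G_le]) (use that in auto)
    have eq: "U t \<xi> = evol p t \<xi> * g \<xi> - (\<i> * of_real \<xi> / (4 * of_real pi)) * (evol p t \<xi> * integral {0..t} G)"
      if t: "t \<in> {0..T}" for t
    proof -
      have "(LINT \<tau>:{0..t}|lborel. evol p (t - \<tau>) \<xi> * conv (U \<tau>) (U \<tau>) \<xi>)
          = (LINT \<tau>:{0..t}|lborel. evol p t \<xi> * G \<tau>)"
        using evol_add[of p t "- \<tau>" \<xi> for \<tau>] by (simp add: G_def N_def mult.assoc)
      also have "\<dots> = evol p t \<xi> * (LINT \<tau>:{0..t}|lborel. G \<tau>)"
        by (rule set_integral_mult_right)
      also have "(LINT \<tau>:{0..t}|lborel. G \<tau>) = integral {0..t} G"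
        by (rule set_borel_integral_eq_integral(2)[OF Gi[OF t]])
      finally show ?thesis unfolding duh[OF t] by simp
    qed
    have "continuous_on {0..T} (\<lambda>t. integral {0..t} G)"
    proof (cases "0 \<le> T")
      case True
      then show ?thesis
        using set_borel_integral_eq_integral(1)[OF Gi[of T]] by (intro indefinite_integral_continuous_1) auto
    qed simp
    then have "continuous_on {0..T} (\<lambda>t. evol p t \<xi> * g \<xi> - (\<i> * of_real \<xi> / (4 * of_real pi)) * (evol p t \<xi> * integral {0..t} G))"
      by (intro continuous_intros continuous_evol)
    then show ?thesis by (rule continuous_on_cong[THEN iffD2, OF refl, rotated]) (rule eq)
  qed

  have norm_eq: "sobolev_norm \<sigma> (dist_of (rift (U \<tau>)) - dist_of (rift (U t)))
      = sqrt (LINT \<xi>|lborel. (1 + \<xi>\<^sup>2) powr \<sigma> * (cmod (U \<tau> \<xi> - U t \<xi>))\<^sup>2)"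
    if "\<tau> \<in> {0..T}" "t \<in> {0..T}" for \<sigma> \<tau> t
    by (intro sobolev_norm_eq has_fourier_fun_diff has_fourier_fun_rift rapid herm that)
  have continuity: "((\<lambda>\<tau>. sobolev_norm \<sigma> (dist_of (rift (U \<tau>)) - dist_of (rift (U t)))) \<longlongrightarrow> 0) (at t within {0..T})"
    if t: "t \<in> {0..T}" for \<sigma> t
    unfolding tendsto_at_iff_sequentially
  proof (intro allI impI)
    fix X assume X: "\<forall>i::nat. X i \<in> {0..T} - {t}" "X \<longlonglongrightarrow> t"
    then have XT: "X i \<in> {0..T}" for i by blast
    define k where "k = nat \<lceil>\<sigma>\<rceil>"
    have k: "\<sigma> \<le> real k" by (simp add: k_def real_nat_ceiling_ge)
    obtain C where C: "\<And>t \<xi>. t \<in> {0..T} \<Longrightarrow> \<bar>\<xi>\<bar> ^ (2 * k) * cmod (U t \<xi>) \<le> C"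
      using decay[of "2 * k"] by blast
    have b1: "cmod (U \<tau> \<xi> - U t \<xi>) \<le> (2 * A) * lorentz \<xi>" if "\<tau> \<in> {0..T}" for \<tau> \<xi>
      using norm_triangle_ineq4[of "U \<tau> \<xi>" "U t \<xi>"] A(2)[OF that, of \<xi>] A(2)[OF t, of \<xi>] by linarith
    have b2: "\<bar>\<xi>\<bar> ^ (2 * k) * cmod (U \<tau> \<xi> - U t \<xi>) \<le> 2 * C" if "\<tau> \<in> {0..T}" for \<tau> \<xi>
    proof -
      have "\<bar>\<xi>\<bar> ^ (2 * k) * cmod (U \<tau> \<xi> - U t \<xi>) \<le> \<bar>\<xi>\<bar> ^ (2 * k) * (cmod (U \<tau> \<xi>) + cmod (U t \<xi>))"
        by (intro mult_left_mono norm_triangle_ineq4) auto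
      then show ?thesis using C[OF that, of \<xi>] C[OF t, of \<xi>] by (simp only: distrib_left)
    qed
    have "(\<lambda>i. LINT \<xi>|lborel. (1 + \<xi>\<^sup>2) powr \<sigma> * (cmod (U (X i) \<xi> - U t \<xi>))\<^sup>2) \<longlonglongrightarrow> (LINT (\<xi>::real)|lborel. (0::real))"
    proof (rule integral_dominated_convergence)
      show "integrable lborel (\<lambda>\<xi>. 2 ^ k * (2 * A + 2 * C) * (2 * A) * lorentz \<xi>)"
        by (intro integrable_mult_right lorentz_integrable)
      show "AE \<xi> in lborel. norm ((1 + \<xi>\<^sup>2) powr \<sigma> * (cmod (U (X i) \<xi> - U t \<xi>))\<^sup>2)
          \<le> 2 ^ k * (2 * A + 2 * C) * (2 * A) * lorentz \<xi>" for i
        using weight_le_lorentz[OF k b1[OF XT] b2[OF XT]] by (intro AE_I2) simp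
      show "AE \<xi> in lborel. (\<lambda>i. (1 + \<xi>\<^sup>2) powr \<sigma> * (cmod (U (X i) \<xi> - U t \<xi>))\<^sup>2) \<longlonglongrightarrow> 0"
      proof (intro AE_I2)
        fix \<xi>
        have "(\<lambda>i. U (X i) \<xi>) \<longlonglongrightarrow> U t \<xi>"
          using cont[of \<xi>] X(2) t XT by (auto simp: continuous_on_sequentially o_def)
        then have "(\<lambda>i. (1 + \<xi>\<^sup>2) powr \<sigma> * (cmod (U (X i) \<xi> - U t \<xi>))\<^sup>2) \<longlonglongrightarrow> (1 + \<xi>\<^sup>2) powr \<sigma> * (cmod (U t \<xi> - U t \<xi>))\<^sup>2"
          by (intro tendsto_intros)
        then show "(\<lambda>i. (1 + \<xi>\<^sup>2) powr \<sigma> * (cmod (U (X i) \<xi> - U t \<xi>))\<^sup>2) \<longlonglongrightarrow> 0" by simp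
      qed
    qed measurable
    from tendsto_real_sqrt[OF this]
    show "((\<lambda>\<tau>. sobolev_norm \<sigma> (dist_of (rift (U \<tau>)) - dist_of (rift (U t)))) \<circ> X) \<longlonglongrightarrow> 0"
      by (simp add: o_def norm_eq[OF XT t])
  qed
  show ?thesis
    unfolding is_solution_def
    using equation continuity rift_H_infinity[OF rapid herm] by blast
qed

section \<open>Summation of the series\<close>

text \<open>The smallness condition makes the series in \<open>\<epsilon>\<close> converge like a geometric series of ratio \<open>1/2\<close>,
  uniformly for times in \<open>[0,T]\<close>.\<close>

locale small_amplitude = band_limited +
  fixes T \<epsilon> :: real
  assumes T_nonneg: "0 \<le> T" and small: "\<bar>\<epsilon>\<bar> * (T * (4 * K * A + 1)) \<le> 1 / 2"
begin

definition Z :: "real \<Rightarrow> real \<Rightarrow> complex" where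
  "Z t \<xi> = (\<Sum>n. of_real \<epsilon> ^ n * a n t \<xi>)"

lemma term_le:
  assumes t: "t \<in> {0..T}"
  shows "cmod (of_real \<epsilon> ^ n * a n t \<xi>) \<le> 2 * A * (1/2) ^ n * lorentz \<xi>"
proof -
  define m where "m = 4 * K * A + 1"
  have m: "0 < m" using K_nonneg A_nonneg by (simp add: m_def add_nonneg_pos)
  have c: "0 \<le> majorant A K n" by (rule majorant_nonneg[OF A_nonneg K_nonneg])
  have geo: "majorant A K n * (1 / m) ^ n \<le> 2 * A"
    by (rule majorant_geometric[OF A_nonneg K_nonneg]) (use m in \<open>auto simp: m_def\<close>)
  have "\<bar>\<epsilon>\<bar> * t * m \<le> \<bar>\<epsilon>\<bar> * (T * m)"
    unfolding mult.assoc using t m by (intro mult_right_mono mult_left_mono) auto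
  then have le: "\<bar>\<epsilon>\<bar> * t * m \<le> 1 / 2"
    by (rule order_trans) (rule small[folded m_def])
  have "cmod (of_real \<epsilon> ^ n * a n t \<xi>) \<le> \<bar>\<epsilon>\<bar> ^ n * (majorant A K n * t ^ n * lorentz \<xi>)"
    unfolding norm_mult norm_power using a_bound[of t n \<xi>] t by (intro mult_mono) auto
  also have "\<dots> = (majorant A K n * (1 / m) ^ n) * (\<bar>\<epsilon>\<bar> * t * m) ^ n * lorentz \<xi>"
    using m by (simp add: power_mult_distrib power_divide)
  also have "\<dots> \<le> (2 * A) * (1/2) ^ n * lorentz \<xi>"
    using m t A_nonneg c by (intro mult_right_mono mult_mono[OF geo power_mono[OF le]]) auto
  finally show ?thesis .
qed

lemma summable_half: "summable (\<lambda>n. c * (1/2 :: real) ^ n)"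
  by (intro summable_mult summable_geometric) simp

lemma term_summable:
  assumes "t \<in> {0..T}"
  shows "summable (\<lambda>n. cmod (of_real \<epsilon> ^ n * a n t \<xi>))"
  by (rule summable_comparison_test[OF _ summable_half[of "2 * A * lorentz \<xi>"]])
     (use term_le[OF assms] in \<open>auto simp: mult_ac\<close>)

lemma Z_measurable [measurable]: "case_prod Z \<in> borel_measurable (borel \<Otimes>\<^sub>M borel)"
proof -
  note [measurable] = a_measurable
  show ?thesis unfolding Z_def split_beta' by measurable
qed

text \<open>A power of \<open>\<xi>\<close> costs the \<open>n\<close>-th term a power of \<open>n + 1\<close> because of its support, which the
  geometric factor absorbs.\<close>

lemma Z_decay: "\<exists>C. \<forall>t\<in>{0..T}. \<forall>\<xi>. \<bar>\<xi>\<bar> ^ k * cmod (Z t \<xi>) \<le> C"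
proof (intro exI ballI allI)
  fix t \<xi> assume t: "t \<in> {0..T}"
  let ?C = "\<lambda>n. 2 * A * R ^ k * ((real n + 1) ^ k * (1/2) ^ n)"
  have le: "norm (of_real (\<bar>\<xi>\<bar> ^ k) * (of_real \<epsilon> ^ n * a n t \<xi>)) \<le> ?C n" for n
  proof (cases "(real n + 1) * R < \<bar>\<xi>\<bar>")
    case True
    then show ?thesis using a_support[OF True] A_nonneg R_nonneg by simp
  next
    case False
    have "norm (of_real (\<bar>\<xi>\<bar> ^ k) * (of_real \<epsilon> ^ n * a n t \<xi>)) = \<bar>\<xi>\<bar> ^ k * cmod (of_real \<epsilon> ^ n * a n t \<xi>)"
      unfolding norm_mult[of "of_real (\<bar>\<xi>\<bar> ^ k)"] by (simp add: norm_power)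
    also have "\<dots> \<le> ((real n + 1) * R) ^ k * (2 * A * (1/2) ^ n * 1)"
    proof (intro mult_mono power_mono)
      show "cmod (of_real \<epsilon> ^ n * a n t \<xi>) \<le> 2 * A * (1/2) ^ n * 1"
        using A_nonneg lorentz_le_1 by (intro order_trans[OF term_le[OF t]] mult_left_mono) auto
    qed (use False R_nonneg in auto)
    also have "\<dots> = ?C n" by (simp add: power_mult_distrib)
    finally show ?thesis .
  qed
  have "\<bar>\<xi>\<bar> ^ k * cmod (Z t \<xi>) = cmod (of_real (\<bar>\<xi>\<bar> ^ k) * Z t \<xi>)"
    unfolding norm_mult by (simp add: norm_power)
  also have "\<dots> = cmod (\<Sum>n. of_real (\<bar>\<xi>\<bar> ^ k) * (of_real \<epsilon> ^ n * a n t \<xi>))"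
    unfolding Z_def by (subst suminf_mult) (rule summable_norm_cancel[OF term_summable[OF t]], rule refl)
  also have "\<dots> \<le> suminf ?C"
    by (rule norm_suminf_le[OF le]) (intro summable_mult summable_power_geometric)
  finally show "\<bar>\<xi>\<bar> ^ k * cmod (Z t \<xi>) \<le> suminf ?C" .
qed

lemma Z_hermitian:
  assumes "t \<in> {0..T}"
  shows "hermitian (Z t)"
  unfolding hermitian_def
proof
  fix \<xi>
  have "(\<lambda>n. of_real \<epsilon> ^ n * a n t \<xi>) sums Z t \<xi>"
    unfolding Z_def by (rule summable_sums[OF summable_norm_cancel[OF term_summable[OF assms]]])
  then have "(\<lambda>n. cnj (of_real \<epsilon> ^ n * a n t \<xi>)) sums cnj (Z t \<xi>)"
    by (simp only: sums_cnj)
  moreover have "cnj (of_real \<epsilon> ^ n * a n t \<xi>) = of_real \<epsilon> ^ n * a n t (- \<xi>)" for n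
    using a_hermitian[of n t] by (simp add: hermitian_def)
  ultimately have "(\<lambda>n. of_real \<epsilon> ^ n * a n t (- \<xi>)) sums cnj (Z t \<xi>)"
    by (simp only:)
  then show "Z t (- \<xi>) = cnj (Z t \<xi>)"
    unfolding Z_def[of t "- \<xi>"] by (rule sums_unique[symmetric])
qed

lemma product_term_le:
  assumes t: "t \<in> {0..T}"
  shows "cmod (\<Sum>j\<le>n. (of_real \<epsilon> ^ j * a j t \<eta>) * (of_real \<epsilon> ^ (n - j) * a (n - j) t \<zeta>))
    \<le> (4 * A\<^sup>2) * ((real n + 1) ^ 1 * (1/2) ^ n) * (lorentz \<eta> * lorentz \<zeta>)"
proof -
  have "cmod ((of_real \<epsilon> ^ j * a j t \<eta>) * (of_real \<epsilon> ^ (n - j) * a (n - j) t \<zeta>))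
      \<le> 4 * A\<^sup>2 * (1/2) ^ n * (lorentz \<eta> * lorentz \<zeta>)" if "j \<in> {..n}" for j
  proof -
    have "cmod ((of_real \<epsilon> ^ j * a j t \<eta>) * (of_real \<epsilon> ^ (n - j) * a (n - j) t \<zeta>))
        \<le> (2 * A * (1/2) ^ j * lorentz \<eta>) * (2 * A * (1/2) ^ (n - j) * lorentz \<zeta>)"
      unfolding norm_mult[of "of_real \<epsilon> ^ j * a j t \<eta>"]
      using A_nonneg by (intro mult_mono term_le t) auto
    also have "\<dots> = 4 * A\<^sup>2 * ((1/2) ^ j * (1/2) ^ (n - j)) * (lorentz \<eta> * lorentz \<zeta>)"
      by (simp add: power2_eq_square)
    also have "(1/2) ^ j * (1/2 :: real) ^ (n - j) = (1/2) ^ n"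
      using that by (simp flip: power_add)
    finally show ?thesis .
  qed
  then have "cmod (\<Sum>j\<le>n. (of_real \<epsilon> ^ j * a j t \<eta>) * (of_real \<epsilon> ^ (n - j) * a (n - j) t \<zeta>))
    \<le> (\<Sum>j\<le>n. 4 * A\<^sup>2 * (1/2) ^ n * (lorentz \<eta> * lorentz \<zeta>))"
    by (rule sum_norm_le)
  then show ?thesis by (simp add: mult_ac add.commute)
qed

lemma conv_Z_sums:
  assumes t: "t \<in> {0..T}"
  shows "(\<lambda>n. of_real \<epsilon> ^ n * (\<Sum>j\<le>n. conv (a j t) (a (n - j) t) \<xi>)) sums conv (Z t) (Z t) \<xi>"
proof -
  let ?g = "\<lambda>n \<eta>. \<Sum>j\<le>n. (of_real \<epsilon> ^ j * a j t \<eta>) * (of_real \<epsilon> ^ (n - j) * a (n - j) t (\<xi> - \<eta>))"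
  let ?C = "\<lambda>n. (4 * A\<^sup>2) * ((real n + 1) ^ 1 * (1/2) ^ n)"
  have le: "cmod (?g n \<eta>) \<le> ?C n * lorentz \<eta>" for n \<eta>
  proof -
    have "?C n * (lorentz \<eta> * lorentz (\<xi> - \<eta>)) \<le> ?C n * (lorentz \<eta> * 1)"
      by (intro mult_left_mono lorentz_le_1) auto
    then show ?thesis using product_term_le[OF t, where n=n and \<eta>=\<eta> and \<zeta>="\<xi> - \<eta>"] by simp
  qed
  have "(\<lambda>n. integral\<^sup>L lborel (?g n)) sums (LINT \<eta>|lborel. (\<Sum>n. ?g n \<eta>))"
    by (rule sums_integral_dominated(1)[OF _ lorentz_integrable le])
       (measurable, intro summable_mult summable_power_geometric)
  moreover have "(\<Sum>n. ?g n \<eta>) = Z t \<eta> * Z t (\<xi> - \<eta>)" for \<eta>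
    unfolding Z_def
    by (rule sums_unique[symmetric]) (rule Cauchy_product_sums[OF term_summable[OF t] term_summable[OF t]])
  moreover have "integral\<^sup>L lborel (?g n) = of_real \<epsilon> ^ n * (\<Sum>j\<le>n. conv (a j t) (a (n - j) t) \<xi>)" for n
  proof -
    have i: "integrable lborel (\<lambda>\<eta>. a j t \<eta> * a l t (\<xi> - \<eta>))" for j l
      by (rule conv_integrable(1)[of _ _ "majorant A K j * t ^ j" "majorant A K l * t ^ l"])
         (use t a_bound majorant_nonneg[OF A_nonneg K_nonneg] in auto)
    have "?g n \<eta> = (\<Sum>j\<le>n. of_real \<epsilon> ^ n * (a j t \<eta> * a (n - j) t (\<xi> - \<eta>)))" for \<eta>
    proof (intro sum.cong refl)
      fix j assume "j \<in> {..n}"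
      then have "of_real \<epsilon> ^ n = (of_real \<epsilon> ^ j * of_real \<epsilon> ^ (n - j) :: complex)"
        by (simp flip: power_add)
      then show "(of_real \<epsilon> ^ j * a j t \<eta>) * (of_real \<epsilon> ^ (n - j) * a (n - j) t (\<xi> - \<eta>))
          = of_real \<epsilon> ^ n * (a j t \<eta> * a (n - j) t (\<xi> - \<eta>))"
        by (simp only: mult_ac)
    qed
    then have "integral\<^sup>L lborel (?g n) = (\<Sum>j\<le>n. LINT \<eta>|lborel. of_real \<epsilon> ^ n * (a j t \<eta> * a (n - j) t (\<xi> - \<eta>)))"
      by (simp only: Bochner_Integration.integral_sum[OF integrable_mult_right[OF i]])
    then show ?thesis
      by (simp only: integral_mult_right_zero conv_def sum_distrib_left)
  qed
  ultimately show ?thesis by (simp only: conv_def)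
qed

lemma Z_duhamel:
  assumes t: "t \<in> {0..T}"
  shows "Z t \<xi> = evol p t \<xi> * f \<xi> - of_real \<epsilon> * (\<i> * of_real \<xi> / (4 * of_real pi)) *
    (LINT \<tau>:{0..t}|lborel. evol p (t - \<tau>) \<xi> * conv (Z \<tau>) (Z \<tau>) \<xi>)"
proof -
  let ?c = "\<lambda>n \<tau>. \<Sum>j\<le>n. conv (a j \<tau>) (a (n - j) \<tau>) \<xi>"
  let ?h = "\<lambda>n \<tau>. indicator {0..t} \<tau> *\<^sub>R (evol p (t - \<tau>) \<xi> * (of_real \<epsilon> ^ n * ?c n \<tau>))"
  let ?C = "\<lambda>n. (4 * A\<^sup>2) * ((real n + 1) ^ 1 * (1/2) ^ n) * (4 * W)"
  have cm [measurable]: "?c n \<in> borel_measurable borel" for n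
    using measurable_compose[OF measurable_Pair2' conv_sum_measurable[of n], of \<xi>] by simp
  have c_le: "cmod (of_real \<epsilon> ^ n * ?c n \<tau>) \<le> ?C n" if \<tau>: "\<tau> \<in> {0..T}" for n \<tau>
  proof -
    have each: "cmod (of_real \<epsilon> ^ n * conv (a j \<tau>) (a (n - j) \<tau>) \<xi>) \<le> 4 * A\<^sup>2 * (1/2) ^ n * (4 * W)"
      if j: "j \<in> {..n}" for j
    proof -
      have "of_real \<epsilon> ^ n * conv (a j \<tau>) (a (n - j) \<tau>) \<xi>
          = conv (\<lambda>\<eta>. of_real \<epsilon> ^ j * a j \<tau> \<eta>) (\<lambda>\<eta>. of_real \<epsilon> ^ (n - j) * a (n - j) \<tau> \<eta>) \<xi>"
      proof -
        have e: "of_real \<epsilon> ^ n = (of_real \<epsilon> ^ j * of_real \<epsilon> ^ (n - j) :: complex)"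
          using j by (simp flip: power_add)
        show ?thesis
          unfolding conv_def e
          by (subst integral_mult_right_zero[symmetric]) (simp only: mult_ac)
      qed
      also have "cmod \<dots> \<le> (2 * A * (1/2) ^ j) * (2 * A * (1/2) ^ (n - j)) * (4 * integral\<^sup>L lborel lorentz) * lorentz \<xi>"
        by (rule conv_integrable(2)) (use term_le[OF \<tau>] A_nonneg in auto)
      also have "\<dots> = 4 * A\<^sup>2 * ((1/2) ^ j * (1/2) ^ (n - j)) * (4 * W) * lorentz \<xi>"
        by (simp add: W_def power2_eq_square)
      also have "(1/2) ^ j * (1/2 :: real) ^ (n - j) = (1/2) ^ n"
        using j by (simp flip: power_add)
      also have "4 * A\<^sup>2 * (1/2) ^ n * (4 * W) * lorentz \<xi> \<le> 4 * A\<^sup>2 * (1/2) ^ n * (4 * W) * 1"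
        using W_nonneg by (intro mult_left_mono lorentz_le_1) auto
      finally show ?thesis by simp
    qed
    have "cmod (of_real \<epsilon> ^ n * ?c n \<tau>) \<le> (\<Sum>j\<le>n. 4 * A\<^sup>2 * (1/2) ^ n * (4 * W))"
      unfolding sum_distrib_left by (rule sum_norm_le) (rule each)
    then show ?thesis by (simp add: mult_ac add.commute)
  qed
  have h_le: "cmod (?h n \<tau>) \<le> ?C n * indicator {0..t} \<tau>" for n \<tau>
  proof (cases "\<tau> \<in> {0..t}")
    case True
    have "cmod (evol p (t - \<tau>) \<xi> * (of_real \<epsilon> ^ n * ?c n \<tau>)) \<le> 1 * ?C n"
      unfolding norm_mult[of "evol p (t - \<tau>) \<xi>"]
      using True t by (intro mult_mono norm_evol_le c_le) auto
    then show ?thesis using True by simp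
  qed simp
  have "(\<lambda>n. integral\<^sup>L lborel (?h n)) sums (LINT \<tau>|lborel. (\<Sum>n. ?h n \<tau>))"
  proof (rule sums_integral_dominated(1)[OF _ _ h_le])
    show "integrable lborel (\<lambda>\<tau>. indicator {0..t} \<tau> :: real)"
      by (rule integrable_real_indicator) (use t in auto)
    show "summable ?C" by (intro summable_mult summable_mult2 summable_power_geometric)
  qed measurable
  moreover have "(\<Sum>n. ?h n \<tau>) = indicator {0..t} \<tau> *\<^sub>R (evol p (t - \<tau>) \<xi> * conv (Z \<tau>) (Z \<tau>) \<xi>)" for \<tau>
  proof (cases "\<tau> \<in> {0..t}")
    case True
    then have "\<tau> \<in> {0..T}" using t by auto
    from sums_mult[OF conv_Z_sums[OF this, of \<xi>], of "evol p (t - \<tau>) \<xi>"] True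
    show ?thesis by (simp add: sums_iff)
  qed simp
  ultimately have I: "(\<lambda>n. integral\<^sup>L lborel (?h n)) sums
      (LINT \<tau>:{0..t}|lborel. evol p (t - \<tau>) \<xi> * conv (Z \<tau>) (Z \<tau>) \<xi>)"
    by (simp only: set_lebesgue_integral_def)
  have h_int: "integral\<^sup>L lborel (?h n) = of_real \<epsilon> ^ n * (LINT \<tau>:{0..t}|lborel. evol p (t - \<tau>) \<xi> * ?c n \<tau>)" for n
    unfolding set_lebesgue_integral_def
    by (subst integral_mult_right_zero[symmetric]) (simp add: scaleR_conv_of_real mult_ac)
  have "(\<lambda>n. - of_real \<epsilon> * (\<i> * of_real \<xi> / (4 * of_real pi)) * integral\<^sup>L lborel (?h n)) sums
      (- of_real \<epsilon> * (\<i> * of_real \<xi> / (4 * of_real pi)) *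
        (LINT \<tau>:{0..t}|lborel. evol p (t - \<tau>) \<xi> * conv (Z \<tau>) (Z \<tau>) \<xi>))"
    by (rule sums_mult[OF I])
  moreover have "- of_real \<epsilon> * (\<i> * of_real \<xi> / (4 * of_real pi)) * integral\<^sup>L lborel (?h n)
      = of_real \<epsilon> ^ Suc n * a (Suc n) t \<xi>" for n
    by (simp add: h_int)
  ultimately have S: "(\<lambda>n. of_real \<epsilon> ^ Suc n * a (Suc n) t \<xi>) sums
      (- of_real \<epsilon> * (\<i> * of_real \<xi> / (4 * of_real pi)) *
        (LINT \<tau>:{0..t}|lborel. evol p (t - \<tau>) \<xi> * conv (Z \<tau>) (Z \<tau>) \<xi>))"
    by (simp only:)
  have S_eq: "(\<Sum>n. of_real \<epsilon> ^ Suc n * a (Suc n) t \<xi>) = Z t \<xi> - evol p t \<xi> * f \<xi>"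
    unfolding Z_def
    by (subst suminf_split_head) (rule summable_norm_cancel[OF term_summable[OF t]], simp)
  have "Z t \<xi> - evol p t \<xi> * f \<xi> = - of_real \<epsilon> * (\<i> * of_real \<xi> / (4 * of_real pi)) *
        (LINT \<tau>:{0..t}|lborel. evol p (t - \<tau>) \<xi> * conv (Z \<tau>) (Z \<tau>) \<xi>)"
    unfolding S_eq[symmetric] by (rule sums_unique[OF S, symmetric])
  then have "Z t \<xi> = - of_real \<epsilon> * (\<i> * of_real \<xi> / (4 * of_real pi)) *
        (LINT \<tau>:{0..t}|lborel. evol p (t - \<tau>) \<xi> * conv (Z \<tau>) (Z \<tau>) \<xi>) + evol p t \<xi> * f \<xi>"
    by (simp only: diff_eq_eq)
  then show ?thesis by simp
qed

lemma rapid_datum: "rapid (\<lambda>\<xi>. of_real \<epsilon> * f \<xi>)"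
  unfolding rapid_def
proof (intro conjI allI exI)
  show "(\<lambda>\<xi>. of_real \<epsilon> * f \<xi>) \<in> borel_measurable borel" by measurable
  fix k \<xi>
  show "\<bar>\<xi>\<bar> ^ k * cmod (of_real \<epsilon> * f \<xi>) \<le> R ^ k * (\<bar>\<epsilon>\<bar> * A)"
  proof (cases "R < \<bar>\<xi>\<bar>")
    case True
    then show ?thesis using f_supp A_nonneg R_nonneg by simp
  next
    case False
    have "cmod (f \<xi>) \<le> A * 1"
      by (rule order_trans[OF f_le]) (intro mult_left_mono lorentz_le_1 A_nonneg)
    then show ?thesis
      unfolding norm_mult using False R_nonneg by (intro mult_mono power_mono) (auto intro: mult_left_mono)
  qed
qed

lemma hermitian_datum: "hermitian (\<lambda>\<xi>. of_real \<epsilon> * f \<xi>)"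
  using f_herm by (simp add: hermitian_def)

lemma rapid_solution: "t \<in> {0..T} \<Longrightarrow> rapid (\<lambda>\<xi>. of_real \<epsilon> * Z t \<xi>)"
proof -
  assume t: "t \<in> {0..T}"
  have "Z t \<in> borel_measurable borel"
    using measurable_compose[OF measurable_Pair1' Z_measurable, of t] by simp
  then have "rapid (Z t)" using Z_decay t unfolding rapid_def by blast
  then show ?thesis
    by (rule rapid_dominated[of _ _ "\<bar>\<epsilon>\<bar>"]) (use \<open>Z t \<in> _\<close> in \<open>auto simp: norm_mult\<close>)
qed

lemma hermitian_solution: "t \<in> {0..T} \<Longrightarrow> hermitian (\<lambda>\<xi>. of_real \<epsilon> * Z t \<xi>)"
  using Z_hermitian by (simp add: hermitian_def)

theorem solution:
  "is_solution p T (rift (\<lambda>\<xi>. of_real \<epsilon> * f \<xi>)) (\<lambda>t. rift (\<lambda>\<xi>. of_real \<epsilon> * Z t \<xi>))"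
proof (rule mild_solution)
  show "(\<lambda>(t, \<xi>). of_real \<epsilon> * Z t \<xi>) \<in> borel_measurable (borel \<Otimes>\<^sub>M borel)" by measurable
  show "\<exists>C. \<forall>t\<in>{0..T}. \<forall>\<xi>. \<bar>\<xi>\<bar> ^ k * cmod (of_real \<epsilon> * Z t \<xi>) \<le> C" for k
  proof -
    obtain C where C: "\<And>t \<xi>. t \<in> {0..T} \<Longrightarrow> \<bar>\<xi>\<bar> ^ k * cmod (Z t \<xi>) \<le> C"
      using Z_decay[of k] by blast
    have "\<bar>\<xi>\<bar> ^ k * cmod (of_real \<epsilon> * Z t \<xi>) \<le> \<bar>\<epsilon>\<bar> * C" if "t \<in> {0..T}" for t \<xi>
      using mult_left_mono[OF C[OF that, of \<xi>], of "\<bar>\<epsilon>\<bar>"] by (simp add: norm_mult mult_ac)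
    then show ?thesis by blast
  qed
  fix t \<xi> assume t: "t \<in> {0..T}"
  have "conv (\<lambda>\<xi>. of_real \<epsilon> * Z \<tau> \<xi>) (\<lambda>\<xi>. of_real \<epsilon> * Z \<tau> \<xi>) \<xi> = of_real (\<epsilon>\<^sup>2) * conv (Z \<tau>) (Z \<tau>) \<xi>" for \<tau>
    unfolding conv_def
    by (subst integral_mult_right_zero[symmetric]) (simp add: power2_eq_square mult_ac)
  then have "(LINT \<tau>:{0..t}|lborel. evol p (t - \<tau>) \<xi> * conv (\<lambda>\<xi>. of_real \<epsilon> * Z \<tau> \<xi>) (\<lambda>\<xi>. of_real \<epsilon> * Z \<tau> \<xi>) \<xi>)
      = (LINT \<tau>:{0..t}|lborel. of_real (\<epsilon>\<^sup>2) * (evol p (t - \<tau>) \<xi> * conv (Z \<tau>) (Z \<tau>) \<xi>))"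
    by (simp add: mult_ac)
  also have "\<dots> = of_real (\<epsilon>\<^sup>2) * (LINT \<tau>:{0..t}|lborel. evol p (t - \<tau>) \<xi> * conv (Z \<tau>) (Z \<tau>) \<xi>)"
    by (rule set_integral_mult_right)
  finally show "of_real \<epsilon> * Z t \<xi> = evol p t \<xi> * (of_real \<epsilon> * f \<xi>) - (\<i> * of_real \<xi> / (4 * of_real pi)) *
      (LINT \<tau>:{0..t}|lborel. evol p (t - \<tau>) \<xi> * conv (\<lambda>\<xi>. of_real \<epsilon> * Z \<tau> \<xi>) (\<lambda>\<xi>. of_real \<epsilon> * Z \<tau> \<xi>) \<xi>)"
    unfolding Z_duhamel[OF t] by (simp add: right_diff_distrib power2_eq_square)
qed (use rapid_datum hermitian_datum hermitian_solution in auto)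

lemma pairing_sums:
  assumes t: "t \<in> {0..T}" and [measurable]: "w \<in> borel_measurable borel" and w: "\<And>\<xi>. cmod (w \<xi>) \<le> 1"
  shows "(\<lambda>n. of_real \<epsilon> ^ n * (LINT \<xi>|lborel. w \<xi> * a n t \<xi>)) sums (LINT \<xi>|lborel. w \<xi> * Z t \<xi>)"
proof -
  let ?g = "\<lambda>n \<xi>. w \<xi> * (of_real \<epsilon> ^ n * a n t \<xi>)"
  have "cmod (?g n \<xi>) \<le> (2 * A * (1/2) ^ n) * lorentz \<xi>" for n \<xi>
  proof -
    have "cmod (?g n \<xi>) \<le> 1 * (2 * A * (1/2) ^ n * lorentz \<xi>)"
      unfolding norm_mult[of "w \<xi>"] using A_nonneg by (intro mult_mono w term_le t) auto
    then show ?thesis by simp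
  qed
  then have "(\<lambda>n. integral\<^sup>L lborel (?g n)) sums (LINT \<xi>|lborel. (\<Sum>n. ?g n \<xi>))"
    by (rule sums_integral_dominated(1)[OF _ lorentz_integrable _ summable_half, rotated]) measurable
  moreover have "(\<Sum>n. ?g n \<xi>) = w \<xi> * Z t \<xi>" for \<xi>
    unfolding Z_def by (rule suminf_mult[OF summable_norm_cancel[OF term_summable[OF t]]])
  moreover have "integral\<^sup>L lborel (?g n) = of_real \<epsilon> ^ n * (LINT \<xi>|lborel. w \<xi> * a n t \<xi>)" for n
    by (subst integral_mult_right_zero[symmetric]) (simp only: mult_ac)
  ultimately show ?thesis by simp
qed

end

section \<open>Derivatives of the flow map along a line\<close>

lemma has_fourier_fun_scale:
  assumes "has_fourier_fun V g"
  shows "has_fourier_fun (\<lambda>\<phi>. c *\<^sub>R V \<phi>) (\<lambda>\<xi>. of_real c * g \<xi>)"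
proof -
  have "(LINT \<xi>|lborel. of_real c * g \<xi> * \<phi> \<xi>) = of_real c * (LINT \<xi>|lborel. g \<xi> * \<phi> \<xi>)" for \<phi>
    by (subst integral_mult_right_zero[symmetric]) (simp only: mult.assoc)
  then show ?thesis
    using assms by (auto simp: has_fourier_fun_def dist_fourier_def scaleR_conv_of_real mult.assoc
        intro!: integrable_mult_right)
qed

lemma sob_scale:
  assumes "sob s V g"
  shows "sob s (\<lambda>\<phi>. c *\<^sub>R V \<phi>) (\<lambda>\<xi>. of_real c * g \<xi>)"
proof -
  have "integrable lborel (\<lambda>\<xi>. c\<^sup>2 * ((1 + \<xi>\<^sup>2) powr s * (cmod (g \<xi>))\<^sup>2))"
    using assms by (intro integrable_mult_right) (auto simp: sob_def)
  then have "integrable lborel (\<lambda>\<xi>. (1 + \<xi>\<^sup>2) powr s * (cmod (of_real c * g \<xi>))\<^sup>2)"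
    by (simp add: norm_mult power_mult_distrib mult_ac)
  then show ?thesis
    using assms has_fourier_fun_scale[of V g c] by (simp only: sob_def)
qed

lemma sobolev_norm_scale:
  assumes "has_fourier_fun V g"
  shows "sobolev_norm s (\<lambda>\<phi>. c *\<^sub>R V \<phi>) = \<bar>c\<bar> * sobolev_norm s V"
proof -
  have "(LINT \<xi>|lborel. (1 + \<xi>\<^sup>2) powr s * (cmod (of_real c * g \<xi>))\<^sup>2)
      = (LINT \<xi>|lborel. c\<^sup>2 * ((1 + \<xi>\<^sup>2) powr s * (cmod (g \<xi>))\<^sup>2))"
    by (simp add: norm_mult power_mult_distrib mult_ac)
  also have "\<dots> = c\<^sup>2 * (LINT \<xi>|lborel. (1 + \<xi>\<^sup>2) powr s * (cmod (g \<xi>))\<^sup>2)"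
    by (rule integral_mult_right_zero)
  finally show ?thesis
    by (simp add: sobolev_norm_eq[OF assms] sobolev_norm_eq[OF has_fourier_fun_scale[OF assms]] real_sqrt_mult)
qed

text \<open>A bounded weight of compact frequency support defines a bounded functional on \<open>H\<^sup>s\<close>.\<close>

locale frequency_window =
  fixes s lo hi :: real and w :: "real \<Rightarrow> complex"
  assumes s_nonpos: "s \<le> 0" and window: "-1 \<le> lo" "lo < hi" "hi \<le> 1"
    and w_meas [measurable]: "w \<in> borel_measurable borel"
    and w_le: "\<And>\<xi>. cmod (w \<xi>) \<le> indicator {lo..hi} \<xi>"
begin

definition pairing :: "dist \<Rightarrow> complex" where
  "pairing V = (LINT \<xi>|lborel. w \<xi> * hat V \<xi>)"

lemma pairing_eq: "has_fourier_fun V g \<Longrightarrow> pairing V = (LINT \<xi>|lborel. w \<xi> * g \<xi>)"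
  unfolding pairing_def by (rule hat_integral_cong) measurable

lemma pairing_bound:
  assumes "sob s V g"
  shows "cmod (pairing V) \<le> sqrt ((hi - lo) * 2 powr (- s)) * sobolev_norm s V"
  using pairing_le(2)[OF assms s_nonpos window w_meas w_le] assms
  by (simp add: pairing_eq[of V g] sob_def)

lemma pairing_diff:
  assumes "sob s V g" "sob s W h"
  shows "pairing (V - W) = pairing V - pairing W"
proof -
  have V: "has_fourier_fun V g" and W: "has_fourier_fun W h" using assms by (auto simp: sob_def)
  note i = pairing_le(1)[OF assms(1) s_nonpos window w_meas w_le]
    pairing_le(1)[OF assms(2) s_nonpos window w_meas w_le]
  show ?thesis
    unfolding pairing_eq[OF V] pairing_eq[OF W] pairing_eq[OF has_fourier_fun_diff[OF V W]]
    using Bochner_Integration.integral_diff[OF i] by (simp only: right_diff_distrib)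
qed

lemma pairing_scale:
  assumes "has_fourier_fun V g"
  shows "pairing (\<lambda>\<phi>. c *\<^sub>R V \<phi>) = of_real c * pairing V"
  unfolding pairing_eq[OF assms] pairing_eq[OF has_fourier_fun_scale[OF assms]]
  by (subst integral_mult_right_zero[symmetric]) (simp only: mult.left_commute)

text \<open>Differentiability in the \<open>H\<^sup>s\<close> norm descends to the scalar function obtained by pairing, so the
  identification of derivatives of the flow reduces to one-variable calculus.\<close>

lemma pairing_derivative:
  fixes G :: "real \<Rightarrow> dist"
  assumes G: "\<And>y. \<bar>y - x\<bar> < d \<Longrightarrow> G y \<in> sobolev s" and d: "0 < d" and B: "B \<in> sobolev s"
    and diff: "\<And>e. 0 < e \<Longrightarrow> \<exists>\<delta>>0. \<forall>\<eta>. \<bar>\<eta>\<bar> < \<delta> \<longrightarrow>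
      sobolev_norm s (G (x + \<eta>) - G x - (\<lambda>\<phi>. \<eta> *\<^sub>R B \<phi>)) \<le> e * \<bar>\<eta>\<bar>"
  shows "((\<lambda>y. pairing (G y)) has_vector_derivative pairing B) (at x)"
  unfolding has_vector_derivative_def has_derivative_at_alt
proof (intro conjI allI impI)
  show "bounded_linear (\<lambda>h. h *\<^sub>R pairing B)" by (rule bounded_linear_scaleR_left)
  fix e :: real assume e: "0 < e"
  define k where "k = sqrt ((hi - lo) * 2 powr (- s))"
  have k: "0 \<le> k" using window by (simp add: k_def)
  obtain \<delta> where \<delta>: "0 < \<delta>" "\<And>\<eta>. \<bar>\<eta>\<bar> < \<delta> \<Longrightarrow>
      sobolev_norm s (G (x + \<eta>) - G x - (\<lambda>\<phi>. \<eta> *\<^sub>R B \<phi>)) \<le> e / (k + 1) * \<bar>\<eta>\<bar>"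
    using diff[of "e / (k + 1)"] e k by (metis add_nonneg_pos divide_pos_pos zero_less_one)
  show "\<exists>d>0. \<forall>y. norm (y - x) < d \<longrightarrow>
      norm (pairing (G y) - pairing (G x) - (y - x) *\<^sub>R pairing B) \<le> e * norm (y - x)"
  proof (intro exI conjI allI impI)
    show "0 < min d \<delta>" using d \<delta> by simp
    fix y assume y: "norm (y - x) < min d \<delta>"
    define \<eta> where "\<eta> = y - x"
    have yx: "y = x + \<eta>" by (simp add: \<eta>_def)
    have Gy: "sob s (G y) (hat (G y))" and Gx: "sob s (G x) (hat (G x))" and Bs: "sob s B (hat B)"
      using G[of y] G[of x] y d B by (auto intro: sobolev_sob)
    have hB: "has_fourier_fun B (hat B)" using Bs by (simp add: sob_def)
    have eq: "pairing (G y - G x - (\<lambda>\<phi>. \<eta> *\<^sub>R B \<phi>)) = pairing (G y) - pairing (G x) - \<eta> *\<^sub>R pairing B"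
      unfolding pairing_diff[OF sob_diff[OF Gy Gx] sob_scale[OF Bs]] pairing_diff[OF Gy Gx]
        pairing_scale[OF hB] by (simp add: scaleR_conv_of_real)
    have "cmod (pairing (G y - G x - (\<lambda>\<phi>. \<eta> *\<^sub>R B \<phi>))) \<le> k * sobolev_norm s (G y - G x - (\<lambda>\<phi>. \<eta> *\<^sub>R B \<phi>))"
      unfolding k_def by (rule pairing_bound[OF sob_diff[OF sob_diff[OF Gy Gx] sob_scale[OF Bs]]])
    also have "\<dots> \<le> k * (e / (k + 1) * \<bar>\<eta>\<bar>)"
      using \<delta>(2)[of \<eta>] y k by (intro mult_left_mono) (auto simp: yx)
    also have "\<dots> = (k / (k + 1)) * (e * \<bar>\<eta>\<bar>)" by simp
    also have "\<dots> \<le> 1 * (e * \<bar>\<eta>\<bar>)" using k e by (intro mult_right_mono) auto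
    finally show "norm (pairing (G y) - pairing (G x) - (y - x) *\<^sub>R pairing B) \<le> e * norm (y - x)"
      unfolding eq by (simp only: \<eta>_def real_norm_def mult_1)
  qed
qed

end

text \<open>The function differentiated is \<open>\<epsilon> \<Sum> \<epsilon>\<^sup>n l\<^sub>n\<close>, so its second derivative at zero is \<open>2 l\<^sub>1\<close>. The first
  derivative is needed on a whole neighbourhood, since that is where it is compared with the first
  Frechet derivative.\<close>

lemma powser_second_derivative:
  fixes l :: "nat \<Rightarrow> complex" and y0 :: real
  assumes y0: "0 < y0" and sm: "summable (\<lambda>n. of_real y0 ^ n * l n)"
  obtains P where
    "\<And>y. \<bar>y\<bar> < y0 \<Longrightarrow> ((\<lambda>y. of_real y * (\<Sum>n. of_real y ^ n * l n)) has_vector_derivative P y) (at y)"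
    "(P has_vector_derivative 2 * l 1) (at 0)"
proof -
  define c where "c = (\<lambda>n. case n of 0 \<Rightarrow> 0 | Suc m \<Rightarrow> l m)"
  have "summable (\<lambda>n. of_real y0 * (of_real y0 ^ n * l n))" by (rule summable_mult[OF sm])
  then have "summable (\<lambda>n. c (Suc n) * of_real y0 ^ Suc n)"
    by (simp add: c_def mult_ac)
  then have smc: "summable (\<lambda>n. c n * of_real y0 ^ n)"
    by (rule iffD1[OF summable_Suc_iff])
  have smz: "summable (\<lambda>n. c n * z ^ n)" if "norm z < y0" for z
    by (rule powser_inside[OF smc]) (use that y0 in simp)
  have d1: "((\<lambda>z. \<Sum>n. c n * z ^ n) has_field_derivative (\<Sum>n. diffs c n * z ^ n)) (at z)"
    if "norm z < y0" for z
    by (rule termdiffs_strong'[OF smz that])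
  have "((\<lambda>z. \<Sum>n. diffs c n * z ^ n) has_field_derivative (\<Sum>n. diffs (diffs c) n * 0 ^ n)) (at 0)"
    by (rule termdiffs_strong'[of y0]) (use y0 termdiff_converges[OF _ smz] in auto)
  also have "(\<Sum>n. diffs (diffs c) n * 0 ^ n) = 2 * l 1"
    by (subst powser_zero) (simp add: diffs_def c_def)
  finally have d2: "((\<lambda>z. \<Sum>n. diffs c n * z ^ n) has_field_derivative 2 * l 1) (at (of_real 0))"
    by simp
  have eq: "of_real y * (\<Sum>n. of_real y ^ n * l n) = (\<Sum>n. c n * of_real y ^ n)" if y: "\<bar>y\<bar> < y0" for y
  proof -
    have s: "summable (\<lambda>n. c n * of_real y ^ n)" by (rule smz) (use y in simp)
    show ?thesis
    proof (cases "y = 0")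
      case True
      then show ?thesis using powser_zero[of c] by (simp add: c_def)
    next
      case False
      have "summable (\<lambda>n. c (Suc n) * of_real y ^ Suc n)" by (rule iffD2[OF summable_Suc_iff s])
      from summable_mult[OF this, of "inverse (of_real y)"]
      have "summable (\<lambda>n. of_real y ^ n * l n)" using False by (simp add: c_def field_simps)
      then have "of_real y * (\<Sum>n. of_real y ^ n * l n) = (\<Sum>n. of_real y * (of_real y ^ n * l n))"
        by (rule suminf_mult[symmetric])
      also have "\<dots> = (\<Sum>n. c (Suc n) * of_real y ^ Suc n)" by (simp add: c_def mult_ac)
      also have "\<dots> = (\<Sum>n. c n * of_real y ^ n)" using suminf_split_head[OF s] by (simp add: c_def)
      finally show ?thesis .
    qed
  qed
  show ?thesis
  proof
    fix y :: real assume y: "\<bar>y\<bar> < y0"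
    have "((\<lambda>y. \<Sum>n. c n * of_real y ^ n) has_vector_derivative (\<Sum>n. diffs c n * of_real y ^ n)) (at y)"
      by (rule has_vector_derivative_real_field[OF d1]) (use y in simp)
    then show "((\<lambda>y. of_real y * (\<Sum>n. of_real y ^ n * l n)) has_vector_derivative
        (\<lambda>y. \<Sum>n. diffs c n * of_real y ^ n) y) (at y)"
      by (rule has_vector_derivative_transform_within_open[of _ _ _ "{-y0<..<y0}"]) (use y eq in auto)
  next
    show "((\<lambda>y. \<Sum>n. diffs c n * of_real y ^ n) has_vector_derivative 2 * l 1) (at (0::real))"
      using has_vector_derivative_real_field[OF d2] by simp
  qed
qed

lemma rift_scale: "rift (\<lambda>\<xi>. of_real c * g \<xi>) x = c * rift g x"
proof -
  have "(LINT \<xi>|lborel. exp (\<i> * of_real (x * \<xi>)) * (of_real c * g \<xi>))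
      = of_real c * (LINT \<xi>|lborel. exp (\<i> * of_real (x * \<xi>)) * g \<xi>)"
    by (subst integral_mult_right_zero[symmetric]) (simp only: mult.left_commute)
  then have "ift (\<lambda>\<xi>. of_real c * g \<xi>) x = of_real c * ift g x"
    unfolding ift_def by simp
  then show ?thesis by (simp add: rift_def)
qed

lemma dist_of_rift_scale:
  "dist_of (rift (\<lambda>\<xi>. of_real c * g \<xi>)) = (\<lambda>\<phi>. c *\<^sub>R dist_of (rift g) \<phi>)"
proof
  fix \<phi>
  have "(LINT x|lborel. complex_of_real (c * rift g x) * \<phi> x)
      = of_real c * (LINT x|lborel. of_real (rift g x) * \<phi> x)"
    by (subst integral_mult_right_zero[symmetric]) (simp only: of_real_mult mult.assoc)
  then show "dist_of (rift (\<lambda>\<xi>. of_real c * g \<xi>)) \<phi> = c *\<^sub>R dist_of (rift g) \<phi>"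
    by (simp add: dist_of_def rift_scale[abs_def] scaleR_conv_of_real)
qed

text \<open>For small \<open>\<epsilon>\<close> the function \<open>F(\<epsilon>)\<close> is the pairing of the flow at \<open>\<epsilon> h\<close>. Differentiability of the
  flow at \<open>\<epsilon> h\<close> gives that \<open>F'(\<epsilon>)\<close> is the pairing of \<open>D (\<epsilon> h) h\<close>. Differentiability of \<open>D\<close> at the origin in the
  operator norm gives that \<open>F''(0)\<close> is the pairing of \<open>B h h\<close>. Taylor's formula along
  the line is thereby avoided.\<close>

theorem (in band_limited) second_derivative_of_flow:
  assumes win: "frequency_window s lo hi w"
    and t: "t \<in> {0..T}" and T: "0 \<le> T" and r: "\<rho> \<le> r" and \<rho>: "0 < \<rho>"
    and \<Phi>: "\<Phi> \<in> sobolev_ball s r \<rightarrow> sobolev s" and ext: "extends_flow p T s r t \<Phi>"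
    and D: "\<And>v. v \<in> sobolev_ball s \<rho> \<Longrightarrow> has_frechet s \<Phi> v (D v)"
    and D2: "has_frechet_op s D 0 B"
  defines "h \<equiv> dist_of (rift f)"
  shows "2 * (LINT \<xi>|lborel. w \<xi> * a 1 t \<xi>) = frequency_window.pairing w (B h h)"
proof -
  interpret frequency_window s lo hi w by (rule win)
  have f_rapid: "rapid f" and f_h: "hermitian f"
  proof -
    interpret small_amplitude p A R f 0 1 by unfold_locales simp_all
    show "rapid f" using rapid_datum by simp
    show "hermitian f" by (rule f_herm)
  qed
  have h: "h \<in> sobolev s" unfolding h_def by (rule rift_sobolev[OF f_rapid f_h])
  have hF: "has_fourier_fun h f" unfolding h_def by (rule has_fourier_fun_rift[OF f_rapid f_h])
  define v where "v = (\<lambda>e::real. (\<lambda>\<phi>. e *\<^sub>R h \<phi>))"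
  have v_eq: "v e = dist_of (rift (\<lambda>\<xi>. of_real e * f \<xi>))" for e
    unfolding v_def h_def dist_of_rift_scale ..
  have v_add: "v (x + y) = v x + v y" for x y by (simp add: v_def fun_eq_iff scaleR_add_left)
  have v_0: "v 0 = 0" by (simp add: v_def fun_eq_iff)
  have rh: "rapid (\<lambda>\<xi>. of_real e * f \<xi>)" "hermitian (\<lambda>\<xi>. of_real e * f \<xi>)" for e
  proof -
    interpret small_amplitude p A R f 0 e by unfold_locales simp_all
    show "rapid (\<lambda>\<xi>. of_real e * f \<xi>)" by (rule rapid_datum)
    show "hermitian (\<lambda>\<xi>. of_real e * f \<xi>)" by (rule hermitian_datum)
  qed
  have v_sob: "v e \<in> sobolev s" for e unfolding v_eq by (rule rift_sobolev[OF rh])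
  define H where "H = sobolev_norm s h"
  have H: "0 \<le> H" unfolding H_def by (rule sobolev_norm_nonneg)
  have v_norm: "sobolev_norm s (v e) = \<bar>e\<bar> * H" for e
    unfolding v_def H_def by (rule sobolev_norm_scale[OF hF])
  define q where "q = T * (4 * K * A + 1)"
  have q: "0 \<le> q" using T K_nonneg A_nonneg by (simp add: q_def)
  \<comment> \<open>Below this amplitude the series converges and the datum stays in the ball where the flow is differentiable.\<close>
  define y0 where "y0 = min (1 / (2 * q + 1)) (\<rho> / (H + 1))"
  have y0: "0 < y0" using q \<rho> H by (simp add: y0_def add_nonneg_pos)
  have small: "\<bar>e\<bar> * q \<le> 1 / 2" if "\<bar>e\<bar> \<le> y0" for e
  proof -
    have "\<bar>e\<bar> * q \<le> (1 / (2 * q + 1)) * q" using that q by (intro mult_right_mono) (auto simp: y0_def)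
    also have "\<dots> \<le> 1 / 2" using q by (simp add: field_simps)
    finally show ?thesis .
  qed
  have v_ball: "v e \<in> sobolev_ball s \<rho>" if "\<bar>e\<bar> \<le> y0" for e
  proof -
    have "\<bar>e\<bar> * H \<le> (\<rho> / (H + 1)) * H" using that H by (intro mult_right_mono) (auto simp: y0_def)
    also have "\<dots> < \<rho>" using \<rho> H by (simp add: field_simps)
    finally show ?thesis using v_sob by (simp add: sobolev_ball_def v_norm)
  qed
  define l where "l = (\<lambda>n. LINT \<xi>|lborel. w \<xi> * a n t \<xi>)"
  have w1: "cmod (w \<xi>) \<le> 1" for \<xi> by (rule order_trans[OF w_le]) (simp add: indicator_def)
  define F where "F = (\<lambda>y::real. of_real y * (\<Sum>n. of_real y ^ n * l n))"
  have flow: "pairing (\<Phi> (v e)) = F e \<and> summable (\<lambda>n. of_real e ^ n * l n)" if e: "\<bar>e\<bar> \<le> y0" for e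
  proof -
    interpret S: small_amplitude p A R f T e
      by unfold_locales (use T small[OF e] in \<open>auto simp: q_def\<close>)
    have "v e \<in> sobolev_ball s r" using v_ball[OF e] r by (auto simp: sobolev_ball_def)
    then have "\<Phi> (v e) = dist_of (rift (\<lambda>\<xi>. of_real e * S.Z t \<xi>))"
      using ext S.solution rift_H_infinity[OF rh] unfolding extends_flow_def v_eq by blast
    then have "pairing (\<Phi> (v e)) = (LINT \<xi>|lborel. w \<xi> * (of_real e * S.Z t \<xi>))"
      using pairing_eq[OF has_fourier_fun_rift[OF S.rapid_solution[OF t] S.hermitian_solution[OF t]]] by simp
    also have "\<dots> = of_real e * (LINT \<xi>|lborel. w \<xi> * S.Z t \<xi>)"
      by (subst integral_mult_right_zero[symmetric]) (simp only: mult.left_commute)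
    finally show ?thesis
      using S.pairing_sums[OF t w_meas w1] by (simp add: F_def l_def sums_iff)
  qed
  obtain P where P: "\<And>y. \<bar>y\<bar> < y0 \<Longrightarrow> (F has_vector_derivative P y) (at y)"
    and P0: "(P has_vector_derivative 2 * l 1) (at 0)"
    using powser_second_derivative[OF y0, of l] flow[of y0] y0 unfolding F_def by auto
  have D_lin: "sob_linear s (D (v e))" if "\<bar>e\<bar> \<le> y0" for e
    using D[OF v_ball[OF that]] by (simp add: has_frechet_def sob_bounded_linear_def)
  have D_h: "D (v e) h \<in> sobolev s" if "\<bar>e\<bar> \<le> y0" for e
    using D_lin[OF that] h by (auto simp: sob_linear_def)
  have first: "pairing (D (v e) h) = P e" if e: "\<bar>e\<bar> < y0" for e
  proof -
    have "((\<lambda>y. pairing (\<Phi> (v y))) has_vector_derivative pairing (D (v e) h)) (at e)"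
    proof (rule pairing_derivative[where d="y0 - \<bar>e\<bar>"])
      show "\<Phi> (v y) \<in> sobolev s" if "\<bar>y - e\<bar> < y0 - \<bar>e\<bar>" for y
      proof -
        have "\<bar>y\<bar> \<le> y0" using that by linarith
        from v_ball[OF this] r have "v y \<in> sobolev_ball s r" by (auto simp: sobolev_ball_def)
        then show ?thesis using \<Phi> by auto
      qed
      show "0 < y0 - \<bar>e\<bar>" using e by simp
      show "D (v e) h \<in> sobolev s" using D_h e by simp
      fix \<epsilon> :: real assume \<epsilon>: "0 < \<epsilon>"
      obtain \<delta> where \<delta>: "0 < \<delta>" "\<And>k. k \<in> sobolev_ball s \<delta> \<Longrightarrow>
          sobolev_norm s (\<Phi> (v e + k) - \<Phi> (v e) - D (v e) k) \<le> \<epsilon> / (H + 1) * sobolev_norm s k"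
        using D[OF v_ball[of e]] e \<epsilon> H unfolding has_frechet_def
        by (metis add_nonneg_pos divide_pos_pos less_imp_le zero_less_one)
      show "\<exists>\<delta>>0. \<forall>\<eta>. \<bar>\<eta>\<bar> < \<delta> \<longrightarrow>
          sobolev_norm s (\<Phi> (v (e + \<eta>)) - \<Phi> (v e) - (\<lambda>\<phi>. \<eta> *\<^sub>R D (v e) h \<phi>)) \<le> \<epsilon> * \<bar>\<eta>\<bar>"
      proof (intro exI conjI allI impI)
        show "0 < \<delta> / (H + 1)" using \<delta> H by (simp add: add_nonneg_pos)
        fix \<eta> assume "\<bar>\<eta>\<bar> < \<delta> / (H + 1)"
        then have "\<bar>\<eta>\<bar> * (H + 1) < \<delta>" using H by (simp add: pos_less_divide_eq add_nonneg_pos)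
        then have "v \<eta> \<in> sobolev_ball s \<delta>" using v_sob by (simp add: sobolev_ball_def v_norm distrib_left)
        from \<delta>(2)[OF this]
        have "sobolev_norm s (\<Phi> (v e + v \<eta>) - \<Phi> (v e) - D (v e) (v \<eta>)) \<le> (H / (H + 1)) * (\<epsilon> * \<bar>\<eta>\<bar>)"
          by (simp add: v_norm mult_ac)
        also have "\<dots> \<le> 1 * (\<epsilon> * \<bar>\<eta>\<bar>)" using H \<epsilon> by (intro mult_right_mono) auto
        also have "D (v e) (v \<eta>) = (\<lambda>\<phi>. \<eta> *\<^sub>R D (v e) h \<phi>)"
          using D_lin[of e] e h by (simp add: sob_linear_def v_def)
        finally show "sobolev_norm s (\<Phi> (v (e + \<eta>)) - \<Phi> (v e) - (\<lambda>\<phi>. \<eta> *\<^sub>R D (v e) h \<phi>)) \<le> \<epsilon> * \<bar>\<eta>\<bar>"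
          by (simp only: v_add mult_1)
      qed
    qed
    then have "(F has_vector_derivative pairing (D (v e) h)) (at e)"
      by (rule has_vector_derivative_transform_within_open[of _ _ _ "{-y0<..<y0}"]) (use e flow in auto)
    then show ?thesis using P[OF e] by (rule vector_derivative_unique_at)
  qed
  have B_lin: "sob_linear s (\<lambda>k. B k h)" "sob_linear s (B h)"
    using D2 h by (auto simp: has_frechet_op_def sob_bounded_bilinear_def)
  have "((\<lambda>y. pairing (D (v y) h)) has_vector_derivative pairing (B h h)) (at 0)"
  proof (rule pairing_derivative[where d=y0])
    show "D (v y) h \<in> sobolev s" if "\<bar>y - 0\<bar> < y0" for y using D_h[of y] that by simp
    show "B h h \<in> sobolev s" using B_lin h by (auto simp: sob_linear_def)
    fix \<epsilon> :: real assume \<epsilon>: "0 < \<epsilon>"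
    have H2: "0 < H * H + 1" using H by (simp add: add_nonneg_pos)
    obtain \<delta> where \<delta>: "0 < \<delta>" "\<And>k. k \<in> sobolev_ball s \<delta> \<Longrightarrow>
        sobolev_norm s (D (0 + k) h - D 0 h - B k h) \<le> \<epsilon> / (H * H + 1) * sobolev_norm s k * sobolev_norm s h"
      using D2 h \<epsilon> H2 unfolding has_frechet_op_def by (metis divide_pos_pos)
    show "\<exists>\<delta>>0. \<forall>\<eta>. \<bar>\<eta>\<bar> < \<delta> \<longrightarrow>
        sobolev_norm s (D (v (0 + \<eta>)) h - D (v 0) h - (\<lambda>\<phi>. \<eta> *\<^sub>R B h h \<phi>)) \<le> \<epsilon> * \<bar>\<eta>\<bar>"
    proof (intro exI conjI allI impI)
      show "0 < \<delta> / (H + 1)" using \<delta> H by (simp add: add_nonneg_pos)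
      fix \<eta> assume "\<bar>\<eta>\<bar> < \<delta> / (H + 1)"
      then have "\<bar>\<eta>\<bar> * (H + 1) < \<delta>" using H by (simp add: pos_less_divide_eq add_nonneg_pos)
      then have "v \<eta> \<in> sobolev_ball s \<delta>" using v_sob by (simp add: sobolev_ball_def v_norm distrib_left)
      from \<delta>(2)[OF this]
      have "sobolev_norm s (D (0 + v \<eta>) h - D 0 h - B (v \<eta>) h) \<le> (H * H / (H * H + 1)) * (\<epsilon> * \<bar>\<eta>\<bar>)"
        by (simp add: v_norm H_def[symmetric] mult_ac)
      also have "\<dots> \<le> 1 * (\<epsilon> * \<bar>\<eta>\<bar>)" using H2 \<epsilon> by (intro mult_right_mono) (auto simp: divide_le_eq)
      also have "B (v \<eta>) h = (\<lambda>\<phi>. \<eta> *\<^sub>R B h h \<phi>)"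
        using B_lin(1) h by (simp add: sob_linear_def v_def)
      finally show "sobolev_norm s (D (v (0 + \<eta>)) h - D (v 0) h - (\<lambda>\<phi>. \<eta> *\<^sub>R B h h \<phi>)) \<le> \<epsilon> * \<bar>\<eta>\<bar>"
        by (simp only: v_0 add_0 mult_1)
    qed
  qed (rule y0)
  then have "(P has_vector_derivative pairing (B h h)) (at 0)"
    by (rule has_vector_derivative_transform_within_open[of _ _ _ "{-y0<..<y0}"]) (use first y0 in auto)
  then show ?thesis
    using P0 vector_derivative_unique_at unfolding l_def by blast
qed

section \<open>The high-high-to-low interaction\<close>

lemma cos_lower: "1 - x\<^sup>2 / 2 \<le> cos (x::real)"
proof -
  have "(sin (x / 2))\<^sup>2 \<le> (x / 2)\<^sup>2"
    using abs_sin_x_le_abs_x[of "x / 2"] by (simp only: abs_le_square_iff)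
  then show ?thesis
    using cos_double_sin[of "x / 2"] by (simp add: power_divide)
qed

text \<open>The cosine is replaced by its quadratic minorant, and \<open>\<tau>\<^sup>2 lam\<^sup>2 exp (- lam \<tau>)\<close> is bounded by a multiple of
  \<open>exp (- lam \<tau> / 2)\<close>. The minorant depends on \<open>\<alpha>\<close> and \<open>b\<close> only through \<open>lam\<close> and \<open>\<beta>\<close>, hence is the same for
  all interacting frequencies; it may be negative for large \<open>\<tau>\<close>, but its time integral is positive.\<close>

lemma damped_cos_lower:
  fixes lam :: real
  assumes "0 < lam" "lam \<le> \<alpha>" "\<alpha> \<le> 8 * lam" "\<bar>b\<bar> \<le> \<beta> * lam" "0 \<le> \<tau>"
  shows "exp (- (8 * lam * \<tau>)) - 4 * \<beta>\<^sup>2 * exp (- (lam / 2 * \<tau>)) \<le> exp (- (\<tau> * \<alpha>)) * cos (\<tau> * b)"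
proof -
  define y where "y = lam * \<tau> / 2"
  have y: "0 \<le> y" using assms by (simp add: y_def)
  have "(\<tau> * b)\<^sup>2 \<le> (\<tau> * (\<beta> * lam))\<^sup>2"
  proof -
    have "\<bar>\<tau> * b\<bar> \<le> \<bar>\<tau> * (\<beta> * lam)\<bar>"
      using mult_left_mono[OF assms(4,5)] abs_ge_self[of "\<tau> * (\<beta> * lam)"] assms(5)
      unfolding abs_mult[of \<tau> b] by simp
    then show ?thesis by (simp only: abs_le_square_iff)
  qed
  then have tb: "(\<tau> * b)\<^sup>2 / 2 \<le> \<beta>\<^sup>2 * (2 * y\<^sup>2)"
    by (simp add: y_def power_mult_distrib power_divide mult_ac)
  have "2 * y\<^sup>2 \<le> 4 * exp y"
    using exp_lower_Taylor_quadratic[OF y] y by simp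
  then have "(\<tau> * b)\<^sup>2 / 2 \<le> \<beta>\<^sup>2 * (4 * exp y)"
    using tb by (meson mult_left_mono order_trans zero_le_power2)
  then have "exp (- (\<tau> * \<alpha>)) * ((\<tau> * b)\<^sup>2 / 2) \<le> exp (- (2 * y)) * (\<beta>\<^sup>2 * (4 * exp y))"
    using assms by (intro mult_mono) (auto simp: y_def mult.commute[of \<tau>] mult_right_mono)
  also have "\<dots> = 4 * \<beta>\<^sup>2 * (exp (- (2 * y)) * exp y)" by simp
  also have "exp (- (2 * y)) * exp y = exp (- (lam / 2 * \<tau>))" by (simp add: y_def flip: exp_add)
  finally have q: "exp (- (\<tau> * \<alpha>)) * ((\<tau> * b)\<^sup>2 / 2) \<le> 4 * \<beta>\<^sup>2 * exp (- (lam / 2 * \<tau>))" .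
  have "exp (- (8 * lam * \<tau>)) \<le> exp (- (\<tau> * \<alpha>))"
    using assms by (simp add: mult.commute[of \<tau>] mult_right_mono)
  then have "exp (- (8 * lam * \<tau>)) - 4 * \<beta>\<^sup>2 * exp (- (lam / 2 * \<tau>))
      \<le> exp (- (\<tau> * \<alpha>)) - exp (- (\<tau> * \<alpha>)) * ((\<tau> * b)\<^sup>2 / 2)"
    using q by linarith
  also have "\<dots> = exp (- (\<tau> * \<alpha>)) * (1 - (\<tau> * b)\<^sup>2 / 2)" by (simp add: right_diff_distrib)
  also have "\<dots> \<le> exp (- (\<tau> * \<alpha>)) * cos (\<tau> * b)"
    by (intro mult_left_mono cos_lower) simp
  finally show ?thesis .
qed

lemma set_integral_exp:
  fixes c t :: real
  assumes "0 < c" "0 \<le> t"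
  shows "set_integrable lborel {0..t} (\<lambda>\<tau>. exp (- (c * \<tau>)))"
    and "(LINT \<tau>:{0..t}|lborel. exp (- (c * \<tau>))) = (1 - exp (- (c * t))) / c"
proof -
  show "set_integrable lborel {0..t} (\<lambda>\<tau>. exp (- (c * \<tau>)))"
    by (rule borel_integrable_atLeastAtMost') (intro continuous_intros)
  have "(LINT \<tau>|lborel. exp (- (c * \<tau>)) * indicator {0..t} \<tau>)
      = - exp (- (c * t)) / c - (- exp (- (c * 0)) / c)"
    by (rule integral_FTC_Icc_real[where F="\<lambda>\<tau>. - exp (- (c * \<tau>)) / c"])
       (use assms in \<open>auto intro!: derivative_eq_intros continuous_intros\<close>)
  then show "(LINT \<tau>:{0..t}|lborel. exp (- (c * \<tau>))) = (1 - exp (- (c * t))) / c"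
    by (simp add: set_lebesgue_integral_def mult.commute diff_divide_distrib)
qed

text \<open>The choice of \<open>\<gamma>\<close> is made for the last bound: the resonance function is at most \<open>6 \<gamma> N\<^sup>2\<close>, which is
  then \<open>\<beta> N powr p\<close>. The damping rate is comparable to \<open>N powr p\<close> because the output frequency \<open>\<xi>\<close> is below \<open>N\<close>.\<close>

lemma resonance_bounds:
  fixes p N \<gamma> \<beta> \<xi> \<eta> \<zeta> :: real
  assumes p: "0 \<le> p" "p \<le> 2" and N: "1 \<le> N" and \<gamma>: "\<gamma> = \<beta> * N powr (p - 2) / 6" "\<gamma> \<le> 1"
    and \<xi>: "0 < \<xi>" "\<xi> \<le> \<gamma> / 2" and sum: "\<eta> + \<zeta> = \<xi>"
    and \<eta>: "N \<le> \<bar>\<eta>\<bar>" "\<bar>\<eta>\<bar> \<le> N + \<gamma>" and \<zeta>: "N \<le> \<bar>\<zeta>\<bar>" "\<bar>\<zeta>\<bar> \<le> N + \<gamma>"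
  shows "N powr p \<le> \<bar>\<eta>\<bar> powr p + \<bar>\<zeta>\<bar> powr p - \<bar>\<xi>\<bar> powr p"
    and "\<bar>\<eta>\<bar> powr p + \<bar>\<zeta>\<bar> powr p - \<bar>\<xi>\<bar> powr p \<le> 8 * N powr p"
    and "\<bar>\<eta> ^ 3 + \<zeta> ^ 3 - \<xi> ^ 3\<bar> \<le> \<beta> * N powr p"
proof -
  have "\<bar>\<xi>\<bar> powr p \<le> N powr p" using \<xi> \<gamma> N p by (intro powr_mono2) auto
  moreover have "N powr p \<le> \<bar>\<eta>\<bar> powr p" "N powr p \<le> \<bar>\<zeta>\<bar> powr p"
    using \<eta> \<zeta> N p by (auto intro!: powr_mono2)
  ultimately show "N powr p \<le> \<bar>\<eta>\<bar> powr p + \<bar>\<zeta>\<bar> powr p - \<bar>\<xi>\<bar> powr p" by linarith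
  have le2N: "\<bar>\<eta>\<bar> \<le> 2 * N" "\<bar>\<zeta>\<bar> \<le> 2 * N" using \<eta> \<zeta> \<gamma> N by linarith+
  have "(2 * N) powr p \<le> 4 * N powr p"
  proof -
    have "(2::real) powr p \<le> 2 powr 2" using p by (intro powr_mono) auto
    then show ?thesis using N by (simp add: powr_mult mult_right_mono)
  qed
  moreover have "\<bar>\<eta>\<bar> powr p \<le> (2 * N) powr p" "\<bar>\<zeta>\<bar> powr p \<le> (2 * N) powr p"
    using le2N p by (auto intro!: powr_mono2)
  moreover have "0 \<le> \<bar>\<xi>\<bar> powr p" by simp
  ultimately show "\<bar>\<eta>\<bar> powr p + \<bar>\<zeta>\<bar> powr p - \<bar>\<xi>\<bar> powr p \<le> 8 * N powr p" by linarith
  have "\<eta> ^ 3 + \<zeta> ^ 3 - \<xi> ^ 3 = - 3 * \<xi> * \<eta> * \<zeta>"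
    unfolding sum[symmetric] by (simp add: power3_eq_cube algebra_simps)
  then have "\<bar>\<eta> ^ 3 + \<zeta> ^ 3 - \<xi> ^ 3\<bar> = 3 * \<xi> * (\<bar>\<eta>\<bar> * \<bar>\<zeta>\<bar>)"
    using \<xi> by (simp add: abs_mult)
  also have "\<dots> \<le> 3 * (\<gamma> / 2) * ((2 * N) * (2 * N))"
    using \<xi> le2N N by (intro mult_mono) auto
  also have "\<dots> = \<beta> * (N powr (p - 2) * N\<^sup>2)" by (simp add: \<gamma>(1) power2_eq_square)
  also have "N powr (p - 2) * N\<^sup>2 = N powr p"
  proof -
    have "N\<^sup>2 = N powr 2" using N by simp
    then have "N powr (p - 2) * N\<^sup>2 = N powr (p - 2 + 2)" by (simp only: powr_add)
    then show ?thesis by simp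
  qed
  finally show "\<bar>\<eta> ^ 3 + \<zeta> ^ 3 - \<xi> ^ 3\<bar> \<le> \<beta> * N powr p" .
qed

definition band :: "real \<Rightarrow> real \<Rightarrow> real set" where
  "band N \<gamma> = {\<xi>. N \<le> \<bar>\<xi>\<bar> \<and> \<bar>\<xi>\<bar> \<le> N + \<gamma>}"

lemma band_measurable [measurable]: "band N \<gamma> \<in> sets borel"
proof -
  have "band N \<gamma> = {\<xi> \<in> space borel. N \<le> \<bar>\<xi>\<bar> \<and> \<bar>\<xi>\<bar> \<le> N + \<gamma>}" by (simp add: band_def)
  also have "\<dots> \<in> sets borel" by measurable
  finally show ?thesis .
qed

lemma band_limited_indicator:
  assumes "0 \<le> N" "0 \<le> \<gamma>"
  shows "band_limited (1 + (N + \<gamma>)\<^sup>2) (N + \<gamma>) (indicator (band N \<gamma>))"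
proof
  show "(indicator (band N \<gamma>) :: real \<Rightarrow> complex) \<in> borel_measurable borel" by measurable
  show "cmod (indicator (band N \<gamma>) \<xi>) \<le> (1 + (N + \<gamma>)\<^sup>2) * lorentz \<xi>" for \<xi>
  proof (cases "\<xi> \<in> band N \<gamma>")
    case True
    then have "\<bar>\<xi>\<bar> \<le> \<bar>N + \<gamma>\<bar>" using assms by (simp add: band_def)
    then have "\<xi>\<^sup>2 \<le> (N + \<gamma>)\<^sup>2" by (simp only: abs_le_square_iff)
    then have "(1 + \<xi>\<^sup>2) * lorentz \<xi> \<le> (1 + (N + \<gamma>)\<^sup>2) * lorentz \<xi>" by (intro mult_right_mono) auto
    moreover have "(1 + \<xi>\<^sup>2) * lorentz \<xi> = 1"
      using lorentz_pos[of \<xi>] by (simp add: lorentz_def)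
    ultimately show ?thesis using True by simp
  qed simp
  show "indicator (band N \<gamma>) \<xi> = (0::complex)" if "N + \<gamma> < \<bar>\<xi>\<bar>" for \<xi>
    using that by (simp add: band_def)
  show "hermitian (indicator (band N \<gamma>))"
    by (simp add: hermitian_def indicator_def band_def)
qed (use assms in auto)

lemma band_self_convolution:
  assumes "0 \<le> N" "0 \<le> \<xi>" "\<xi> \<le> \<gamma> / 2"
  shows "integrable lborel (\<lambda>\<eta>. indicator (band N \<gamma>) \<eta> * indicator (band N \<gamma>) (\<xi> - \<eta>) :: real)"
    and "\<gamma> / 2 \<le> (LINT \<eta>|lborel. indicator (band N \<gamma>) \<eta> * indicator (band N \<gamma>) (\<xi> - \<eta>))"
proof -
  let ?g = "\<lambda>\<eta>. indicator (band N \<gamma>) \<eta> * indicator (band N \<gamma>) (\<xi> - \<eta>) :: real"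
  show int: "integrable lborel ?g"
  proof (rule integrable_dominated)
    show "integrable lborel (\<lambda>\<eta>. indicator {-(N + \<gamma>)..N + \<gamma>} \<eta> :: real)"
      by (rule integrable_real_indicator) (use assms in auto)
    show "norm (?g \<eta>) \<le> indicator {-(N + \<gamma>)..N + \<gamma>} \<eta>" for \<eta>
      by (auto simp: indicator_def band_def)
  qed measurable
  have "\<gamma> / 2 \<le> (LINT \<eta>|lborel. indicator {N + \<xi>..N + \<gamma>} \<eta>)"
    using assms by simp
  also have "\<dots> \<le> integral\<^sup>L lborel ?g"
  proof (rule integral_mono[OF _ int])
    show "integrable lborel (\<lambda>\<eta>. indicator {N + \<xi>..N + \<gamma>} \<eta> :: real)"
      by (rule integrable_real_indicator) (use assms in auto)
    show "indicator {N + \<xi>..N + \<gamma>} \<eta> \<le> ?g \<eta>" for \<eta>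
      using assms by (auto simp: indicator_def band_def)
  qed
  finally show "\<gamma> / 2 \<le> integral\<^sup>L lborel ?g" .
qed

text \<open>The phase cancels the linear evolution of the output frequency together with the factor \<open>- \<i>\<close> from
  the derivative, so that the integrand of the pairing has positive real part up to the resonance.\<close>

definition low_window :: "real \<Rightarrow> real \<Rightarrow> real \<Rightarrow> complex" where
  "low_window \<gamma> t \<xi> = indicator {\<gamma> / 4..\<gamma> / 2} \<xi> * (\<i> * exp (- (\<i> * of_real (t * \<xi> ^ 3))))"

lemma low_window_measurable [measurable]: "low_window \<gamma> t \<in> borel_measurable borel"
  unfolding low_window_def[abs_def] by measurable

lemma norm_low_window: "cmod (low_window \<gamma> t \<xi>) = indicator {\<gamma> / 4..\<gamma> / 2} \<xi>"
  by (simp add: low_window_def norm_mult indicator_def)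

text \<open>For fixed \<open>\<xi>\<close> in the window, the interaction of \<open>\<eta>\<close> and \<open>\<xi> - \<eta>\<close> at time \<open>\<tau>\<close> is bounded below by \<open>H(\<tau>)\<close>,
  independent of \<open>\<eta>\<close>. Integrating first in \<open>\<eta>\<close> gives a factor at least \<open>\<gamma> / 2\<close>, then in \<open>\<tau>\<close> a factor at least
  \<open>\<kappa> / N powr p\<close>, and the derivative contributes \<open>\<xi> \<ge> \<gamma> / 4\<close>. The condition on \<open>\<beta>\<close> ensures that the second
  exponential in \<open>H\<close> takes away at most half of the contribution of the first.\<close>

lemma second_iterate_lower_bound:
  fixes p N \<gamma> \<beta> t :: real
  assumes p: "0 \<le> p" "p \<le> 2" and N: "1 \<le> N" and \<beta>: "0 < \<beta>"
    and \<gamma>: "\<gamma> = \<beta> * N powr (p - 2) / 6" "\<gamma> \<le> 1"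
    and t: "0 < t" and \<beta>t: "128 * \<beta>\<^sup>2 \<le> 1 - exp (- (8 * t))"
  shows "\<gamma> ^ 3 * ((1 - exp (- (8 * t))) / 16) * exp (- t) / (128 * pi * N powr p)
    \<le> Re (LINT \<xi>|lborel. low_window \<gamma> t \<xi> * duhamel p (indicator (band N \<gamma>)) 1 t \<xi>)"
proof -
  have \<gamma>0: "0 < \<gamma>" using \<beta> N by (simp add: \<gamma>(1))
  define A where "A = 1 + (N + \<gamma>)\<^sup>2"
  define f where "f = (indicator (band N \<gamma>) :: real \<Rightarrow> complex)"
  define ch where "ch = (indicator (band N \<gamma>) :: real \<Rightarrow> real)"
  have f_ch: "f \<xi> = of_real (ch \<xi>)" for \<xi> by (simp add: f_def ch_def indicator_def)
  have [measurable]: "ch \<in> borel_measurable borel" by (simp add: ch_def)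
  interpret band_limited p A "N + \<gamma>" f
    unfolding A_def f_def by (rule band_limited_indicator) (use N \<gamma>0 in auto)
  define lam where "lam = N powr p"
  have lam: "1 \<le> lam" using ge_one_powr_ge_zero[OF N p(1)] by (simp add: lam_def)
  define \<kappa> where "\<kappa> = (1 - exp (- (8 * t))) / 16"
  have \<kappa>: "0 < \<kappa>" using t by (simp add: \<kappa>_def)
  define H where "H = (\<lambda>\<tau>. exp (- (8 * lam * \<tau>)) - 4 * \<beta>\<^sup>2 * exp (- (lam / 2 * \<tau>)))"
  have H_int: "set_integrable lborel {0..t} H"
    unfolding H_def using lam t
    by (intro set_integral_diff set_integral_exp set_integrable_mult_right) auto
  have H_ge: "\<kappa> / lam \<le> (LINT \<tau>:{0..t}|lborel. H \<tau>)"
  proof -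
    have "(LINT \<tau>:{0..t}|lborel. H \<tau>)
        = (1 - exp (- (8 * lam * t))) / (8 * lam) - 4 * \<beta>\<^sup>2 * ((1 - exp (- (lam / 2 * t))) / (lam / 2))"
    proof -
      note e1 = set_integral_exp[of "8 * lam" t] and e2 = set_integral_exp[of "lam / 2" t]
      have "(LINT \<tau>:{0..t}|lborel. H \<tau>) = (LINT \<tau>:{0..t}|lborel. exp (- (8 * lam * \<tau>)))
          - (LINT \<tau>:{0..t}|lborel. 4 * \<beta>\<^sup>2 * exp (- (lam / 2 * \<tau>)))"
        unfolding H_def
        by (intro set_integral_diff set_integrable_mult_right e1 e2) (use lam t in auto)
      also have "(LINT \<tau>:{0..t}|lborel. 4 * \<beta>\<^sup>2 * exp (- (lam / 2 * \<tau>)))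
          = 4 * \<beta>\<^sup>2 * (LINT \<tau>:{0..t}|lborel. exp (- (lam / 2 * \<tau>)))"
        by (rule set_integral_mult_right)
      finally show ?thesis using e1(2) e2(2) lam t by simp
    qed
    moreover have "4 * \<beta>\<^sup>2 * ((1 - exp (- (lam / 2 * t))) / (lam / 2)) \<le> 4 * \<beta>\<^sup>2 * (1 / (lam / 2))"
      using lam by (intro mult_left_mono divide_right_mono) auto
    moreover have "(1 - exp (- (8 * t))) / (8 * lam) \<le> (1 - exp (- (8 * lam * t))) / (8 * lam)"
      using lam t by (intro divide_right_mono) auto
    moreover have "4 * \<beta>\<^sup>2 * (1 / (lam / 2)) \<le> \<kappa> / lam"
      using lam \<beta>t by (simp add: \<kappa>_def divide_simps)
    moreover have "(1 - exp (- (8 * t))) / (8 * lam) = 2 * (\<kappa> / lam)"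
      using lam by (simp add: \<kappa>_def field_simps)
    ultimately show ?thesis by linarith
  qed
  have pointwise: "\<gamma>\<^sup>2 * \<kappa> * exp (- t) / (32 * pi * lam) \<le> Re (low_window \<gamma> t \<xi> * a 1 t \<xi>)"
    if \<xi>: "\<xi> \<in> {\<gamma> / 4..\<gamma> / 2}" for \<xi>
  proof -
    have \<xi>0: "0 < \<xi>" using \<xi> \<gamma>0 by auto
    define X where "X = \<bar>\<xi>\<bar> powr p"
    have X: "X \<le> 1"
    proof -
      have "\<bar>\<xi>\<bar> powr p \<le> 1 powr p" using \<xi> \<gamma> \<xi>0 p by (intro powr_mono2) auto
      then show ?thesis by (simp add: X_def)
    qed
    define c where "c = (\<lambda>\<tau>. exp (- (\<i> * of_real (t * \<xi> ^ 3))) * evol p (t - \<tau>) \<xi>)"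
    have c_le: "cmod (c \<tau>) \<le> 1" if "\<tau> \<le> t" for \<tau>
      using norm_evol_le[of "t - \<tau>" p \<xi>] that by (simp add: c_def norm_mult)
    define m where "m = (LINT \<eta>|lborel. ch \<eta> * ch (\<xi> - \<eta>))"
    have m_int: "integrable lborel (\<lambda>\<eta>. ch \<eta> * ch (\<xi> - \<eta>))" and m: "\<gamma> / 2 \<le> m"
      unfolding m_def ch_def using band_self_convolution[of N \<xi> \<gamma>] N \<xi> \<xi>0 by auto
    have kernel: "exp (- (t * X)) * H \<tau> * (ch \<eta> * ch (\<xi> - \<eta>)) \<le> Re (c \<tau> * (a 0 \<tau> \<eta> * a 0 \<tau> (\<xi> - \<eta>)))"
      if \<tau>: "0 \<le> \<tau>" for \<tau> \<eta>
    proof (cases "\<eta> \<in> band N \<gamma> \<and> \<xi> - \<eta> \<in> band N \<gamma>")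
      case False
      then show ?thesis by (auto simp: ch_def f_ch)
    next
      case True
      define b where "b = \<eta> ^ 3 + (\<xi> - \<eta>) ^ 3 - \<xi> ^ 3"
      define \<alpha> where "\<alpha> = \<bar>\<eta>\<bar> powr p + \<bar>\<xi> - \<eta>\<bar> powr p - X"
      have bounds: "lam \<le> \<alpha>" "\<alpha> \<le> 8 * lam" "\<bar>b\<bar> \<le> \<beta> * lam"
        unfolding lam_def \<alpha>_def b_def X_def
        by (rule resonance_bounds[OF p N \<gamma> \<xi>0]; use True \<xi> in \<open>simp add: band_def\<close>)+
      have "c \<tau> * (evol p \<tau> \<eta> * evol p \<tau> (\<xi> - \<eta>))
          = exp (of_real (- (t * X) - \<tau> * \<alpha>) + \<i> * of_real (\<tau> * b))"
        unfolding c_def evol_def exp_add[symmetric] X_def[symmetric] \<alpha>_def b_def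
        by (rule arg_cong[where f=exp]) (simp add: algebra_simps X_def)
      also have "Re \<dots> = exp (- (t * X)) * (exp (- (\<tau> * \<alpha>)) * cos (\<tau> * b))"
        by (simp add: Re_exp flip: exp_add)
      finally have "Re (c \<tau> * (a 0 \<tau> \<eta> * a 0 \<tau> (\<xi> - \<eta>))) = exp (- (t * X)) * (exp (- (\<tau> * \<alpha>)) * cos (\<tau> * b))"
        using True by (simp add: f_def)
      moreover have "exp (- (t * X)) * H \<tau> \<le> exp (- (t * X)) * (exp (- (\<tau> * \<alpha>)) * cos (\<tau> * b))"
        unfolding H_def using lam by (intro mult_left_mono damped_cos_lower bounds \<tau>) auto
      ultimately show ?thesis using True by (simp add: ch_def)
    qed
    have conv_int: "integrable lborel (\<lambda>\<eta>. a 0 \<tau> \<eta> * a 0 \<tau> (\<xi> - \<eta>))"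
      and conv_le: "cmod (conv (a 0 \<tau>) (a 0 \<tau>) \<xi>) \<le> A * A * (4 * integral\<^sup>L lborel lorentz) * lorentz \<xi>"
      if \<tau>: "0 \<le> \<tau>" for \<tau>
      using conv_integrable[of "a 0 \<tau>" "a 0 \<tau>" A A \<xi>] a_bound[OF \<tau>, of 0] A_nonneg by auto
    have inner: "exp (- (t * X)) * m * H \<tau> \<le> Re (c \<tau> * conv (a 0 \<tau>) (a 0 \<tau>) \<xi>)" if \<tau>: "0 \<le> \<tau>" for \<tau>
    proof -
      have i: "integrable lborel (\<lambda>\<eta>. c \<tau> * (a 0 \<tau> \<eta> * a 0 \<tau> (\<xi> - \<eta>)))"
        by (rule integrable_mult_right[OF conv_int[OF \<tau>]])
      have "exp (- (t * X)) * m * H \<tau> = (LINT \<eta>|lborel. exp (- (t * X)) * H \<tau> * (ch \<eta> * ch (\<xi> - \<eta>)))"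
        unfolding m_def by (subst integral_mult_right_zero) simp
      also have "\<dots> \<le> (LINT \<eta>|lborel. Re (c \<tau> * (a 0 \<tau> \<eta> * a 0 \<tau> (\<xi> - \<eta>))))"
        by (intro integral_mono integrable_mult_right m_int kernel \<tau> integrable_Re i)
      also have "\<dots> = Re (LINT \<eta>|lborel. c \<tau> * (a 0 \<tau> \<eta> * a 0 \<tau> (\<xi> - \<eta>)))"
        by (rule integral_bounded_linear[OF bounded_linear_Re i])
      also have "(LINT \<eta>|lborel. c \<tau> * (a 0 \<tau> \<eta> * a 0 \<tau> (\<xi> - \<eta>))) = c \<tau> * conv (a 0 \<tau>) (a 0 \<tau>) \<xi>"
        unfolding conv_def by (rule integral_mult_right_zero)
      finally show ?thesis .
    qed
    define Q where "Q = (\<lambda>\<tau>. c \<tau> * conv (a 0 \<tau>) (a 0 \<tau>) \<xi>)"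
    have Q_meas: "Q \<in> borel_measurable borel"
    proof -
      have "(\<lambda>\<tau>. conv (a 0 \<tau>) (a 0 \<tau>) \<xi>) \<in> borel_measurable borel"
        using measurable_compose[OF measurable_Pair2' conv_sum_measurable[of 0], of \<xi>] by simp
      then show ?thesis unfolding Q_def c_def by measurable
    qed
    have Q_int: "set_integrable lborel {0..t} Q"
    proof (rule set_integral_power_bound(1)[OF Q_meas])
      show "cmod (Q \<tau>) \<le> (1 * (A * A * (4 * integral\<^sup>L lborel lorentz) * lorentz \<xi>)) * \<tau> ^ 0"
        if "0 \<le> \<tau>" "\<tau> \<le> t" for \<tau>
        unfolding Q_def norm_mult using mult_mono[OF c_le[OF that(2)] conv_le[OF that(1)]] by simp
    qed (use t in simp)
    have "exp (- t) * (\<gamma> / 2) * (\<kappa> / lam) \<le> exp (- (t * X)) * m * (LINT \<tau>:{0..t}|lborel. H \<tau>)"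
    proof (intro mult_mono[OF mult_mono[OF _ m] H_ge])
      show "exp (- t) \<le> exp (- (t * X))" using X t by (simp add: mult_left_le)
      have "0 \<le> m" using m \<gamma>0 by linarith
      then show "0 \<le> exp (- (t * X)) * m" by simp
    qed (use \<gamma>0 \<kappa> lam in auto)
    also have "\<dots> = (LINT \<tau>:{0..t}|lborel. exp (- (t * X)) * m * H \<tau>)"
      by (rule set_integral_mult_right[symmetric])
    also have "\<dots> \<le> (LINT \<tau>:{0..t}|lborel. Re (Q \<tau>))"
    proof (rule set_integral_mono)
      show "set_integrable lborel {0..t} (\<lambda>\<tau>. exp (- (t * X)) * m * H \<tau>)"
        by (rule set_integrable_mult_right[OF H_int])
      show "set_integrable lborel {0..t} (\<lambda>\<tau>. Re (Q \<tau>))"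
        using integrable_Re[OF Q_int[unfolded set_integrable_def]] by (simp add: set_integrable_def)
    qed (use inner in \<open>auto simp: Q_def\<close>)
    also have "\<dots> = Re (LINT \<tau>:{0..t}|lborel. Q \<tau>)"
      using integral_bounded_linear[OF bounded_linear_Re Q_int[unfolded set_integrable_def]]
      by (simp add: set_lebesgue_integral_def)
    finally have ReQ: "exp (- t) * (\<gamma> / 2) * (\<kappa> / lam) \<le> Re (LINT \<tau>:{0..t}|lborel. Q \<tau>)" .
    have "(LINT \<tau>:{0..t}|lborel. Q \<tau>) = exp (- (\<i> * of_real (t * \<xi> ^ 3))) *
        (LINT \<tau>:{0..t}|lborel. evol p (t - \<tau>) \<xi> * conv (a 0 \<tau>) (a 0 \<tau>) \<xi>)"
      unfolding Q_def c_def mult.assoc by (rule set_integral_mult_right)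
    then have "low_window \<gamma> t \<xi> * a 1 t \<xi> = of_real (\<xi> / (4 * pi)) * (LINT \<tau>:{0..t}|lborel. Q \<tau>)"
      using \<xi> by (simp add: low_window_def mult_ac del: duhamel.simps(1))
    then have Re_eq: "Re (low_window \<gamma> t \<xi> * a 1 t \<xi>) = \<xi> / (4 * pi) * Re (LINT \<tau>:{0..t}|lborel. Q \<tau>)"
      by simp
    have lower: "(\<gamma> / 4) / (4 * pi) * (exp (- t) * (\<gamma> / 2) * (\<kappa> / lam))
        \<le> \<xi> / (4 * pi) * Re (LINT \<tau>:{0..t}|lborel. Q \<tau>)"
      using \<xi> \<gamma>0 \<kappa> lam by (intro mult_mono[OF _ ReQ] divide_right_mono) auto
    have "\<gamma>\<^sup>2 * \<kappa> * exp (- t) / (32 * pi * lam) = (\<gamma> / 4) / (4 * pi) * (exp (- t) * (\<gamma> / 2) * (\<kappa> / lam))"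
      by (simp add: power2_eq_square mult_ac)
    then show ?thesis unfolding Re_eq using lower by (simp only:)
  qed
  have a_int: "integrable lborel (\<lambda>\<xi>. low_window \<gamma> t \<xi> * a 1 t \<xi>)"
  proof (rule integrable_le_lorentz)
    show "norm (low_window \<gamma> t \<xi> * a 1 t \<xi>) \<le> (majorant A K 1 * t ^ 1) * lorentz \<xi>" for \<xi>
    proof -
      have "norm (low_window \<gamma> t \<xi> * a 1 t \<xi>) \<le> 1 * (majorant A K 1 * t ^ 1 * lorentz \<xi>)"
        unfolding norm_mult norm_low_window using t
        by (intro mult_mono a_bound) (auto simp: indicator_def)
      then show ?thesis by simp
    qed
  qed measurable
  let ?L = "\<gamma>\<^sup>2 * \<kappa> * exp (- t) / (32 * pi * lam)"
  have "\<gamma> / 4 * ?L = (LINT \<xi>|lborel. ?L * indicator {\<gamma> / 4..\<gamma> / 2} \<xi>)"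
    using \<gamma>0 by (simp add: mult_ac)
  also have "\<dots> \<le> (LINT \<xi>|lborel. Re (low_window \<gamma> t \<xi> * a 1 t \<xi>))"
  proof (rule integral_mono[OF _ integrable_Re[OF a_int]])
    show "integrable lborel (\<lambda>\<xi>. ?L * indicator {\<gamma> / 4..\<gamma> / 2} \<xi>)"
      by (intro integrable_mult_right integrable_real_indicator) (use \<gamma>0 in auto)
    show "?L * indicator {\<gamma> / 4..\<gamma> / 2} \<xi> \<le> Re (low_window \<gamma> t \<xi> * a 1 t \<xi>)" for \<xi>
      using pointwise[of \<xi>] by (cases "\<xi> \<in> {\<gamma> / 4..\<gamma> / 2}") (auto simp: low_window_def)
  qed
  also have "\<dots> = Re (LINT \<xi>|lborel. low_window \<gamma> t \<xi> * a 1 t \<xi>)"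
    by (rule integral_bounded_linear[OF bounded_linear_Re a_int])
  finally show ?thesis
    by (simp add: f_def \<kappa>_def lam_def power2_eq_square power3_eq_cube mult_ac)
qed

section \<open>Unboundedness of the second derivative\<close>

lemma band_sobolev_norm:
  assumes N: "0 < N" and \<gamma>: "0 \<le> \<gamma>" and s: "s \<le> 0" and V: "has_fourier_fun V (indicator (band N \<gamma>))"
  shows "(sobolev_norm s V)\<^sup>2 \<le> 2 * \<gamma> * N powr (2 * s)"
proof -
  let ?g = "\<lambda>\<xi>. (1 + \<xi>\<^sup>2) powr s * (cmod (indicator (band N \<gamma>) \<xi>))\<^sup>2"
  let ?u = "\<lambda>\<xi>. N powr (2 * s) * (indicator {N..N + \<gamma>} \<xi> + indicator {-(N + \<gamma>)..- N} \<xi> :: real)"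
  have i: "integrable lborel (\<lambda>\<xi>. indicator {N..N + \<gamma>} \<xi> :: real)"
    "integrable lborel (\<lambda>\<xi>. indicator {-(N + \<gamma>)..- N} \<xi> :: real)"
    by (intro integrable_real_indicator; use \<gamma> in simp)+
  have ui: "integrable lborel ?u"
    by (intro integrable_mult_right Bochner_Integration.integrable_add i)
  have le: "?g \<xi> \<le> ?u \<xi>" for \<xi>
  proof (cases "\<xi> \<in> band N \<gamma>")
    case True
    then have "\<bar>N\<bar> \<le> \<bar>\<xi>\<bar>" using N by (simp add: band_def)
    then have "N\<^sup>2 \<le> \<xi>\<^sup>2" by (simp only: abs_le_square_iff)
    then have "(1 + \<xi>\<^sup>2) powr s \<le> (N\<^sup>2) powr s" using s N by (intro powr_mono2') auto
    also have "(N\<^sup>2) powr s = N powr (2 * s)"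
    proof -
      have "N\<^sup>2 = N powr 2" using N by simp
      then show ?thesis by (simp only: powr_powr)
    qed
    finally have "(1 + \<xi>\<^sup>2) powr s \<le> N powr (2 * s)" .
    moreover have "1 \<le> (indicator {N..N + \<gamma>} \<xi> + indicator {-(N + \<gamma>)..- N} \<xi> :: real)"
      using True by (auto simp: band_def indicator_def)
    ultimately have "(1 + \<xi>\<^sup>2) powr s * 1 \<le> ?u \<xi>" by (intro mult_mono) auto
    then show ?thesis using True by simp
  qed simp
  have "(sobolev_norm s V)\<^sup>2 = integral\<^sup>L lborel ?g"
    unfolding sobolev_norm_eq[OF V]
    by (rule real_sqrt_pow2) (intro Bochner_Integration.integral_nonneg, simp)
  also have "\<dots> \<le> integral\<^sup>L lborel ?u"
  proof (rule integral_mono[OF _ ui le])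
    show "integrable lborel ?g"
      by (rule integrable_dominated[OF ui]) (measurable, use le in simp)
  qed
  also have "\<dots> = 2 * \<gamma> * N powr (2 * s)"
    using \<gamma> i by simp
  finally show ?thesis .
qed

theorem mainTheorem3:
  fixes p s :: real
  assumes "0 \<le> p" and "p \<le> 2" and "s < p / 4 - 3 / 2"
  shows "\<not> (\<exists>T>0. \<exists>r>0. \<forall>t\<in>{0..T}. \<exists>\<Phi>. \<Phi> \<in> sobolev_ball s r \<rightarrow> sobolev s \<and>
            extends_flow p T s r t \<Phi> \<and> C2_at_origin s r \<Phi>)"
proof
  assume "\<exists>T>0. \<exists>r>0. \<forall>t\<in>{0..T}. \<exists>\<Phi>. \<Phi> \<in> sobolev_ball s r \<rightarrow> sobolev s \<and>
            extends_flow p T s r t \<Phi> \<and> C2_at_origin s r \<Phi>"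
  then obtain T r \<Phi> where T: "0 < T" and \<Phi>: "\<Phi> \<in> sobolev_ball s r \<rightarrow> sobolev s"
    and ext: "extends_flow p T s r T \<Phi>" and C2: "C2_at_origin s r \<Phi>"
    by (meson atLeastAtMost_iff less_imp_le order_refl)
  obtain \<rho> D D2 where \<rho>: "0 < \<rho>" "\<rho> \<le> r"
    and fre: "\<And>v. v \<in> sobolev_ball s \<rho> \<Longrightarrow> has_frechet s \<Phi> v (D v) \<and> has_frechet_op s D v (D2 v)"
    using C2 unfolding C2_at_origin_def by blast
  have s: "s \<le> 0" using assms by linarith
  have zero: "(0::dist) \<in> sobolev_ball s \<rho>"
  proof -
    have r0: "rapid (\<lambda>_. 0)" "hermitian (\<lambda>_. 0)" by (auto simp: rapid_def hermitian_def)
    have "dist_of (rift (\<lambda>_. 0)) = 0"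
      by (simp add: dist_of_def rift_def ift_def fun_eq_iff)
    moreover have "sobolev_norm s (dist_of (rift (\<lambda>_. 0))) = 0"
      by (simp add: sobolev_norm_eq[OF has_fourier_fun_rift[OF r0]])
    ultimately show ?thesis
      using rift_sobolev[OF r0, of s] \<rho> by (simp add: sobolev_ball_def)
  qed
  define B where "B = D2 0"
  have B: "has_frechet_op s D 0 B" using fre[OF zero] by (simp add: B_def)
  then obtain C where C: "\<And>h k. h \<in> sobolev s \<Longrightarrow> k \<in> sobolev s \<Longrightarrow>
      sobolev_norm s (B h k) \<le> C * sobolev_norm s h * sobolev_norm s k"
    unfolding has_frechet_op_def sob_bounded_bilinear_def by blast
  define \<kappa> where "\<kappa> = (1 - exp (- (8 * T))) / 16"
  have \<kappa>: "0 < \<kappa>" using T by (simp add: \<kappa>_def)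
  \<comment> \<open>Independent of \<open>N\<close>: the largest value allowed by the lower bound at time \<open>T\<close>.\<close>
  define \<beta> where "\<beta> = sqrt (\<kappa> / 8)"
  have \<beta>: "0 < \<beta>" using \<kappa> by (simp add: \<beta>_def)
  have \<beta>2: "128 * \<beta>\<^sup>2 \<le> 1 - exp (- (8 * T))" using \<kappa> by (simp add: \<beta>_def \<kappa>_def)
  have \<beta>1: "\<beta> \<le> 1"
  proof -
    have "(1 - y) / 16 / 8 \<le> 1" if "0 \<le> y" for y :: real using that by (simp add: divide_le_eq)
    from this[OF exp_ge_zero] have "\<kappa> / 8 \<le> 1" unfolding \<kappa>_def .
    then show ?thesis unfolding \<beta>_def by simp
  qed
  define c0 where "c0 = \<kappa> * exp (- T) / (64 * pi)"
  define c1 where "c1 = sqrt (2 powr (- s)) * \<bar>C\<bar>"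
  have c0: "0 < c0" using \<kappa> by (simp add: c0_def)
  have main: "c0 * \<gamma> powr (3/2) \<le> c1 * N powr (p + 2 * s)"
    if N: "1 \<le> N" and \<gamma>: "\<gamma> = \<beta> * N powr (p - 2) / 6" for N \<gamma>
  proof -
    have \<gamma>0: "0 < \<gamma>" using \<beta> N by (simp add: \<gamma>)
    have "N powr (p - 2) \<le> N powr 0" using N assms by (intro powr_mono) auto
    then have "\<beta> * N powr (p - 2) \<le> 1 * 1" using N \<beta> \<beta>1 by (intro mult_mono) auto
    then have \<gamma>1: "\<gamma> \<le> 1" by (simp add: \<gamma>)
    interpret band_limited p "1 + (N + \<gamma>)\<^sup>2" "N + \<gamma>" "indicator (band N \<gamma>)"
      by (rule band_limited_indicator) (use N \<gamma>0 in auto)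
    have win: "frequency_window s (\<gamma> / 4) (\<gamma> / 2) (low_window \<gamma> T)"
      by unfold_locales (use s \<gamma>0 \<gamma>1 in \<open>auto simp: norm_low_window\<close>)
    interpret frequency_window s "\<gamma> / 4" "\<gamma> / 2" "low_window \<gamma> T" by (rule win)
    have rh: "rapid (indicator (band N \<gamma>))"
    proof -
      interpret small_amplitude p "1 + (N + \<gamma>)\<^sup>2" "N + \<gamma>" "indicator (band N \<gamma>)" 0 1 by unfold_locales simp_all
      show ?thesis using rapid_datum by simp
    qed
    define h where "h = dist_of (rift (indicator (band N \<gamma>)))"
    have h: "h \<in> sobolev s" unfolding h_def by (rule rift_sobolev[OF rh f_herm])
    have h_norm: "(sobolev_norm s h)\<^sup>2 \<le> 2 * \<gamma> * N powr (2 * s)"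
      by (rule band_sobolev_norm) (use N \<gamma>0 s has_fourier_fun_rift[OF rh f_herm] in \<open>auto simp: h_def\<close>)
    have Bh: "B h h \<in> sobolev s"
      using B h unfolding has_frechet_op_def sob_bounded_bilinear_def sob_linear_def by blast
    define I where "I = (LINT \<xi>|lborel. low_window \<gamma> T \<xi> * a 1 T \<xi>)"
    have I: "2 * I = pairing (B h h)"
      unfolding h_def I_def
      by (rule second_derivative_of_flow[OF win _ _ \<rho>(2,1) \<Phi> ext _ B]) (use T fre in auto)
    have "2 * Re I = Re (2 * I)" by simp
    also have "\<dots> \<le> cmod (pairing (B h h))" unfolding I by (rule complex_Re_le_cmod)
    also have "\<dots> \<le> sqrt ((\<gamma> / 2 - \<gamma> / 4) * 2 powr (- s)) * sobolev_norm s (B h h)"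
      by (rule pairing_bound[OF sobolev_sob[OF Bh]])
    also have "\<dots> \<le> sqrt ((\<gamma> / 2 - \<gamma> / 4) * 2 powr (- s)) * (\<bar>C\<bar> * (2 * \<gamma> * N powr (2 * s)))"
    proof (intro mult_left_mono)
      have "sobolev_norm s (B h h) \<le> C * (sobolev_norm s h)\<^sup>2"
        using C[OF h h] by (simp add: power2_eq_square mult.assoc)
      also have "\<dots> \<le> \<bar>C\<bar> * (2 * \<gamma> * N powr (2 * s))"
        using h_norm by (intro mult_mono) auto
      finally show "sobolev_norm s (B h h) \<le> \<bar>C\<bar> * (2 * \<gamma> * N powr (2 * s))" .
    qed (use \<gamma>0 in auto)
    also have "sqrt ((\<gamma> / 2 - \<gamma> / 4) * 2 powr (- s)) = sqrt \<gamma> * sqrt (2 powr (- s)) / 2"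
      by (simp add: real_sqrt_mult real_sqrt_divide)
    finally have "2 * Re I \<le> c1 * (\<gamma> * sqrt \<gamma>) * N powr (2 * s)"
      by (simp add: c1_def mult_ac)
    moreover have "\<gamma> ^ 3 * \<kappa> * exp (- T) / (128 * pi * N powr p) \<le> Re I"
      unfolding \<kappa>_def I_def by (rule second_iterate_lower_bound[OF assms(1,2) N \<beta> \<gamma> \<gamma>1 T \<beta>2])
    moreover have "2 * (\<gamma> ^ 3 * \<kappa> * exp (- T) / (128 * pi * N powr p)) = c0 * \<gamma> ^ 3 / N powr p"
      by (simp add: c0_def)
    ultimately have "c0 * \<gamma> ^ 3 / N powr p \<le> c1 * (\<gamma> * sqrt \<gamma>) * N powr (2 * s)" by linarith
    moreover have g32: "\<gamma> powr (3/2) = \<gamma> * sqrt \<gamma>"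
      using \<gamma>0 powr_add[of \<gamma> 1 "1/2"] by (simp add: powr_half_sqrt)
    moreover have "\<gamma> ^ 3 = (\<gamma> * sqrt \<gamma>) * (\<gamma> * sqrt \<gamma>)"
    proof -
      have "(\<gamma> * sqrt \<gamma>) * (\<gamma> * sqrt \<gamma>) = \<gamma> * \<gamma> * (sqrt \<gamma> * sqrt \<gamma>)" by (simp only: mult_ac)
      then show ?thesis using \<gamma>0 by (simp add: power3_eq_cube)
    qed
    ultimately have "(c0 * \<gamma> powr (3/2)) * \<gamma> powr (3/2) \<le> (c1 * (N powr p * N powr (2 * s))) * \<gamma> powr (3/2)"
      using N by (simp add: divide_le_eq mult_ac)
    then show ?thesis
      using \<gamma>0 by (simp add: powr_add)
  qed
  define e where "e = p / 2 - 3 - 2 * s"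
  have e: "0 < e" using assms by (simp add: e_def)
  define c2 where "c2 = c1 / (c0 * (\<beta> / 6) powr (3/2))"
  have c2: "N powr e \<le> c2" if N: "1 \<le> N" for N
  proof -
    have "(\<beta> / 6 * N powr (p - 2)) powr (3/2) = (\<beta> / 6) powr (3/2) * N powr ((p - 2) * (3/2))"
    proof -
      have "(\<beta> / 6 * N powr (p - 2)) powr (3/2) = (\<beta> / 6) powr (3/2) * (N powr (p - 2)) powr (3/2)"
        by (rule powr_mult)
      then show ?thesis by (simp only: powr_powr)
    qed
    then have "c0 * (\<beta> / 6) powr (3/2) * N powr ((p - 2) * (3/2)) \<le> c1 * N powr (p + 2 * s)"
      using main[OF N refl] by (simp add: mult.assoc)
    then have "c0 * (\<beta> / 6) powr (3/2) * N powr ((p - 2) * (3/2)) * N powr (- (p + 2 * s))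
        \<le> c1 * N powr (p + 2 * s) * N powr (- (p + 2 * s))"
      by (rule mult_right_mono) simp
    moreover have "N powr ((p - 2) * (3/2)) * N powr (- (p + 2 * s)) = N powr e"
    proof -
      have "(p - 2) * (3/2) + - (p + 2 * s) = e" by (simp add: e_def field_simps)
      then show ?thesis by (simp only: powr_add[symmetric])
    qed
    moreover have "N powr (p + 2 * s) * N powr (- (p + 2 * s)) = 1"
      using N by (simp flip: powr_add)
    ultimately have "c0 * (\<beta> / 6) powr (3/2) * N powr e \<le> c1"
      by (simp only: mult.assoc)
    then show ?thesis
      using c0 \<beta> by (simp add: c2_def le_divide_eq mult_ac)
  qed
  define N where "N = (\<bar>c2\<bar> + 1) powr (1 / e)"
  have "1 \<le> N" unfolding N_def using e by (intro ge_one_powr_ge_zero) auto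
  moreover have "N powr e = \<bar>c2\<bar> + 1" using e by (simp add: N_def powr_powr)
  ultimately show False using c2[of N] by simp
qed

end
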